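(* Let $n\ge1$. For a partial permutation $\tau\in\mathfrak{T}_n$ of rank $r$, put $s=n-r$, let $\sigma:\{j_1,\dots,j_r\}\to\{i_1,\dots,i_r\}$ be the nondegenerate part of $\tau$, and let $\{m_1<\dots<m_s\}=\{1,\dots,n\}\setminus\{j_1,\dots,j_r\}$, $\{\ell_1<\dots<\ell_s\}=\{1,\dots,n\}\setminus\{i_1,\dots,i_r\}$. Put $$T_1(\tau):=(\cdots((\mathrm{RS}_1(\sigma)\leftarrow\ell_s)\leftarrow\ell_{s-1})\cdots)\leftarrow\ell_1,\qquad T_2(\tau):=m_s\to(\cdots\to(m_2\to(m_1\to\mathrm{RS}_2(\sigma)))\cdots),\qquad \nu(\tau):=\mathrm{shape}(\mathrm{RS}_1(\sigma)).$$ (1) The generalized Steinberg map is given by $\Phi(\tau)=(\mathrm{shape}(T_1(\tau)),\mathrm{shape}(T_2(\tau)))$ for every $\tau\in\mathfrak{T}_n$. (2) The map $\tau\mapsto(T_1(\tau),T_2(\tau),\nu(\tau))$ is a bijection from $\mathfrak{T}_n$ onto the set of triples $\bigcup_{r=0}^n\Upsilon_r$. (3) If $\tau\in\mathfrak{S}_n$ is a full permutation, this bijection reduces to the classical Robinson-Schensted correspondence: $\tau$ corresponds to $(\mathrm{RS}_1(\tau),\mathrm{RS}_2(\tau),\lambda)$ where $\lambda=\mathrm{shape}(\mathrm{RS}_1(\tau))=\mathrm{shape}(\mathrm{RS}_2(\tau))$ (so $r=n$).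
   Context: **Triples.** $\mathscr{P}(n)$ is the set of partitions of $n$, identified with Young diagrams. A Young tableau of shape $\lambda$ is a filling of $\lambda$ by pairwise distinct integers increasing along rows and down columns; it is standard if its entries are $1,\dots,n$. For $0\le r\le n$, $\Upsilon_r$ is the set of triples $(T_1,T_2,\nu)$ where $T_1,T_2$ are standard tableaux of shapes $\lambda,\mu\in\mathscr{P}(n)$ respectively, and $\nu\in\mathscr{P}(r)$ satisfies $\nu\subset\lambda$, $\nu\subset\mu$ and $\lambda\setminus\nu$, $\mu\setminus\nu$ are column strips (at most one box in each row). **Partial permutations.** A partial permutation is an $n\times n$ $0/1$ matrix with at most one $1$ in each row and each column; $\mathfrak{T}_n$ is the set of these. $\tau\in\mathfrak{T}_n$ is viewed as a map $\{1,\dots,n\}\to\{0,1,\dots,n\}$ with $\tau(j)=i\ne0$ iff the $(i,j)$ entry is $1$, and $\tau(j)=0$ if column $j$ is zero. Its nondegenerate part is the restriction of $\tau$ to $\{j:\tau(j)\neq0\}$, a bijection onto its image. **Insertion.** Row insertion $(T\leftarrow a)$: if $a$ is larger than every entry of the first row, put $a$ in a new box at the end of the first row; otherwise replace the smallest entry $a_1>a$ of the first row by $a$ and insert $a_1$ by the same rule in the subtableau starting with the second row. Column insertion $(a\to T)$ is the same with rows replaced by columns. For a bijection $w:\{b_1<\dots<b_\ell\}\to A$ onto a finite set of integers, $\mathrm{RS}_1(w)$ is obtained from the empty tableau by successively row inserting $w(b_1),\dots,w(b_\ell)$, and $\mathrm{RS}_2(w)$ is the tableau of the same shape having $b_k$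 in the box created at the $k$-th step. The classical Robinson-Schensted correspondence is $w\mapsto(\mathrm{RS}_1(w),\mathrm{RS}_2(w))$ for $w\in\mathfrak{S}_n$. **Generalized Steinberg map.** Work over $\mathbb{C}$; $\mathrm{M}_n$ is the space of $n\times n$ matrices, $B\subset\mathrm{GL}_n$ the group of upper triangular matrices, $\mathfrak{n}\subset\mathrm{M}_n$ the strictly upper triangular matrices. $B\times B$ acts on $\mathrm{M}_n$ by $(b_1,b_2)\cdot x=b_1xb_2^{-1}$. The conormal variety of this action is $\mathcal{Y}_{\mathrm{M}_n}=\{(x,y)\in\mathrm{M}_n\times\mathrm{M}_n: xy\in\mathfrak{n},\ yx\in\mathfrak{n}\}$; its irreducible components are $\mathcal{Y}_\tau=\overline{\{(x,y)\in\mathcal{Y}_{\mathrm{M}_n}:x\in B\tau B\}}$ for $\tau\in\mathfrak{T}_n$. Let $\varphi(x,y)=(xy,yx)$. For $\lambda\in\mathscr{P}(n)$, $\mathcal{O}_\lambda\subset\mathrm{M}_n$ is the set of nilpotent matrices with Jordan block sizes the parts of $\lambda$. $\Phi:\mathfrak{T}_n\to\mathscr{P}(n)\times\mathscr{P}(n)$ is defined by $\Phi(\tau)=(\lambda,\mu)$ where $\overline{(\mathrm{GL}_n\times\mathrm{GL}_n)\cdot\varphi(\mathcal{Y}_\tau)}=\overline{\mathcal{O}_\lambda}\times\overline{\mathcal{O}_\mu}$ (each factor acting by conjugation). *)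

theory Defs
  imports
    "HOL-Combinatorics.Permutations"
    "Jordan_Normal_Form.Jordan_Normal_Form"
begin

section \<open>Partitions and tableaux\<close>

definition partitions :: "nat \<Rightarrow> nat list set" where
  "partitions n = {p. sorted_wrt (\<ge>) p \<and> 0 \<notin> set p \<and> sum_list p = n}"

text \<open>Boxes are (row, column), both counted from 0.\<close>

definition diagram :: "nat list \<Rightarrow> (nat \<times> nat) set" where
  "diagram p = {(i, j). i < length p \<and> j < p ! i}"

definition column_strip :: "(nat \<times> nat) set \<Rightarrow> bool" where
  "column_strip D \<longleftrightarrow> (\<forall>i. card {j. (i, j) \<in> D} \<le> 1)"

text \<open>A tableau is the list of its rows, from top to bottom; \<^const>\<open>List.transpose\<close> (from the
  list library) gives the list of its columns.\<close>

definition shape :: "'a list list \<Rightarrow> nat list" where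
  "shape T = map length T"

definition young_tableau :: "'a::linorder list list \<Rightarrow> bool" where
  "young_tableau T \<longleftrightarrow>
     shape T \<in> partitions (sum_list (shape T)) \<and>
     distinct (concat T) \<and>
     (\<forall>r\<in>set T. sorted_wrt (<) r) \<and>
     (\<forall>c\<in>set (List.transpose T). sorted_wrt (<) c)"

definition standard_tableau :: "nat \<Rightarrow> nat list list \<Rightarrow> bool" where
  "standard_tableau n T \<longleftrightarrow> young_tableau T \<and> set (concat T) = {1..n}"

definition Upsilon :: "nat \<Rightarrow> nat \<Rightarrow> (nat list list \<times> nat list list \<times> nat list) set" where
  "Upsilon n r = {(T1, T2, \<nu>).
     standard_tableau n T1 \<and> shape T1 \<in> partitions n \<and>
     standard_tableau n T2 \<and> shape T2 \<in> partitions n \<and>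
     \<nu> \<in> partitions r \<and>
     diagram \<nu> \<subseteq> diagram (shape T1) \<and> diagram \<nu> \<subseteq> diagram (shape T2) \<and>
     column_strip (diagram (shape T1) - diagram \<nu>) \<and>
     column_strip (diagram (shape T2) - diagram \<nu>)}"


section \<open>Insertion\<close>

fun row_insert :: "'a::linorder list list \<Rightarrow> 'a \<Rightarrow> 'a list list" where
  "row_insert [] a = [[a]]"
| "row_insert (r # T) a =
     (if \<forall>x\<in>set r. x < a then (r @ [a]) # T
      else let b = Min {x \<in> set r. a < x}
           in map (\<lambda>x. if x = b then a else x) r # row_insert T b)"

definition column_insert :: "'a::linorder \<Rightarrow> 'a list list \<Rightarrow> 'a list list" where
  "column_insert a T = List.transpose (row_insert (List.transpose T) a)"

text \<open>Puts a new entry at the end of row \<open>i\<close>, where \<open>i = length T\<close> starts a new row.\<close>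

definition append_to_row :: "'a \<Rightarrow> nat \<Rightarrow> 'a list list \<Rightarrow> 'a list list" where
  "append_to_row b i T = (if i < length T then T[i := T ! i @ [b]] else T @ [[b]])"

text \<open>One step for a word \<open>w\<close>, given as a map on a finite set: insert \<open>w b\<close> in the first tableau
  and record \<open>b\<close> in the box that is created.\<close>

definition RS_step ::
  "('b \<Rightarrow> 'a::linorder) \<Rightarrow> 'a list list \<times> 'b list list \<Rightarrow> 'b \<Rightarrow> 'a list list \<times> 'b list list" where
  "RS_step w PQ b =
     (let P = fst PQ; Q = snd PQ; P' = row_insert P (w b);
          box = (THE c. c \<in> diagram (shape P') - diagram (shape P))
      in (P', append_to_row b (fst box) Q))"

definition RS :: "'b::linorder set \<Rightarrow> ('b \<Rightarrow> 'a::linorder) \<Rightarrow> 'a list list \<times> 'b list list" where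
  "RS D w = foldl (RS_step w) ([], []) (sorted_list_of_set D)"

definition RS1 :: "'b::linorder set \<Rightarrow> ('b \<Rightarrow> 'a::linorder) \<Rightarrow> 'a list list" where
  "RS1 D w = fst (RS D w)"

definition RS2 :: "'b::linorder set \<Rightarrow> ('b \<Rightarrow> 'a::linorder) \<Rightarrow> 'b list list" where
  "RS2 D w = snd (RS D w)"


section \<open>Partial permutations\<close>

definition partial_perms :: "nat \<Rightarrow> complex mat set" where
  "partial_perms n = {\<tau> \<in> carrier_mat n n.
     (\<forall>i<n. \<forall>j<n. \<tau> $$ (i, j) \<in> {0, 1}) \<and>
     (\<forall>i<n. card {j. j < n \<and> \<tau> $$ (i, j) = 1} \<le> 1) \<and>
     (\<forall>j<n. card {i. i < n \<and> \<tau> $$ (i, j) = 1} \<le> 1)}"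

text \<open>The map \<open>{1..n} \<rightarrow> {0..n}\<close> of a partial permutation. Matrix indices start at 0, whereas the
  arguments and the nonzero values of the map start at 1.\<close>

definition pp_map :: "nat \<Rightarrow> complex mat \<Rightarrow> nat \<Rightarrow> nat" where
  "pp_map n \<tau> j =
     (if \<exists>i\<in>{1..n}. \<tau> $$ (i - 1, j - 1) = 1
      then THE i. i \<in> {1..n} \<and> \<tau> $$ (i - 1, j - 1) = 1 else 0)"

definition pp_dom :: "nat \<Rightarrow> complex mat \<Rightarrow> nat set" where
  "pp_dom n \<tau> = {j \<in> {1..n}. pp_map n \<tau> j \<noteq> 0}"

definition pp_img :: "nat \<Rightarrow> complex mat \<Rightarrow> nat set" where
  "pp_img n \<tau> = pp_map n \<tau> ` pp_dom n \<tau>"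

definition perm_mat :: "nat \<Rightarrow> (nat \<Rightarrow> nat) \<Rightarrow> complex mat" where
  "perm_mat n w = mat n n (\<lambda>(i, j). if w (j + 1) = i + 1 then 1 else 0)"

definition T1 :: "nat \<Rightarrow> complex mat \<Rightarrow> nat list list" where
  "T1 n \<tau> = foldl row_insert (RS1 (pp_dom n \<tau>) (pp_map n \<tau>))
                 (rev (sorted_list_of_set ({1..n} - pp_img n \<tau>)))"

definition T2 :: "nat \<Rightarrow> complex mat \<Rightarrow> nat list list" where
  "T2 n \<tau> = foldl (\<lambda>T m. column_insert m T) (RS2 (pp_dom n \<tau>) (pp_map n \<tau>))
                 (sorted_list_of_set ({1..n} - pp_dom n \<tau>))"

definition nu :: "nat \<Rightarrow> complex mat \<Rightarrow> nat list" where
  "nu n \<tau> = shape (RS1 (pp_dom n \<tau>) (pp_map n \<tau>))"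


section \<open>Zariski closure\<close>

text \<open>Polynomial functions in a given set of coordinate functions, and the Zariski closure within
  an affine space \<open>X\<close> with these coordinates: the common zeros in \<open>X\<close> of all polynomial functions
  vanishing on the set.\<close>

inductive_set poly_functions :: "('x \<Rightarrow> complex) set \<Rightarrow> ('x \<Rightarrow> complex) set"
  for coords :: "('x \<Rightarrow> complex) set" where
  const: "(\<lambda>x. c) \<in> poly_functions coords"
| coord: "f \<in> coords \<Longrightarrow> f \<in> poly_functions coords"
| add: "f \<in> poly_functions coords \<Longrightarrow> g \<in> poly_functions coords \<Longrightarrow>
    (\<lambda>x. f x + g x) \<in> poly_functions coords"
| mult: "f \<in> poly_functions coords \<Longrightarrow> g \<in> poly_functions coords \<Longrightarrow>
    (\<lambda>x. f x * g x) \<in> poly_functions coords"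

definition zariski_closure :: "'x set \<Rightarrow> ('x \<Rightarrow> complex) set \<Rightarrow> 'x set \<Rightarrow> 'x set" where
  "zariski_closure X coords S =
     {x \<in> X. \<forall>f\<in>poly_functions coords. (\<forall>y\<in>S. f y = 0) \<longrightarrow> f x = 0}"

definition mat_coords :: "nat \<Rightarrow> (complex mat \<Rightarrow> complex) set" where
  "mat_coords n = {(\<lambda>x. x $$ (i, j)) | i j. i < n \<and> j < n}"

definition closure_M :: "nat \<Rightarrow> complex mat set \<Rightarrow> complex mat set" where
  "closure_M n = zariski_closure (carrier_mat n n) (mat_coords n)"

definition closure_MM ::
  "nat \<Rightarrow> (complex mat \<times> complex mat) set \<Rightarrow> (complex mat \<times> complex mat) set" where
  "closure_MM n = zariski_closure (carrier_mat n n \<times> carrier_mat n n)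
     ((\<lambda>f. f \<circ> fst) ` mat_coords n \<union> (\<lambda>f. f \<circ> snd) ` mat_coords n)"


section \<open>The generalized Steinberg map\<close>

definition borel_group :: "nat \<Rightarrow> complex mat set" where
  "borel_group n = {b \<in> carrier_mat n n. invertible_mat b \<and> upper_triangular b}"

definition strictly_upper :: "nat \<Rightarrow> complex mat set" where
  "strictly_upper n = {x \<in> carrier_mat n n. \<forall>i<n. \<forall>j\<le>i. x $$ (i, j) = 0}"

definition conormal :: "nat \<Rightarrow> (complex mat \<times> complex mat) set" where
  "conormal n = {(x, y). x \<in> carrier_mat n n \<and> y \<in> carrier_mat n n \<and>
     x * y \<in> strictly_upper n \<and> y * x \<in> strictly_upper n}"

definition double_coset :: "nat \<Rightarrow> complex mat \<Rightarrow> complex mat set" where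
  "double_coset n \<tau> = {b1 * \<tau> * b2 | b1 b2. b1 \<in> borel_group n \<and> b2 \<in> borel_group n}"

definition Y_component :: "nat \<Rightarrow> complex mat \<Rightarrow> (complex mat \<times> complex mat) set" where
  "Y_component n \<tau> = closure_MM n {(x, y) \<in> conormal n. x \<in> double_coset n \<tau>}"

definition phi :: "complex mat \<times> complex mat \<Rightarrow> complex mat \<times> complex mat" where
  "phi = (\<lambda>(x, y). (x * y, y * x))"

text \<open>\<^const>\<open>similar_mat\<close> is conjugacy under \<open>GL\<^sub>n\<close>, so this is the saturation of a set of pairs
  under \<open>GL\<^sub>n \<times> GL\<^sub>n\<close>.\<close>

definition GL_GL_saturation ::
  "(complex mat \<times> complex mat) set \<Rightarrow> (complex mat \<times> complex mat) set" where
  "GL_GL_saturation S = {(a', b'). \<exists>(a, b)\<in>S. similar_mat a' a \<and> similar_mat b' b}"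

definition nilpotent_orbit :: "nat \<Rightarrow> nat list \<Rightarrow> complex mat set" where
  "nilpotent_orbit n p = {x \<in> carrier_mat n n. jordan_nf x (map (\<lambda>k. (k, 0)) p)}"

definition is_Steinberg_value :: "nat \<Rightarrow> complex mat \<Rightarrow> nat list \<times> nat list \<Rightarrow> bool" where
  "is_Steinberg_value n \<tau> = (\<lambda>(\<alpha>, \<beta>). \<alpha> \<in> partitions n \<and> \<beta> \<in> partitions n \<and>
     closure_MM n (GL_GL_saturation (phi ` Y_component n \<tau>)) =
       closure_M n (nilpotent_orbit n \<alpha>) \<times> closure_M n (nilpotent_orbit n \<beta>))"

definition Phi :: "nat \<Rightarrow> complex mat \<Rightarrow> nat list \<times> nat list" where
  "Phi n \<tau> = (THE p. is_Steinberg_value n \<tau> p)"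

end

theory Submission
  imports Defs "Jordan_Normal_Form.Jordan_Normal_Form_Existence" "Jordan_Normal_Form.Jordan_Normal_Form_Uniqueness"
begin

text \<open>By equivariance, \<open>\<Phi>(\<tau>)\<close> is read off from the pairs \<open>(\<tau> y, y \<tau>)\<close> with \<open>y\<close> in the fibre of the conormal
  variety over \<open>\<tau>\<close>. Each component runs through all matrices \<open>M\<close> with \<open>M\<^bsub>pq\<^esub> \<noteq> 0\<close> only if
  \<open>p < q\<close> and \<open>w\<^sub>p < w\<^sub>q\<close>, for a word \<open>w\<close> that contains every number once; here \<open>w\<close> is the word inserted
  to form the first tableau, respectively the one that forms the second tableau by column insertion from
  its right end. Such a space meets exactly one nilpotent orbit whose closure contains the whole space.
  A Knuth move removes one admissible position, whose entry a generic matrix can lose by conjugation with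
  an elementary matrix, so this generic orbit depends only on the Knuth class of \<open>w\<close>. For the reading word
  of a tableau the matrices strictly raise the column index of the boxes, and shifting the boxes along
  their rows shows that the generic orbit is given by the shape. Since orbits are separated by the ranks of
  powers, which are semicontinuous, both components are generic at once on a line in the fibre. As the
  generic orbit does not distinguish a permutation from its inverse, it also identifies the recording
  tableau with the insertion tableau of the inverse. The bijection is inverse insertion: successive
  letters are decreasing (for row insertion) exactly if the new boxes move down.\<close>

section \<open>Polynomial functions and Zariski closures\<close>

text \<open>Irreducibility enters only through affine lines: a polynomial that vanishes at all but
  finitely many points of a line vanishes on the line, and a Zariski open condition that holds at
  one point of a line fails at only finitely many. This fits the fibre over \<open>\<tau>\<close>,
  which is a linear space although the conormal variety is not. Openness is made concrete by
  determinants: an upper bound on a kernel dimension has a nonvanishing determinant as certificate,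
  a lower bound has explicit independent kernel vectors. The two suffice because a nilpotent orbit
  is determined by the kernel dimensions of all powers, and the lower bounds of the generic orbit
  hold on the whole incidence space. The order of the extra letters also has its origin in the
  fibre: an index outside the image of \<open>\<tau>\<close> is a zero row of
  \<open>\<tau> y\<close>, so it may end but never start an admissible position. Appending these
  letters in decreasing order encodes exactly this. The second word treats the zero columns of
  \<open>y \<tau>\<close> in the same way.\<close>

definition poly_on :: "'x set \<Rightarrow> ('x \<Rightarrow> complex) set \<Rightarrow> ('x \<Rightarrow> complex) \<Rightarrow> bool" where
  "poly_on X cs f \<longleftrightarrow> (\<exists>p\<in>poly_functions cs. \<forall>x\<in>X. f x = p x)"

lemma poly_on_const: "poly_on X cs (\<lambda>x. c)"
  unfolding poly_on_def by (rule bexI[OF _ poly_functions.const[of c]]) simp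

lemma poly_on_coord: "f \<in> cs \<Longrightarrow> poly_on X cs f"
  unfolding poly_on_def by (rule bexI[OF _ poly_functions.coord]) auto

lemma poly_on_add: "poly_on X cs f \<Longrightarrow> poly_on X cs g \<Longrightarrow> poly_on X cs (\<lambda>x. f x + g x)"
  unfolding poly_on_def by (metis (no_types, lifting) poly_functions.add)

lemma poly_on_mult: "poly_on X cs f \<Longrightarrow> poly_on X cs g \<Longrightarrow> poly_on X cs (\<lambda>x. f x * g x)"
  unfolding poly_on_def by (metis (no_types, lifting) poly_functions.mult)

lemma poly_on_cong: "(\<And>x. x \<in> X \<Longrightarrow> f x = g x) \<Longrightarrow> poly_on X cs f = poly_on X cs g"
  unfolding poly_on_def by auto

lemma poly_on_sum: "(\<And>i. i \<in> I \<Longrightarrow> poly_on X cs (f i)) \<Longrightarrow> poly_on X cs (\<lambda>x. \<Sum>i\<in>I. f i x)"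
  by (induct I rule: infinite_finite_induct) (auto intro: poly_on_const poly_on_add)

lemma poly_on_prod: "(\<And>i. i \<in> I \<Longrightarrow> poly_on X cs (f i)) \<Longrightarrow> poly_on X cs (\<lambda>x. \<Prod>i\<in>I. f i x)"
  by (induct I rule: infinite_finite_induct) (auto intro: poly_on_const poly_on_mult)

lemma poly_on_compose:
  assumes "poly_on Y cs f" "h \<in> X \<rightarrow> Y" "\<And>g. g \<in> cs \<Longrightarrow> poly_on X ds (\<lambda>x. g (h x))"
  shows "poly_on X ds (\<lambda>x. f (h x))"
proof -
  have *: "poly_on X ds (\<lambda>x. p (h x))" if "p \<in> poly_functions cs" for p
    using that by (induct rule: poly_functions.induct)
      (auto intro: poly_on_const poly_on_add poly_on_mult assms(3))
  obtain p where p: "p \<in> poly_functions cs" "\<forall>y\<in>Y. f y = p y"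
    using assms(1) unfolding poly_on_def by auto
  have "poly_on X ds (\<lambda>x. f (h x)) = poly_on X ds (\<lambda>x. p (h x))"
    by (rule poly_on_cong) (use p assms(2) in auto)
  thus ?thesis using *[OF p(1)] by simp
qed

lemma poly_on_line:
  assumes "poly_on UNIV {\<lambda>t. t} f"
  shows "\<exists>p. \<forall>t. f t = poly p t"
proof -
  have "\<exists>p. \<forall>t. f t = poly p t" if "f \<in> poly_functions {\<lambda>t. t}" for f
    using that
  proof (induct rule: poly_functions.induct)
    case (const c) show ?case by (rule exI[of _ "[:c:]"]) simp
  next
    case (coord f) thus ?case by (intro exI[of _ "[:0,1:]"]) simp
  next
    case (add f g)
    then obtain p q where "\<forall>t. f t = poly p t" "\<forall>t. g t = poly q t" by auto
    thus ?case by (intro exI[of _ "p + q"]) simp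
  next
    case (mult f g)
    then obtain p q where "\<forall>t. f t = poly p t" "\<forall>t. g t = poly q t" by auto
    thus ?case by (intro exI[of _ "p * q"]) simp
  qed
  thus ?thesis using assms unfolding poly_on_def by force
qed

lemma poly_on_line_finite:
  assumes "poly_on UNIV {\<lambda>t. t} f" "f a \<noteq> 0"
  shows "finite {t. f t = 0}"
proof -
  obtain p where p: "\<forall>t. f t = poly p t" using poly_on_line[OF assms(1)] by auto
  hence "p \<noteq> 0" using assms(2) by auto
  thus ?thesis using poly_roots_finite[of p] p by simp
qed

lemma zariski_closureD:
  assumes "x \<in> zariski_closure X cs S" "S \<subseteq> X" "poly_on X cs f" "\<And>y. y \<in> S \<Longrightarrow> f y = 0"
  shows "f x = 0"
proof -
  obtain p where p: "p \<in> poly_functions cs" "\<forall>x\<in>X. f x = p x" using assms(3) unfolding poly_on_def by auto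
  have "\<forall>y\<in>S. p y = 0" using p(2) assms(2,4) by (metis subsetD)
  thus ?thesis using p assms(1) unfolding zariski_closure_def by auto
qed

lemma zariski_closureI:
  assumes "x \<in> X" "\<And>f. f \<in> poly_functions cs \<Longrightarrow> (\<And>y. y \<in> S \<Longrightarrow> f y = 0) \<Longrightarrow> f x = 0"
  shows "x \<in> zariski_closure X cs S"
  using assms unfolding zariski_closure_def by auto

lemma zariski_closure_subset: "S \<subseteq> X \<Longrightarrow> S \<subseteq> zariski_closure X cs S"
  unfolding zariski_closure_def by auto

lemma zariski_closure_carrier: "zariski_closure X cs S \<subseteq> X"
  unfolding zariski_closure_def by auto

lemma zariski_closure_vanish:
  "x \<in> zariski_closure X cs S \<Longrightarrow> f \<in> poly_functions cs \<Longrightarrow> (\<And>y. y \<in> S \<Longrightarrow> f y = 0) \<Longrightarrow> f x = 0"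
  unfolding zariski_closure_def by auto

lemma zariski_closure_mono: "S \<subseteq> T \<Longrightarrow> zariski_closure X cs S \<subseteq> zariski_closure X cs T"
  unfolding zariski_closure_def by auto

text \<open>Continuity of the polynomial map \<open>h\<close>: a polynomial vanishing on
  \<open>T\<close> pulls back to one that vanishes on \<open>S\<close>, hence on the closure of
  \<open>S\<close>.\<close>

lemma zariski_closure_map:
  assumes "x \<in> zariski_closure X cs S" "S \<subseteq> X" "h \<in> X \<rightarrow> Y"
    and "\<And>g. g \<in> ds \<Longrightarrow> poly_on X cs (\<lambda>x. g (h x))"
    and "\<And>s. s \<in> S \<Longrightarrow> h s \<in> zariski_closure Y ds T"
  shows "h x \<in> zariski_closure Y ds T"
proof (rule zariski_closureI)
  show "h x \<in> Y" using assms(1,3) zariski_closure_carrier by fastforce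
  fix f assume f: "f \<in> poly_functions ds" "\<And>y. y \<in> T \<Longrightarrow> f y = 0"
  have "poly_on Y ds f" using f(1) unfolding poly_on_def by auto
  from poly_on_compose[OF this assms(3,4)]
  have p: "poly_on X cs (\<lambda>x. f (h x))" .
  show "f (h x) = 0"
    using zariski_closureD[OF assms(1,2) p] zariski_closure_vanish[OF assms(5) f(1)] f(2) by blast
qed

text \<open>Otherwise some polynomial would have only finitely many zeros on the line, and these
  together with the finitely many exceptions would cover the infinite field.\<close>

lemma zariski_closure_line:
  assumes "\<And>t. h t \<in> Y" "\<And>g. g \<in> ds \<Longrightarrow> poly_on UNIV {\<lambda>t. t} (\<lambda>t. g (h t))"
    and "finite {t. h t \<notin> zariski_closure Y ds T}"
  shows "h t \<in> zariski_closure Y ds T"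
proof (rule zariski_closureI)
  show "h t \<in> Y" by (rule assms)
  fix f assume f: "f \<in> poly_functions ds" "\<And>y. y \<in> T \<Longrightarrow> f y = 0"
  have "poly_on Y ds f" using f(1) unfolding poly_on_def by auto
  from poly_on_compose[where X = UNIV and h = h, OF this _ assms(2)]
  have p: "poly_on UNIV {\<lambda>t. t} (\<lambda>t. f (h t))" using assms(1) by auto
  show "f (h t) = 0"
  proof (rule ccontr)
    assume "f (h t) \<noteq> 0"
    from poly_on_line_finite[OF p this] have fin: "finite {t. f (h t) = 0}" .
    have "UNIV \<subseteq> {t. f (h t) = 0} \<union> {t. h t \<notin> zariski_closure Y ds T}"
      using f zariski_closure_vanish by fast
    hence "finite (UNIV :: complex set)" using fin assms(3) finite_subset by blast
    thus False using infinite_UNIV_char_0 by blast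
  qed
qed

subsection \<open>Matrix-valued polynomial functions\<close>

text \<open>Membership in the carrier is part of the notion because entries of products and powers
  are polynomial in the coordinates only for matrices of the right size; for the same reason
  \<open>poly_on\<close> asks for agreement on \<open>X\<close> only.\<close>

definition mat_poly_on :: "'x set \<Rightarrow> ('x \<Rightarrow> complex) set \<Rightarrow> nat \<Rightarrow> ('x \<Rightarrow> complex mat) \<Rightarrow> bool" where
  "mat_poly_on X cs n F \<longleftrightarrow> (\<forall>x\<in>X. F x \<in> carrier_mat n n) \<and>
     (\<forall>i<n. \<forall>j<n. poly_on X cs (\<lambda>x. F x $$ (i, j)))"

lemma mat_poly_on_const: "A \<in> carrier_mat n n \<Longrightarrow> mat_poly_on X cs n (\<lambda>x. A)"
  unfolding mat_poly_on_def by (auto intro: poly_on_const)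

lemma mat_poly_on_add:
  assumes "mat_poly_on X cs n F" "mat_poly_on X cs n G"
  shows "mat_poly_on X cs n (\<lambda>x. F x + G x)"
  unfolding mat_poly_on_def
proof (intro conjI ballI allI impI)
  fix x assume "x \<in> X" thus "F x + G x \<in> carrier_mat n n" using assms unfolding mat_poly_on_def by auto
next
  fix i j assume ij: "i < n" "j < n"
  have "poly_on X cs (\<lambda>x. F x $$ (i,j) + G x $$ (i,j))"
    using assms ij unfolding mat_poly_on_def by (auto intro: poly_on_add)
  moreover have "F x $$ (i,j) + G x $$ (i,j) = (F x + G x) $$ (i,j)" if "x \<in> X" for x
    using assms ij that unfolding mat_poly_on_def by (auto simp: carrier_matD)
  ultimately show "poly_on X cs (\<lambda>x. (F x + G x) $$ (i,j))"
    using poly_on_cong[of X "\<lambda>x. F x $$ (i,j) + G x $$ (i,j)" "\<lambda>x. (F x + G x) $$ (i,j)" cs] by simp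
qed

lemma mat_poly_on_mult:
  assumes "mat_poly_on X cs n F" "mat_poly_on X cs n G"
  shows "mat_poly_on X cs n (\<lambda>x. F x * G x)"
  unfolding mat_poly_on_def
proof (intro conjI ballI allI impI)
  fix x assume "x \<in> X" thus "F x * G x \<in> carrier_mat n n" using assms unfolding mat_poly_on_def by auto
next
  fix i j assume ij: "i < n" "j < n"
  have "poly_on X cs (\<lambda>x. \<Sum>k<n. F x $$ (i,k) * G x $$ (k,j))"
    using assms ij unfolding mat_poly_on_def by (auto intro!: poly_on_sum poly_on_mult)
  moreover have "(\<Sum>k<n. F x $$ (i,k) * G x $$ (k,j)) = (F x * G x) $$ (i,j)" if "x \<in> X" for x
  proof -
    have "F x \<in> carrier_mat n n" "G x \<in> carrier_mat n n" using that assms unfolding mat_poly_on_def by auto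
    thus ?thesis using ij by (auto simp: scalar_prod_def atLeast0LessThan)
  qed
  ultimately show "poly_on X cs (\<lambda>x. (F x * G x) $$ (i,j))"
    using poly_on_cong[of X "\<lambda>x. \<Sum>k<n. F x $$ (i,k) * G x $$ (k,j)" "\<lambda>x. (F x * G x) $$ (i,j)" cs] by simp
qed

lemma mat_poly_on_smult:
  assumes "poly_on X cs f" "mat_poly_on X cs n F"
  shows "mat_poly_on X cs n (\<lambda>x. f x \<cdot>\<^sub>m F x)"
  unfolding mat_poly_on_def
proof (intro conjI ballI allI impI)
  fix x assume "x \<in> X" thus "f x \<cdot>\<^sub>m F x \<in> carrier_mat n n" using assms unfolding mat_poly_on_def by auto
next
  fix i j assume ij: "i < n" "j < n"
  have "poly_on X cs (\<lambda>x. f x * F x $$ (i,j))"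
    using assms ij unfolding mat_poly_on_def by (auto intro: poly_on_mult)
  moreover have "f x * F x $$ (i,j) = (f x \<cdot>\<^sub>m F x) $$ (i,j)" if "x \<in> X" for x
    using assms ij that unfolding mat_poly_on_def by (auto simp: carrier_matD)
  ultimately show "poly_on X cs (\<lambda>x. (f x \<cdot>\<^sub>m F x) $$ (i,j))"
    using poly_on_cong[of X "\<lambda>x. f x * F x $$ (i,j)" "\<lambda>x. (f x \<cdot>\<^sub>m F x) $$ (i,j)" cs] by simp
qed

lemma mat_poly_on_pow:
  assumes "mat_poly_on X cs n F"
  shows "mat_poly_on X cs n (\<lambda>x. F x ^\<^sub>m k)"
proof (induct k)
  case 0
  have *: "F x ^\<^sub>m 0 = 1\<^sub>m n" if "x \<in> X" for x
    using that assms unfolding mat_poly_on_def by auto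
  have "poly_on X cs (\<lambda>x. (F x ^\<^sub>m 0) $$ (i, j))" for i j
    by (subst poly_on_cong[where g = "\<lambda>x. 1\<^sub>m n $$ (i, j)"]) (simp only: *, rule poly_on_const)
  moreover have "F x ^\<^sub>m 0 \<in> carrier_mat n n" if "x \<in> X" for x
    by (simp only: *[OF that] one_carrier_mat)
  ultimately show ?case unfolding mat_poly_on_def by blast
next
  case (Suc k)
  from mat_poly_on_mult[OF this assms] show ?case by simp
qed

lemma mat_poly_on_det:
  assumes "mat_poly_on X cs n F"
  shows "poly_on X cs (\<lambda>x. det (F x))"
proof -
  have "poly_on X cs (\<lambda>x. \<Sum>p\<in>{p. p permutes {0..<n}}. signof p * (\<Prod>i=0..<n. F x $$ (i, p i)))"
    using assms unfolding mat_poly_on_def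
    by (intro poly_on_sum poly_on_mult poly_on_prod poly_on_const)
       (auto dest: permutes_in_image)
  moreover have "(\<Sum>p\<in>{p. p permutes {0..<n}}. signof p * (\<Prod>i=0..<n. F x $$ (i, p i))) = det (F x)"
    if "x \<in> X" for x
    using assms that det_def'[of "F x" n] unfolding mat_poly_on_def by auto
  ultimately show ?thesis
    using poly_on_cong[of X "\<lambda>x. \<Sum>p\<in>{p. p permutes {0..<n}}. signof p * (\<Prod>i=0..<n. F x $$ (i, p i))" "\<lambda>x. det (F x)" cs] by simp
qed

lemma mat_poly_on_id: "mat_poly_on (carrier_mat n n) (mat_coords n) n (\<lambda>x. x)"
  unfolding mat_poly_on_def by (auto intro!: poly_on_coord simp: mat_coords_def)

definition pair_coords :: "nat \<Rightarrow> (complex mat \<times> complex mat \<Rightarrow> complex) set" where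
  "pair_coords n = (\<lambda>f. f \<circ> fst) ` mat_coords n \<union> (\<lambda>f. f \<circ> snd) ` mat_coords n"

lemma closure_MM_alt: "closure_MM n = zariski_closure (carrier_mat n n \<times> carrier_mat n n) (pair_coords n)"
  unfolding closure_MM_def pair_coords_def ..

lemma mat_poly_on_fst: "mat_poly_on (carrier_mat n n \<times> carrier_mat n n) (pair_coords n) n fst"
  unfolding mat_poly_on_def
proof (intro conjI ballI allI impI)
  fix i j assume "i < n" "j < n"
  hence "(\<lambda>x. x $$ (i,j)) \<circ> fst \<in> pair_coords n"
    unfolding pair_coords_def mat_coords_def by blast
  from poly_on_coord[OF this] show "poly_on (carrier_mat n n \<times> carrier_mat n n) (pair_coords n) (\<lambda>x. fst x $$ (i,j))"
    by (simp add: comp_def)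
qed auto

lemma mat_poly_on_snd: "mat_poly_on (carrier_mat n n \<times> carrier_mat n n) (pair_coords n) n snd"
  unfolding mat_poly_on_def
proof (intro conjI ballI allI impI)
  fix i j assume "i < n" "j < n"
  hence "(\<lambda>x. x $$ (i,j)) \<circ> snd \<in> pair_coords n"
    unfolding pair_coords_def mat_coords_def by blast
  from poly_on_coord[OF this] show "poly_on (carrier_mat n n \<times> carrier_mat n n) (pair_coords n) (\<lambda>x. snd x $$ (i,j))"
    by (simp add: comp_def)
qed auto

lemma closure_M_map:
  assumes "x \<in> zariski_closure X cs S" "S \<subseteq> X" "mat_poly_on X cs n F"
    and "\<And>s. s \<in> S \<Longrightarrow> F s \<in> closure_M n T"
  shows "F x \<in> closure_M n T"
  unfolding closure_M_def
  by (rule zariski_closure_map[OF assms(1,2)])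
     (use assms(3,4) in \<open>auto simp: mat_poly_on_def mat_coords_def closure_M_def\<close>)

lemma closure_MM_map:
  assumes "x \<in> zariski_closure X cs S" "S \<subseteq> X" "mat_poly_on X cs n F" "mat_poly_on X cs n G"
    and "\<And>s. s \<in> S \<Longrightarrow> (F s, G s) \<in> closure_MM n T"
  shows "(F x, G x) \<in> closure_MM n T"
  unfolding closure_MM_alt
  by (rule zariski_closure_map[OF assms(1,2), where h = "\<lambda>x. (F x, G x)"])
     (use assms(3-5) in \<open>auto simp: mat_poly_on_def mat_coords_def closure_MM_alt pair_coords_def\<close>)

lemma closure_M_line:
  assumes "mat_poly_on UNIV {\<lambda>t. t} n F" "finite {t. F t \<notin> closure_M n T}"
  shows "F t \<in> closure_M n T"
  unfolding closure_M_def
  by (rule zariski_closure_line)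
     (use assms in \<open>auto simp: mat_poly_on_def mat_coords_def closure_M_def\<close>)

lemma closure_MM_Times:
  assumes "A \<subseteq> carrier_mat n n" "B \<subseteq> carrier_mat n n"
  shows "closure_MM n (A \<times> B) = closure_M n A \<times> closure_M n B"
proof (intro equalityI subsetI)
  fix z assume z: "z \<in> closure_MM n (A \<times> B)"
  have sub: "A \<times> B \<subseteq> carrier_mat n n \<times> carrier_mat n n" using assms by auto
  have "fst z \<in> closure_M n A"
    by (rule closure_M_map[OF z[unfolded closure_MM_alt] sub mat_poly_on_fst])
       (use subsetD[OF zariski_closure_subset[OF assms(1)]] in \<open>auto simp: closure_M_def\<close>)
  moreover have "snd z \<in> closure_M n B"
    by (rule closure_M_map[OF z[unfolded closure_MM_alt] sub mat_poly_on_snd])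
       (use subsetD[OF zariski_closure_subset[OF assms(2)]] in \<open>auto simp: closure_M_def\<close>)
  ultimately show "z \<in> closure_M n A \<times> closure_M n B" by (cases z) auto
next
  fix z assume "z \<in> closure_M n A \<times> closure_M n B"
  then obtain a b where z: "z = (a,b)" and a: "a \<in> closure_M n A" and b: "b \<in> closure_M n B" by auto
  have bc: "b \<in> carrier_mat n n" using b zariski_closure_carrier[of "carrier_mat n n"] unfolding closure_M_def by (rule subsetD[rotated])
  have AB: "A \<times> B \<subseteq> carrier_mat n n \<times> carrier_mat n n" using assms by auto
  \<comment> \<open>The coordinates are freed one at a time: first \<open>b\<close> runs through its
    closure with a point of \<open>A\<close> held fixed, then \<open>a\<close> does so with this
    \<open>b\<close> held fixed.\<close>
  have *: "(a', b) \<in> closure_MM n (A \<times> B)" if a': "a' \<in> A" for a'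
  proof (rule closure_MM_map[OF b[unfolded closure_M_def] assms(2) mat_poly_on_const mat_poly_on_id])
    show "a' \<in> carrier_mat n n" using a' assms(1) by blast
    show "(a', s) \<in> closure_MM n (A \<times> B)" if "s \<in> B" for s
      unfolding closure_MM_alt using subsetD[OF zariski_closure_subset[OF AB], of "(a', s)"] a' that by blast
  qed
  have "(a, b) \<in> closure_MM n (A \<times> B)"
    by (rule closure_MM_map[OF a[unfolded closure_M_def] assms(1) mat_poly_on_id mat_poly_on_const[OF bc]]) (rule *)
  thus "z \<in> closure_MM n (A \<times> B)" unfolding z .
qed

section \<open>Nilpotent orbits through partial permutation matrices\<close>

text \<open>Partial maps are used because a nilpotent shift sends the boxes at the border to
  nothing: \<open>None\<close> stands for a zero column.\<close>

definition pmat :: "nat \<Rightarrow> (nat \<Rightarrow> nat option) \<Rightarrow> complex mat" where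
  "pmat m g = mat m m (\<lambda>(i, j). if g j = Some i then 1 else 0)"

lemma pmat_carrier[simp]: "pmat m g \<in> carrier_mat m m"
  unfolding pmat_def by simp

lemma pmat_dim[simp]: "dim_row (pmat m g) = m" "dim_col (pmat m g) = m"
  unfolding pmat_def by simp_all

lemma pmat_index[simp]: "i < m \<Longrightarrow> j < m \<Longrightarrow> pmat m g $$ (i, j) = (if g j = Some i then 1 else 0)"
  unfolding pmat_def by simp

lemma mat_mult_index:
  "A \<in> carrier_mat n k \<Longrightarrow> B \<in> carrier_mat k m \<Longrightarrow> i < n \<Longrightarrow> j < m \<Longrightarrow>
    (A * B) $$ (i, j) = (\<Sum>l<k. A $$ (i, l) * B $$ (l, j))"
  by (auto simp: scalar_prod_def atLeast0LessThan)

lemma mat_mult_pmat_index: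
  assumes "A \<in> carrier_mat m m" "i < m" "j < m" "\<And>l. g j = Some l \<Longrightarrow> l < m"
  shows "(A * pmat m g) $$ (i, j) = (case g j of None \<Rightarrow> 0 | Some l \<Rightarrow> A $$ (i, l))"
proof -
  have "(A * pmat m g) $$ (i, j) = (\<Sum>l<m. A $$ (i, l) * (if g j = Some l then 1 else 0))"
    using assms by (subst mat_mult_index[of _ m m _ m]) auto
  also have "\<dots> = (case g j of None \<Rightarrow> 0 | Some l \<Rightarrow> A $$ (i, l))"
    using assms(4) by (auto split: option.splits simp: if_distrib[of "(*) _"] sum.delta' cong: if_cong)
  finally show ?thesis .
qed

lemma pmat_mult:
  assumes "\<And>j l. j < m \<Longrightarrow> h j = Some l \<Longrightarrow> l < m"
  shows "pmat m g * pmat m h = pmat m (g \<circ>\<^sub>m h)"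
proof (rule eq_matI)
  fix i j assume "i < dim_row (pmat m (g \<circ>\<^sub>m h))" "j < dim_col (pmat m (g \<circ>\<^sub>m h))"
  hence ij: "i < m" "j < m" by auto
  show "(pmat m g * pmat m h) $$ (i, j) = pmat m (g \<circ>\<^sub>m h) $$ (i, j)"
    by (subst mat_mult_pmat_index[OF pmat_carrier ij assms[OF ij(2)]])
       (use ij assms[OF ij(2)] in \<open>auto simp: map_comp_def split: option.splits\<close>)
qed auto

lemma bij_lessThan_inverse:
  fixes \<pi> :: "nat \<Rightarrow> nat"
  assumes "bij_betw \<pi> {..<m} {..<m}"
  shows "\<exists>\<rho>. (\<forall>i<m. \<pi> i < m \<and> \<rho> i < m \<and> \<rho> (\<pi> i) = i \<and> \<pi> (\<rho> i) = i)"
proof (intro exI allI impI)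
  fix i assume "i < m"
  moreover from this have "\<pi> i < m" using assms by (auto simp: bij_betw_def)
  ultimately show "\<pi> i < m \<and> the_inv_into {..<m} \<pi> i < m \<and> the_inv_into {..<m} \<pi> (\<pi> i) = i \<and> \<pi> (the_inv_into {..<m} \<pi> i) = i"
    using assms the_inv_into_into[of \<pi> "{..<m}" i "{..<m}"] the_inv_into_f_f[of \<pi> "{..<m}" i] f_the_inv_into_f[of \<pi> "{..<m}" i]
    by (auto simp: bij_betw_def)
qed

text \<open>Conjugation by the permutation matrix of \<open>\<pi>\<close>, which carries the indices
  of \<open>B\<close> to those of \<open>A\<close>.\<close>

lemma similar_mat_relabel:
  fixes A B :: "complex mat"
  assumes "bij_betw \<pi> {..<m} {..<m}" "A \<in> carrier_mat m m" "B \<in> carrier_mat m m"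
    and "\<And>i j. i < m \<Longrightarrow> j < m \<Longrightarrow> A $$ (\<pi> i, \<pi> j) = B $$ (i, j)"
  shows "similar_mat A B"
proof -
  obtain \<rho> where \<pi>m: "\<And>i. i < m \<Longrightarrow> \<pi> i < m" and \<rho>m: "\<And>i. i < m \<Longrightarrow> \<rho> i < m"
    and \<rho>\<pi>: "\<And>i. i < m \<Longrightarrow> \<rho> (\<pi> i) = i" and \<pi>\<rho>: "\<And>i. i < m \<Longrightarrow> \<pi> (\<rho> i) = i"
    using bij_lessThan_inverse[OF assms(1)] by blast
  let ?P = "pmat m (Some \<circ> \<pi>)" and ?Q = "pmat m (Some \<circ> \<rho>)"
  have PQ: "?P * ?Q = 1\<^sub>m m"
    by (subst pmat_mult) (auto intro!: eq_matI simp: \<rho>m \<pi>\<rho> map_comp_def)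
  have QP: "?Q * ?P = 1\<^sub>m m"
    by (subst pmat_mult) (auto intro!: eq_matI simp: \<pi>m \<rho>\<pi> map_comp_def)
  have AP: "A * ?P = ?P * B"
  proof (rule eq_matI)
    fix i j assume "i < dim_row (?P * B)" "j < dim_col (?P * B)"
    hence ij: "i < m" "j < m" using assms by auto
    have "(?P * B) $$ (i, j) = (\<Sum>l<m. ?P $$ (i,l) * B $$ (l, j))"
      by (rule mat_mult_index) (use ij assms in auto)
    also have "\<dots> = (\<Sum>l<m. if l = \<rho> i then B $$ (l, j) else 0)"
      by (rule sum.cong) (use ij \<rho>\<pi> \<pi>\<rho> in auto)
    also have "\<dots> = B $$ (\<rho> i, j)" using \<rho>m ij by simp
    also have "\<dots> = A $$ (i, \<pi> j)" using assms(4)[OF \<rho>m[OF ij(1)] ij(2)] \<pi>\<rho>[OF ij(1)] by simp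
    also have "\<dots> = (A * ?P) $$ (i, j)"
      by (subst mat_mult_pmat_index[OF assms(2) ij]) (use \<pi>m[OF ij(2)] in auto)
    finally show "(A * ?P) $$ (i, j) = (?P * B) $$ (i, j)" by simp
  qed (use assms in auto)
  have "A = A * (?P * ?Q)" unfolding PQ using assms by simp
  also have "\<dots> = (A * ?P) * ?Q" using assms by (simp add: assoc_mult_mat[of _ m m _ m _ m])
  finally have "A = ?P * B * ?Q" unfolding AP .
  thus ?thesis using similar_matI[of A B ?P ?Q m] PQ QP assms by auto
qed

text \<open>The boxes of the diagram serve as a basis. The numbering stays arbitrary, so that the
  normal form can later be laid out along the positions of the letters of a word.\<close>

definition labelling :: "nat \<Rightarrow> nat list \<Rightarrow> (nat \<times> nat \<Rightarrow> nat) \<Rightarrow> bool" where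
  "labelling m p \<beta> \<longleftrightarrow> bij_betw \<beta> (diagram p) {..<m}"

text \<open>A box moves \<open>k\<close> columns to the left in its row and is lost at the border;
  the explicit test keeps the truncated subtraction \<open>c - k\<close> from sending it to column
  0.\<close>

definition shift_map :: "nat list \<Rightarrow> (nat \<times> nat \<Rightarrow> nat) \<Rightarrow> nat \<Rightarrow> nat \<Rightarrow> nat option" where
  "shift_map p \<beta> k j = (case the_inv_into (diagram p) \<beta> j of (r, c) \<Rightarrow> if c < k then None else Some (\<beta> (r, c - k)))"

definition shift_mat :: "nat \<Rightarrow> nat list \<Rightarrow> (nat \<times> nat \<Rightarrow> nat) \<Rightarrow> complex mat" where
  "shift_mat m p \<beta> = pmat m (shift_map p \<beta> 1)"

lemma diagram_iff[simp]: "(r, c) \<in> diagram p \<longleftrightarrow> r < length p \<and> c < p ! r"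
  unfolding diagram_def by simp

lemma labellingE:
  assumes "labelling m p \<beta>" "i < m"
  obtains r c where "r < length p" "c < p ! r" "i = \<beta> (r, c)"
proof -
  have "i \<in> \<beta> ` diagram p" using assms unfolding labelling_def bij_betw_def by simp
  then obtain x where "x \<in> diagram p" "i = \<beta> x" by blast
  thus thesis using that[of "fst x" "snd x"] diagram_iff[of "fst x" "snd x" p] by simp
qed

lemma labelling_less:
  assumes "labelling m p \<beta>" "r < length p" "c < p ! r"
  shows "\<beta> (r, c) < m"
proof -
  have "(r, c) \<in> diagram p" using assms by simp
  hence "\<beta> (r, c) \<in> {..<m}" using assms(1) unfolding labelling_def bij_betw_def by blast
  thus ?thesis by simp
qed

lemma labelling_eq_iff:
  assumes "labelling m p \<beta>" "r < length p" "c < p ! r" "r' < length p" "c' < p ! r'"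
  shows "\<beta> (r, c) = \<beta> (r', c') \<longleftrightarrow> r = r' \<and> c = c'"
  using assms inj_on_eq_iff[of \<beta> "diagram p" "(r, c)" "(r', c')"] unfolding labelling_def bij_betw_def by simp

lemma labelling_inv:
  assumes "labelling m p \<beta>" "r < length p" "c < p ! r"
  shows "the_inv_into (diagram p) \<beta> (\<beta> (r, c)) = (r, c)"
  using assms the_inv_into_f_f[of \<beta> "diagram p" "(r, c)"] unfolding labelling_def bij_betw_def by simp

lemma shift_map_label:
  assumes "labelling m p \<beta>" "r < length p" "c < p ! r"
  shows "shift_map p \<beta> k (\<beta> (r, c)) = (if c < k then None else Some (\<beta> (r, c - k)))"
  unfolding shift_map_def labelling_inv[OF assms] by simp

lemma pmat_cong: "(\<And>j. j < m \<Longrightarrow> g j = h j) \<Longrightarrow> pmat m g = pmat m h"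
  by (rule eq_matI) auto

lemma shift_mat_pow:
  assumes L: "labelling m p \<beta>"
  shows "shift_mat m p \<beta> ^\<^sub>m k = pmat m (shift_map p \<beta> k)"
proof (induct k)
  case 0
  show ?case
  proof (rule eq_matI)
    fix i j assume "i < dim_row (pmat m (shift_map p \<beta> 0))" "j < dim_col (pmat m (shift_map p \<beta> 0))"
    hence ij: "i < m" "j < m" by auto
    from ij(2) obtain r c where "r < length p" "c < p ! r" "j = \<beta> (r, c)" using labellingE[OF L] by blast
    thus "(shift_mat m p \<beta> ^\<^sub>m 0) $$ (i, j) = pmat m (shift_map p \<beta> 0) $$ (i, j)"
      using ij shift_map_label[OF L, of r c 0] by (auto simp: shift_mat_def)
  qed (auto simp: shift_mat_def)
next
  case (Suc k)
  have "shift_mat m p \<beta> ^\<^sub>m Suc k = pmat m (shift_map p \<beta> k \<circ>\<^sub>m shift_map p \<beta> 1)"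
    unfolding pow_mat.simps Suc
    unfolding shift_mat_def
  proof (rule pmat_mult)
    fix j l assume j: "j < m" "shift_map p \<beta> 1 j = Some l"
    from j(1) obtain r c where "r < length p" "c < p ! r" "j = \<beta> (r, c)" using labellingE[OF L] by blast
    thus "l < m" using j shift_map_label[OF L, of r c 1] labelling_less[OF L, of r "c - 1"] by (auto split: if_splits)
  qed
  also have "\<dots> = pmat m (shift_map p \<beta> (Suc k))"
  proof (rule pmat_cong)
    fix j assume j: "j < m"
    then obtain r c where rc: "r < length p" "c < p ! r" "j = \<beta> (r, c)" using labellingE[OF L] by blast
    thus "(shift_map p \<beta> k \<circ>\<^sub>m shift_map p \<beta> 1) j = shift_map p \<beta> (Suc k) j"
      using shift_map_label[OF L, of r c 1] shift_map_label[OF L, of r "c - 1" k] shift_map_label[OF L, of r c "Suc k"]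
      by (auto simp: map_comp_def)
  qed
  finally show ?case .
qed

lemma shift_mat_similar:
  assumes L: "labelling m p \<beta>" and L': "labelling m p \<beta>'"
  shows "similar_mat (shift_mat m p \<beta>') (shift_mat m p \<beta>)"
proof (rule similar_mat_relabel)
  let ?\<pi> = "\<beta>' \<circ> the_inv_into (diagram p) \<beta>"
  show "bij_betw ?\<pi> {..<m} {..<m}"
    using L L' unfolding labelling_def by (blast intro: bij_betw_trans bij_betw_the_inv_into)
  fix i j assume ij: "i < m" "j < m"
  from ij(1) obtain r c where rc: "r < length p" "c < p ! r" "i = \<beta> (r, c)" using labellingE[OF L] by blast
  from ij(2) obtain r' c' where rc': "r' < length p" "c' < p ! r'" "j = \<beta> (r', c')" using labellingE[OF L] by blast
  have *: "?\<pi> i = \<beta>' (r, c)" "?\<pi> j = \<beta>' (r', c')" using rc rc' labelling_inv[OF L] by auto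
  have "\<beta>' (r', c' - 1) = \<beta>' (r, c) \<longleftrightarrow> \<beta> (r', c' - 1) = \<beta> (r, c)"
    using labelling_eq_iff[OF L rc'(1) _ rc(1,2), of "c' - 1"] labelling_eq_iff[OF L' rc'(1) _ rc(1,2), of "c' - 1"]
      rc'(2) by simp
  thus "shift_mat m p \<beta>' $$ (?\<pi> i, ?\<pi> j) = shift_mat m p \<beta> $$ (i, j)"
    unfolding * unfolding shift_mat_def rc(3) rc'(3)
    using labelling_less[OF L' rc(1,2)] labelling_less[OF L' rc'(1,2)] labelling_less[OF L rc(1,2)] labelling_less[OF L rc'(1,2)]
    by (simp add: shift_map_label[OF L rc'(1,2)] shift_map_label[OF L' rc'(1,2)])
qed (auto simp: shift_mat_def)

text \<open>Each row of the diagram is one Jordan block, and numbering the boxes row by row gives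
  the block matrix. In the induction the labels of the later rows are raised by the length
  \<open>a\<close> of the first, as in a block diagonal matrix.\<close>

lemma jordan_matrix_eq_shift_mat:
  "\<exists>\<beta>. labelling (sum_list p) p \<beta> \<and> jordan_matrix (map (\<lambda>k. (k, 0)) p) = shift_mat (sum_list p) p \<beta>"
proof (induct p)
  case Nil
  have "labelling 0 [] (\<lambda>x. 0)" unfolding labelling_def diagram_def by (simp add: bij_betw_def)
  thus ?case by (intro exI[of _ "\<lambda>x. 0"]) (auto simp: shift_mat_def jordan_matrix_def)
next
  case (Cons a p)
  let ?m = "sum_list p"
  obtain \<beta> where L: "labelling ?m p \<beta>" and J: "jordan_matrix (map (\<lambda>k. (k, 0)) p) = shift_mat ?m p \<beta>"
    using Cons by auto
  define \<beta>' where "\<beta>' = (\<lambda>(r, c). case r of 0 \<Rightarrow> c | Suc r' \<Rightarrow> a + \<beta> (r', c))"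
  have L': "labelling (a + ?m) (a # p) \<beta>'"
    unfolding labelling_def bij_betw_def
  proof (intro conjI inj_onI equalityI subsetI)
    fix x y assume "x \<in> diagram (a # p)" "y \<in> diagram (a # p)" "\<beta>' x = \<beta>' y"
    thus "x = y" using labelling_eq_iff[OF L] unfolding \<beta>'_def
      by (cases x; cases y) (auto split: nat.splits)
  next
    fix i assume "i \<in> \<beta>' ` diagram (a # p)"
    thus "i \<in> {..<a + ?m}" using labelling_less[OF L] unfolding \<beta>'_def
      by (auto split: nat.splits simp: trans_less_add1)
  next
    fix i assume i: "i \<in> {..<a + ?m}"
    show "i \<in> \<beta>' ` diagram (a # p)"
    proof (cases "i < a")
      case True thus ?thesis unfolding \<beta>'_def by (intro image_eqI[of _ _ "(0, i)"]) auto
    next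
      case False
      hence "i - a < ?m" using i by auto
      then obtain r c where "r < length p" "c < p ! r" "i - a = \<beta> (r, c)" using labellingE[OF L] by blast
      thus ?thesis using False unfolding \<beta>'_def by (intro image_eqI[of _ _ "(Suc r, c)"]) auto
    qed
  qed
  have "jordan_matrix (map (\<lambda>k. (k, 0)) (a # p)) = shift_mat (a + ?m) (a # p) \<beta>'" (is "?J = ?S")
  proof (rule eq_matI)
    fix i j assume "i < dim_row ?S" "j < dim_col ?S"
    hence ij: "i < a + ?m" "j < a + ?m" by (auto simp: shift_mat_def)
    have Jeq: "?J = four_block_mat (jordan_block a 0) (0\<^sub>m a ?m) (0\<^sub>m ?m a) (shift_mat ?m p \<beta>)"
      using jordan_matrix_Cons[of a "0::complex" "map (\<lambda>k. (k, 0)) p"] by (simp add: J comp_def)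
    show "?J $$ (i, j) = ?S $$ (i, j)"
    proof (cases "j < a")
      case True
      hence b: "j = \<beta>' (0, j)" unfolding \<beta>'_def by simp
      have "shift_map (a # p) \<beta>' 1 j = (if j < 1 then None else Some (j - 1))"
        using shift_map_label[OF L', of 0 j 1] True unfolding \<beta>'_def by auto
      thus ?thesis unfolding Jeq using True ij
        by (auto simp: shift_mat_def)
    next
      case False
      hence "j - a < ?m" using ij by auto
      then obtain r c where rc: "r < length p" "c < p ! r" "j - a = \<beta> (r, c)" using labellingE[OF L] by blast
      have "j = \<beta>' (Suc r, c)" using rc False unfolding \<beta>'_def by auto
      hence S: "shift_map (a # p) \<beta>' 1 j = (if c < 1 then None else Some (a + \<beta> (r, c - 1)))"
        using shift_map_label[OF L', of "Suc r" c 1] rc unfolding \<beta>'_def by auto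
      have "shift_map p \<beta> 1 (j - a) = (if c < 1 then None else Some (\<beta> (r, c - 1)))"
        using shift_map_label[OF L, of r c 1] rc by auto
      thus ?thesis unfolding Jeq using False ij S
        by (auto simp: shift_mat_def)
    qed
  qed (auto simp: shift_mat_def comp_def)
  thus ?case using L' by (intro exI[of _ \<beta>']) simp
qed

text \<open>All labellings give similar matrices, so membership in the orbit can be tested against
  whichever labelling is convenient.\<close>

lemma nilpotent_orbit_iff:
  assumes "labelling m p \<beta>" "0 \<notin> set p" "sum_list p = m"
  shows "M \<in> nilpotent_orbit m p \<longleftrightarrow> similar_mat M (shift_mat m p \<beta>)"
proof -
  obtain \<beta>' where L: "labelling m p \<beta>'" and J: "jordan_matrix (map (\<lambda>k. (k, 0)) p) = shift_mat m p \<beta>'"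
    using jordan_matrix_eq_shift_mat[of p] assms(3) by auto
  have s: "similar_mat (shift_mat m p \<beta>') (shift_mat m p \<beta>)" "similar_mat (shift_mat m p \<beta>) (shift_mat m p \<beta>')"
    using shift_mat_similar[OF assms(1) L] similar_mat_sym by auto
  have c: "M \<in> carrier_mat m m" if "similar_mat M (shift_mat m p \<beta>)"
  proof -
    from similar_matD[OF that] obtain n where "M \<in> carrier_mat n n" "shift_mat m p \<beta> \<in> carrier_mat n n" by auto
    thus ?thesis by (auto simp: shift_mat_def)
  qed
  have "0 \<notin> fst ` set (map (\<lambda>k. (k, 0 :: complex)) p)" using assms(2) by auto
  hence "M \<in> nilpotent_orbit m p \<longleftrightarrow> M \<in> carrier_mat m m \<and> similar_mat M (shift_mat m p \<beta>')"
    unfolding nilpotent_orbit_def jordan_nf_def J by blast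
  also have "\<dots> \<longleftrightarrow> similar_mat M (shift_mat m p \<beta>)"
    using s c similar_mat_trans by blast
  finally show ?thesis .
qed

lemma labelling_exists: "\<exists>\<beta>. labelling (sum_list p) p \<beta>"
  using jordan_matrix_eq_shift_mat by blast

text \<open>Permuting the rows of the diagram along with the labels leaves the shift matrix itself
  unchanged. This removes the order of the Jordan blocks, which the existence of a Jordan form
  leaves open.\<close>

lemma nilpotent_orbit_mset:
  assumes "mset p = mset q" "0 \<notin> set p" "sum_list p = m"
  shows "nilpotent_orbit m p = nilpotent_orbit m q"
proof -
  have q: "0 \<notin> set q" "sum_list q = m" using assms mset_eq_setD[OF assms(1)] by (auto simp: sum_mset_sum_list[symmetric])
  obtain \<beta> where L: "labelling m q \<beta>" using labelling_exists[of q] q by auto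
  obtain f where "f permutes {..<length q}" "permute_list f q = p"
    using mset_eq_permutation[OF assms(1)] by blast
  hence f: "bij_betw f {..<length p} {..<length q}" "\<forall>i<length p. p ! i = q ! f i"
    using permutes_imp_bij permute_list_nth[of f q] by auto
  define \<beta>' where "\<beta>' = (\<lambda>(r, c). \<beta> (f r, c))"
  have fl: "f r < length q" if "r < length p" for r using f(1) that by (auto simp: bij_betw_def)
  have finj: "f r = f r' \<longleftrightarrow> r = r'" if "r < length p" "r' < length p" for r r'
    using f(1) that by (auto simp: bij_betw_def inj_on_eq_iff)
  have L': "labelling m p \<beta>'"
    unfolding labelling_def bij_betw_def
  proof (intro conjI inj_onI equalityI subsetI)
    fix x y assume "x \<in> diagram p" "y \<in> diagram p" "\<beta>' x = \<beta>' y"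
    thus "x = y" using labelling_eq_iff[OF L] fl finj f(2) unfolding \<beta>'_def by (cases x; cases y) auto
  next
    fix i assume "i \<in> \<beta>' ` diagram p"
    thus "i \<in> {..<m}" using labelling_less[OF L] fl f(2) unfolding \<beta>'_def by auto
  next
    fix i assume "i \<in> {..<m}"
    then obtain r c where rc: "r < length q" "c < q ! r" "i = \<beta> (r, c)" using labellingE[OF L] by blast
    from rc(1) f(1) obtain r' where "r' < length p" "f r' = r" unfolding bij_betw_def by (metis imageE lessThan_iff)
    thus "i \<in> \<beta>' ` diagram p" using rc f(2) unfolding \<beta>'_def by (intro image_eqI[of _ _ "(r', c)"]) auto
  qed
  have "shift_mat m p \<beta>' = shift_mat m q \<beta>"
    unfolding shift_mat_def
  proof (rule pmat_cong)
    fix j assume "j < m"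
    then obtain r c where rc: "r < length p" "c < p ! r" "j = \<beta>' (r, c)" using labellingE[OF L'] by blast
    thus "shift_map p \<beta>' 1 j = shift_map q \<beta> 1 j"
      using shift_map_label[OF L', of r c 1] shift_map_label[OF L, of "f r" c 1] fl f(2) unfolding \<beta>'_def by auto
  qed
  thus ?thesis using nilpotent_orbit_iff[OF L q] nilpotent_orbit_iff[OF L' assms(2,3)] by auto
qed

subsection \<open>Ranks of powers\<close>

text \<open>For a square matrix of size \<open>n\<close>, \<open>corank_le n s\<close> says that its kernel has dimension at most \<open>s\<close>, and
  \<open>kills n d\<close> that the dimension is at least \<open>d\<close>.\<close>

definition corank_le :: "nat \<Rightarrow> nat \<Rightarrow> complex mat \<Rightarrow> bool" where
  "corank_le n s A \<longleftrightarrow> (\<exists>P\<in>carrier_mat n s. \<exists>Q\<in>carrier_mat s n. det (A + P * Q) \<noteq> 0)"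

definition kills :: "nat \<Rightarrow> nat \<Rightarrow> complex mat \<Rightarrow> bool" where
  "kills n d A \<longleftrightarrow> (\<exists>X\<in>carrier_mat n d. \<exists>Y\<in>carrier_mat d n. Y * X = 1\<^sub>m d \<and> A * X = 0\<^sub>m n d)"

text \<open>More unknowns than equations: zero rows make the system square, and its determinant
  vanishes.\<close>

lemma ex_kernel_vec:
  fixes Z :: "complex mat"
  assumes Z: "Z \<in> carrier_mat s d" and sd: "s < d"
  shows "\<exists>v\<in>carrier_vec d. v \<noteq> 0\<^sub>v d \<and> Z *\<^sub>v v = 0\<^sub>v s"
proof -
  define W where "W = mat d d (\<lambda>(i, j). if i < s then Z $$ (i, j) else 0)"
  have W: "W \<in> carrier_mat d d" unfolding W_def by simp
  \<comment> \<open>The last row of \<open>W\<close> is zero, so the transpose annihilates the last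
    unit vector.\<close>
  have "det (transpose_mat W) = 0"
  proof (subst det_0_iff_vec_prod_zero)
    show "transpose_mat W \<in> carrier_mat d d" using W by simp
    have "transpose_mat W *\<^sub>v unit_vec d (d - 1) = 0\<^sub>v d"
    proof (rule eq_vecI)
      fix i assume "i < dim_vec (0\<^sub>v d)"
      hence i: "i < d" by simp
      have "(transpose_mat W *\<^sub>v unit_vec d (d - 1)) $ i = col W i $ (d - 1)"
        using W i sd by (simp add: row_transpose)
      also have "\<dots> = 0" using W i sd unfolding W_def by auto
      finally show "(transpose_mat W *\<^sub>v unit_vec d (d - 1)) $ i = 0\<^sub>v d $ i" using i by simp
    qed (use W in simp)
    moreover have "unit_vec d (d - 1) \<noteq> (0\<^sub>v d :: complex vec)" using sd by (simp add: unit_vec_nonzero)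
    ultimately show "\<exists>v. v \<in> carrier_vec d \<and> v \<noteq> 0\<^sub>v d \<and> transpose_mat W *\<^sub>v v = 0\<^sub>v d"
      by (metis unit_vec_carrier)
  qed
  hence "det W = 0" using det_transpose[OF W] by simp
  then obtain v where v: "v \<in> carrier_vec d" "v \<noteq> 0\<^sub>v d" "W *\<^sub>v v = 0\<^sub>v d"
    using det_0_iff_vec_prod_zero[OF W] by auto
  have "Z *\<^sub>v v = 0\<^sub>v s"
  proof (rule eq_vecI)
    fix i assume "i < dim_vec (0\<^sub>v s)"
    hence i: "i < s" by simp
    have "row Z i = row W i" using i sd Z unfolding W_def by (intro eq_vecI) auto
    hence "(Z *\<^sub>v v) $ i = (W *\<^sub>v v) $ i" using i sd Z W by simp
    thus "(Z *\<^sub>v v) $ i = 0\<^sub>v s $ i" using v(3) i sd by simp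
  qed (use Z in simp)
  thus ?thesis using v by blast
qed

text \<open>If \<open>d\<close> exceeded \<open>s\<close>, the \<open>s\<close> equations
  \<open>Q X v = 0\<close> would have a nonzero solution \<open>v\<close>; then \<open>X v\<close>,
  nonzero because of the left inverse \<open>Y\<close>, would be annihilated by both
  \<open>A\<close> and \<open>P Q\<close>.\<close>

lemma kills_le_corank:
  assumes A: "A \<in> carrier_mat n n" and c: "corank_le n s A" and k: "kills n d A"
  shows "d \<le> s"
proof (rule ccontr)
  assume "\<not> d \<le> s"
  hence sd: "s < d" by simp
  from c obtain P Q where P: "P \<in> carrier_mat n s" and Q: "Q \<in> carrier_mat s n" and dn: "det (A + P * Q) \<noteq> 0"
    unfolding corank_le_def by auto
  from k obtain X Y where X: "X \<in> carrier_mat n d" and Y: "Y \<in> carrier_mat d n"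
    and YX: "Y * X = 1\<^sub>m d" and AX: "A * X = 0\<^sub>m n d" unfolding kills_def by auto
  obtain v where v: "v \<in> carrier_vec d" "v \<noteq> 0\<^sub>v d" "(Q * X) *\<^sub>v v = 0\<^sub>v s"
    using ex_kernel_vec[of "Q * X" s d] Q X sd by auto
  have Xv: "X *\<^sub>v v \<in> carrier_vec n" using X v by simp
  have "Y *\<^sub>v (X *\<^sub>v v) = v" using assoc_mult_mat_vec[OF Y X v(1)] YX v(1) by simp
  moreover have "Y *\<^sub>v 0\<^sub>v n = 0\<^sub>v d" using Y by (intro eq_vecI) auto
  ultimately have nz: "X *\<^sub>v v \<noteq> 0\<^sub>v n" using v(2) by auto
  have "(A + P * Q) *\<^sub>v (X *\<^sub>v v) = A *\<^sub>v (X *\<^sub>v v) + (P * Q) *\<^sub>v (X *\<^sub>v v)"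
    by (rule add_mult_distrib_mat_vec[OF A _ Xv]) (use P Q in simp)
  also have "A *\<^sub>v (X *\<^sub>v v) = 0\<^sub>m n d *\<^sub>v v" using assoc_mult_mat_vec[OF A X v(1)] AX by simp
  also have "\<dots> = 0\<^sub>v n" using v(1) by (intro eq_vecI) auto
  also have "(P * Q) *\<^sub>v (X *\<^sub>v v) = P *\<^sub>v (Q *\<^sub>v (X *\<^sub>v v))" by (rule assoc_mult_mat_vec[OF P Q Xv])
  also have "Q *\<^sub>v (X *\<^sub>v v) = 0\<^sub>v s" using assoc_mult_mat_vec[OF Q X v(1)] v(3) by simp
  also have "P *\<^sub>v 0\<^sub>v s = 0\<^sub>v n" using P by (intro eq_vecI) auto
  finally have "(A + P * Q) *\<^sub>v (X *\<^sub>v v) = 0\<^sub>v n" by simp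
  hence "det (A + P * Q) = 0"
    using det_0_iff_vec_prod_zero[of "A + P * Q" n] A P Q Xv nz by auto
  thus False using dn by simp
qed

lemma corank_le_similar:
  assumes "similar_mat A B" "A \<in> carrier_mat n n" "corank_le n s A"
  shows "corank_le n s B"
proof -
  obtain m P Q where PQ: "{A, B, P, Q} \<subseteq> carrier_mat m m" "P * Q = 1\<^sub>m m" "Q * P = 1\<^sub>m m" "A = P * B * Q"
    using similar_matD[OF assms(1)] by auto
  have [simp]: "m = n" using PQ(1) assms(2) by auto
  have B: "B \<in> carrier_mat n n" and P: "P \<in> carrier_mat n n" and Q: "Q \<in> carrier_mat n n" using PQ(1) by auto
  obtain X Y where X: "X \<in> carrier_mat n s" and Y: "Y \<in> carrier_mat s n" and d: "det (A + X * Y) \<noteq> 0"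
    using assms(3) unfolding corank_le_def by auto
  have XY: "X * Y \<in> carrier_mat n n" using X Y by simp
  have "B = (Q * P) * B * (Q * P)" using PQ(3) B by simp
  also have "\<dots> = Q * A * P" unfolding PQ(4) using B P Q by (simp add: assoc_mult_mat[of _ n n _ n _ n])
  finally have BQ: "B = Q * A * P" .
  have "B + (Q * X) * (Y * P) = Q * A * P + Q * (X * Y) * P"
    unfolding BQ using X Y P Q by (simp add: assoc_mult_mat[of _ n n _ s _ n] assoc_mult_mat[of _ n s _ n _ n] assoc_mult_mat[of _ n n _ n _ n])
  also have "\<dots> = Q * (A + X * Y) * P"
    using assms(2) XY P Q by (simp add: mult_add_distrib_mat[of Q n n _ n] add_mult_distrib_mat[of _ n n _ P n])
  finally have "det (B + (Q * X) * (Y * P)) = det Q * det (A + X * Y) * det P"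
    using assms(2) XY P Q by (simp add: det_mult[of _ n])
  moreover have "det Q * det P = 1" using det_mult[OF Q P] PQ(3) by simp
  hence "det Q \<noteq> 0" "det P \<noteq> 0" by auto
  ultimately have "det (B + (Q * X) * (Y * P)) \<noteq> 0" using d by simp
  thus ?thesis unfolding corank_le_def using X Y P Q by (meson mult_carrier_mat)
qed

lemma kills_similar:
  assumes "similar_mat A B" "A \<in> carrier_mat n n" "kills n s A"
  shows "kills n s B"
proof -
  obtain m P Q where PQ: "{A, B, P, Q} \<subseteq> carrier_mat m m" "P * Q = 1\<^sub>m m" "Q * P = 1\<^sub>m m" "A = P * B * Q"
    using similar_matD[OF assms(1)] by auto
  have [simp]: "m = n" using PQ(1) assms(2) by auto
  have B: "B \<in> carrier_mat n n" and P: "P \<in> carrier_mat n n" and Q: "Q \<in> carrier_mat n n" using PQ(1) by auto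
  obtain X Y where X: "X \<in> carrier_mat n s" and Y: "Y \<in> carrier_mat s n" and YX: "Y * X = 1\<^sub>m s" "A * X = 0\<^sub>m n s"
    using assms(3) unfolding kills_def by auto
  have "(Y * P) * (Q * X) = Y * ((P * Q) * X)"
    using X Y P Q by (simp add: assoc_mult_mat[of _ s n _ n _ s] assoc_mult_mat[of _ n n _ n _ s])
  also have "\<dots> = 1\<^sub>m s" using PQ(2) X Y YX by simp
  finally have 1: "(Y * P) * (Q * X) = 1\<^sub>m s" .
  have "B * (Q * X) = (Q * P) * B * Q * X" using PQ(3) B Q X by (simp add: assoc_mult_mat[of _ n n _ n _ s])
  also have "\<dots> = Q * (A * X)" unfolding PQ(4) using B P Q X
    by (simp add: assoc_mult_mat[of _ n n _ n _ n] assoc_mult_mat[of _ n n _ n _ s])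
  also have "\<dots> = 0\<^sub>m n s" unfolding YX using Q by simp
  finally have "B * (Q * X) = 0\<^sub>m n s" .
  thus ?thesis unfolding kills_def using 1 X Y P Q by (meson mult_carrier_mat)
qed

lemma kills_coords:
  assumes A: "A \<in> carrier_mat n n" and K: "K \<subseteq> {..<n}" and z: "\<And>i j. i < n \<Longrightarrow> j \<in> K \<Longrightarrow> A $$ (i, j) = 0"
  shows "kills n (card K) A"
proof -
  obtain e where e: "bij_betw e {0..<card K} K" using K finite_subset ex_bij_betw_nat_finite by blast
  have eK: "e t \<in> K" "e t < n" if "t < card K" for t using e that K by (auto simp: bij_betw_def)
  have einj: "e t = e t' \<longleftrightarrow> t = t'" if "t < card K" "t' < card K" for t t'
    using e that by (auto simp: bij_betw_def inj_on_eq_iff)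
  define X where "X = mat n (card K) (\<lambda>(i, t). if i = e t then 1 else (0::complex))"
  define Y where "Y = mat (card K) n (\<lambda>(t, i). if i = e t then 1 else (0::complex))"
  have X: "X \<in> carrier_mat n (card K)" and Y: "Y \<in> carrier_mat (card K) n" unfolding X_def Y_def by auto
  have "Y * X = 1\<^sub>m (card K)"
  proof (rule eq_matI)
    fix t t' assume "t < dim_row (1\<^sub>m (card K))" "t' < dim_col (1\<^sub>m (card K))"
    hence t: "t < card K" "t' < card K" by auto
    have "(Y * X) $$ (t, t') = (\<Sum>l<n. Y $$ (t, l) * X $$ (l, t'))"
      by (rule mat_mult_index[OF Y X t])
    also have "\<dots> = (\<Sum>l<n. if l = e t then (if t = t' then 1 else 0) else 0)"
      by (rule sum.cong) (use t einj in \<open>auto simp: X_def Y_def\<close>)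
    also have "\<dots> = 1\<^sub>m (card K) $$ (t, t')" using t eK by simp
    finally show "(Y * X) $$ (t, t') = 1\<^sub>m (card K) $$ (t, t')" .
  qed (use X Y in auto)
  moreover have "A * X = 0\<^sub>m n (card K)"
  proof (rule eq_matI)
    fix i t assume "i < dim_row (0\<^sub>m n (card K))" "t < dim_col (0\<^sub>m n (card K))"
    hence t: "i < n" "t < card K" by auto
    have "(A * X) $$ (i, t) = (\<Sum>l<n. A $$ (i, l) * X $$ (l, t))"
      by (rule mat_mult_index[OF A X t])
    also have "\<dots> = (\<Sum>l<n. if l = e t then A $$ (i, l) else 0)"
      by (rule sum.cong) (use t in \<open>auto simp: X_def\<close>)
    also have "\<dots> = 0" using t eK z by simp
    finally show "(A * X) $$ (i, t) = 0\<^sub>m n (card K) $$ (i, t)" using t by simp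
  qed (use X A in auto)
  ultimately show ?thesis unfolding kills_def using X Y by blast
qed

text \<open>A correction supported on the columns in \<open>K\<close> factors through a space of
  dimension \<open>card K\<close>: \<open>P\<close> collects these columns and \<open>Q\<close> puts
  them back in place.\<close>

lemma corank_le_coords:
  assumes A: "A \<in> carrier_mat n n" and C: "C \<in> carrier_mat n n" and K: "K \<subseteq> {..<n}"
    and z: "\<And>i j. i < n \<Longrightarrow> j < n \<Longrightarrow> j \<notin> K \<Longrightarrow> C $$ (i, j) = 0" and d: "det (A + C) \<noteq> 0"
  shows "corank_le n (card K) A"
proof -
  obtain e where e: "bij_betw e {0..<card K} K" using K finite_subset ex_bij_betw_nat_finite by blast
  have eK: "e t \<in> K" "e t < n" if "t < card K" for t using e that K by (auto simp: bij_betw_def)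
  have einj: "e t = e t' \<longleftrightarrow> t = t'" if "t < card K" "t' < card K" for t t'
    using e that by (auto simp: bij_betw_def inj_on_eq_iff)
  define P where "P = mat n (card K) (\<lambda>(i, t). C $$ (i, e t))"
  define Q where "Q = mat (card K) n (\<lambda>(t, i). if i = e t then 1 else (0::complex))"
  have P: "P \<in> carrier_mat n (card K)" and Q: "Q \<in> carrier_mat (card K) n" unfolding P_def Q_def by auto
  have "P * Q = C"
  proof (rule eq_matI)
    fix i j assume "i < dim_row C" "j < dim_col C"
    hence ij: "i < n" "j < n" using C by auto
    have PQ: "(P * Q) $$ (i, j) = (\<Sum>t<card K. P $$ (i, t) * Q $$ (t, j))"
      by (rule mat_mult_index[OF P Q ij])
    show "(P * Q) $$ (i, j) = C $$ (i, j)"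
    proof (cases "j \<in> K")
      case True
      then obtain t where t: "t < card K" "j = e t"
        using e unfolding bij_betw_def by (metis atLeastLessThan_iff imageE)
      have "(\<Sum>t<card K. P $$ (i, t) * Q $$ (t, j)) = (\<Sum>t'<card K. if t' = t then C $$ (i, j) else 0)"
        by (rule sum.cong) (use ij t einj in \<open>auto simp: P_def Q_def\<close>)
      thus ?thesis using t PQ by simp
    next
      case False
      have "(\<Sum>t<card K. P $$ (i, t) * Q $$ (t, j)) = 0"
        by (rule sum.neutral) (use ij eK False in \<open>auto simp: P_def Q_def\<close>)
      thus ?thesis using False z ij PQ by simp
    qed
  qed (use C P Q in auto)
  thus ?thesis unfolding corank_le_def using d P Q by blast
qed

text \<open>The number of boxes in the first \<open>k\<close> columns, which is the kernel dimension
  of the \<open>k\<close>-th power of a nilpotent matrix of type \<open>p\<close>.\<close>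

definition msum :: "nat \<Rightarrow> nat list \<Rightarrow> nat" where
  "msum k p = (\<Sum>x\<leftarrow>p. min k x)"

lemma card_first_columns: "card {b \<in> diagram p. snd b < k} = msum k p"
proof -
  have "{b \<in> diagram p. snd b < k} = Sigma {..<length p} (\<lambda>r. {..<min k (p ! r)})" by auto
  hence "card {b \<in> diagram p. snd b < k} = (\<Sum>r<length p. min k (p ! r))" by simp
  also have "\<dots> = msum k p" unfolding msum_def by (simp add: sum_list_sum_nth atLeast0LessThan)
  finally show ?thesis .
qed

lemma card_first_columns_label:
  assumes "labelling m p \<beta>"
  shows "card (\<beta> ` {b \<in> diagram p. snd b < k}) = msum k p"
  unfolding card_first_columns[symmetric]
  by (rule card_image) (use assms in \<open>auto simp: labelling_def bij_betw_def intro: inj_on_subset\<close>)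

lemma label_first_columns:
  assumes "labelling m p \<beta>" "r < length p" "c < p ! r"
  shows "\<beta> (r, c) \<in> \<beta> ` {b \<in> diagram p. snd b < k} \<longleftrightarrow> c < k"
proof -
  have "\<beta> (r, c) \<in> \<beta> ` {b \<in> diagram p. snd b < k} \<longleftrightarrow> (r, c) \<in> {b \<in> diagram p. snd b < k}"
    by (rule inj_on_image_mem_iff[of \<beta> "diagram p"]) (use assms in \<open>auto simp: labelling_def bij_betw_def\<close>)
  thus ?thesis using assms by simp
qed

text \<open>Reflecting the boxes of the first \<open>k\<close> columns in their rows completes the \<open>k\<close>-th power to a
  permutation matrix.\<close>

lemma shift_mat_pow_rank:
  assumes L: "labelling m p \<beta>"
  shows "kills m (msum k p) (shift_mat m p \<beta> ^\<^sub>m k)" "corank_le m (msum k p) (shift_mat m p \<beta> ^\<^sub>m k)"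
proof -
  let ?A = "pmat m (shift_map p \<beta> k)"
  let ?K = "\<beta> ` {b \<in> diagram p. snd b < k}"
  have K: "?K \<subseteq> {..<m}" using L unfolding labelling_def bij_betw_def by auto
  have "kills m (card ?K) ?A"
  proof (rule kills_coords[OF _ K])
    fix i j assume "i < m" "j \<in> ?K"
    then obtain r c where "r < length p" "c < p ! r" "c < k" "j = \<beta> (r, c)" by auto
    thus "?A $$ (i, j) = 0" using \<open>i < m\<close> labelling_less[OF L, of r c] shift_map_label[OF L, of r c k] by simp
  qed simp
  thus "kills m (msum k p) (shift_mat m p \<beta> ^\<^sub>m k)"
    unfolding shift_mat_pow[OF L] card_first_columns_label[OF L] .
  \<comment> \<open>The reflected boxes land in the last \<open>k\<close> columns of their row (in
    the whole row if it is shorter), which are exactly the boxes that no shift by \<open>k\<close>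
    reaches.\<close>
  define \<pi> where "\<pi> = (\<lambda>j. case the_inv_into (diagram p) \<beta> j of (r, c) \<Rightarrow> \<beta> (r, if c < k then p ! r - 1 - c else c - k))"
  have \<pi>: "\<pi> (\<beta> (r, c)) = \<beta> (r, if c < k then p ! r - 1 - c else c - k)" if "r < length p" "c < p ! r" for r c
    unfolding \<pi>_def labelling_inv[OF L that] by simp
  have \<pi>m: "\<pi> j < m" if "j < m" for j
  proof -
    obtain r c where rc: "r < length p" "c < p ! r" "j = \<beta> (r, c)" using labellingE[OF L \<open>j < m\<close>] by blast
    show ?thesis unfolding rc(3) \<pi>[OF rc(1,2)] by (rule labelling_less[OF L]) (use rc in auto)
  qed
  have inj: "inj_on \<pi> {..<m}"
  proof (rule inj_onI)
    fix i j assume "i \<in> {..<m}" "j \<in> {..<m}" and eq: "\<pi> i = \<pi> j"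
    hence "i < m" "j < m" by auto
    obtain r c where rc: "r < length p" "c < p ! r" "i = \<beta> (r, c)" using labellingE[OF L \<open>i < m\<close>] by blast
    obtain r' c' where rc': "r' < length p" "c' < p ! r'" "j = \<beta> (r', c')" using labellingE[OF L \<open>j < m\<close>] by blast
    have "r = r' \<and> (if c < k then p ! r - 1 - c else c - k) = (if c' < k then p ! r' - 1 - c' else c' - k)"
      using eq unfolding rc(3) rc'(3) \<pi>[OF rc(1,2)] \<pi>[OF rc'(1,2)]
      by (subst (asm) labelling_eq_iff[OF L rc(1) _ rc'(1)]) (use rc rc' in auto)
    hence "r = r'" "c = c'" using rc rc' by (auto split: if_splits)
    thus "i = j" using rc(3) rc'(3) by simp
  qed
  hence "bij_betw \<pi> {..<m} {..<m}"
    using \<pi>m endo_inj_surj[of "{..<m}" \<pi>] by (auto simp: bij_betw_def)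
  then obtain \<rho> where \<rho>: "\<And>i. i < m \<Longrightarrow> \<rho> i < m" "\<And>i. i < m \<Longrightarrow> \<pi> (\<rho> i) = i"
    using bij_lessThan_inverse by blast
  have "pmat m (Some \<circ> \<pi>) * pmat m (Some \<circ> \<rho>) = 1\<^sub>m m"
    by (subst pmat_mult) (auto intro!: eq_matI simp: \<rho> map_comp_def)
  hence "det (pmat m (Some \<circ> \<pi>)) * det (pmat m (Some \<circ> \<rho>)) = 1"
    by (metis det_mult det_one pmat_carrier)
  hence dn: "det (pmat m (Some \<circ> \<pi>)) \<noteq> 0" by auto
  define C where "C = mat m m (\<lambda>(i, j). if j \<in> ?K \<and> i = \<pi> j then 1 else (0::complex))"
  have AC: "?A + C = pmat m (Some \<circ> \<pi>)"
  proof (rule eq_matI)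
    fix i j assume "i < dim_row (pmat m (Some \<circ> \<pi>))" "j < dim_col (pmat m (Some \<circ> \<pi>))"
    hence ij: "i < m" "j < m" by auto
    obtain r c where rc: "r < length p" "c < p ! r" "j = \<beta> (r, c)" using labellingE[OF L \<open>j < m\<close>] by blast
    have j: "j \<in> ?K \<longleftrightarrow> c < k" unfolding rc(3) by (rule label_first_columns[OF L rc(1,2)])
    show "(?A + C) $$ (i, j) = pmat m (Some \<circ> \<pi>) $$ (i, j)"
      using ij j shift_map_label[OF L rc(1,2), of k, folded rc(3)] \<pi>[OF rc(1,2), folded rc(3)]
      by (auto simp: C_def)
  qed (auto simp: C_def)
  have "corank_le m (card ?K) ?A"
    by (rule corank_le_coords[OF _ _ K, of _ C]) (use AC dn in \<open>auto simp: C_def\<close>)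
  thus "corank_le m (msum k p) (shift_mat m p \<beta> ^\<^sub>m k)"
    unfolding shift_mat_pow[OF L] card_first_columns_label[OF L] .
qed

lemma similar_mat_pow: "similar_mat A B \<Longrightarrow> similar_mat (A ^\<^sub>m k) (B ^\<^sub>m k)"
  using similar_mat_wit_pow unfolding similar_mat_def by blast

lemma nilpotent_orbit_carrier: "M \<in> nilpotent_orbit m p \<Longrightarrow> M \<in> carrier_mat m m"
  unfolding nilpotent_orbit_def by simp

lemma nilpotent_orbit_rank:
  assumes "M \<in> nilpotent_orbit m p" "0 \<notin> set p" "sum_list p = m"
  shows "kills m (msum k p) (M ^\<^sub>m k)" "corank_le m (msum k p) (M ^\<^sub>m k)"
proof -
  obtain \<beta> where L: "labelling m p \<beta>" using labelling_exists[of p] assms by auto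
  have "similar_mat (shift_mat m p \<beta> ^\<^sub>m k) (M ^\<^sub>m k)"
    using nilpotent_orbit_iff[OF L assms(2,3)] assms(1) similar_mat_pow similar_mat_sym by blast
  moreover have "shift_mat m p \<beta> ^\<^sub>m k \<in> carrier_mat m m" by (simp add: shift_mat_def)
  ultimately show "kills m (msum k p) (M ^\<^sub>m k)" "corank_le m (msum k p) (M ^\<^sub>m k)"
    using shift_mat_pow_rank[OF L, of k] kills_similar corank_le_similar by blast+
qed

text \<open>Only the Jordan blocks with eigenvalue 0 contribute to the kernel of the
  \<open>k\<close>-th power; as this kernel is everything, no other eigenvalue occurs.\<close>

lemma nilpotent_orbit_exists:
  assumes M: "M \<in> carrier_mat m m" and nil: "M ^\<^sub>m k = 0\<^sub>m m m"
  shows "\<exists>p. 0 \<notin> set p \<and> sum_list p = m \<and> M \<in> nilpotent_orbit m p"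
proof -
  obtain as where "char_poly M = (\<Prod>a\<leftarrow>as. [:- a, 1:])" using char_poly_factorized[OF M] by auto
  from jordan_nf_exists[OF M this] obtain na where J: "jordan_nf M na" by auto
  hence z: "0 \<notin> fst ` set na" and sim: "similar_mat M (jordan_matrix na)" unfolding jordan_nf_def by auto
  have "jordan_matrix na \<in> carrier_mat m m" using similar_matD[OF sim] M by auto
  hence s: "sum_list (map fst na) = m" by (metis carrier_matD(1) jordan_matrix_dim(1))
  have "char_matrix M 0 = M" unfolding char_matrix_def using M by (intro eq_matI) auto
  hence "dim_gen_eigenspace M 0 k = kernel_dim (0\<^sub>m m m :: complex mat)"
    unfolding dim_gen_eigenspace_def using nil by simp
  \<comment> \<open>The zero matrix is written as a power of a nilpotent Jordan block, whose kernel
    dimension is known.\<close>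
  also have "0\<^sub>m m m = (jordan_block m (0 :: complex)) ^\<^sub>m m"
    unfolding jordan_block_zero_pow by (intro eq_matI) auto
  also have "kernel_dim \<dots> = m"
    unfolding kernel_dim_def carrier_matD(2)[OF pow_carrier_mat[OF jordan_block_carrier]]
    using dim_kernel_zero_jordan_block_pow[where 'a = complex, of m m] unfolding min.idem .
  finally have "(\<Sum>n\<leftarrow>map fst [(n, e)\<leftarrow>na. e = 0]. min k n) = sum_list (map fst na)"
    using dim_gen_eigenspace[OF J, of 0 k] s by simp
  moreover have le: "(\<Sum>n\<leftarrow>map fst [(n, e)\<leftarrow>xs. e = 0]. min k n) \<le> sum_list (map fst xs)" for xs :: "(nat \<times> complex) list"
    by (induct xs) auto
  \<comment> \<open>A block contributes at most its size, and nothing if its eigenvalue is nonzero;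
    equality of the totals therefore excludes nonzero eigenvalues.\<close>
  have "(\<Sum>n\<leftarrow>map fst [(n, e)\<leftarrow>xs. e = 0]. min k n) = sum_list (map fst xs) \<Longrightarrow> 0 \<notin> fst ` set xs \<Longrightarrow> \<forall>x\<in>set xs. snd x = 0"
    for xs :: "(nat \<times> complex) list"
  proof (induct xs)
    case (Cons x xs)
    obtain n e where x: "x = (n, e)" by force
    from Cons.prems le[of xs] have "e = 0" unfolding x
      by (auto split: if_splits) 
    moreover from Cons.prems(1) le[of xs] have "(\<Sum>n\<leftarrow>map fst [(n, e)\<leftarrow>xs. e = 0]. min k n) = sum_list (map fst xs)"
      unfolding x \<open>e = 0\<close> by (simp add: min_def split: if_splits)
    ultimately show ?case using Cons.hyps(1) Cons.prems unfolding x by auto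
  qed simp
  ultimately have e: "\<forall>x\<in>set na. snd x = 0" using z by blast
  have "map (\<lambda>k. (k, 0)) (map fst na) = na"
    unfolding map_map comp_def by (rule map_idI) (use e in \<open>auto simp: prod_eq_iff\<close>)
  thus ?thesis using z s J M unfolding nilpotent_orbit_def
    by (intro exI[of _ "map fst na"]) auto
qed

text \<open>The second difference of \<open>k \<mapsto> min k y\<close> is -1 at
  \<open>k = y\<close> and 0 at all other positive \<open>k\<close>. So the kernel dimensions of the
  powers recover the multiplicity of every part.\<close>

lemma msum_count: "x > 0 \<Longrightarrow> 2 * msum x p = msum (x - 1) p + msum (x + 1) p + count (mset p) x"
  by (induct p) (auto simp: msum_def min_def)

lemma msum_eq_mset:
  assumes "\<And>k. msum k p = msum k q" "0 \<notin> set p" "0 \<notin> set q"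
  shows "mset p = mset q"
proof (rule multiset_eqI)
  fix x show "count (mset p) x = count (mset q) x"
  proof (cases "x = 0")
    case True thus ?thesis using assms(2,3) by (metis count_eq_zero_iff set_mset_mset)
  next
    case False thus ?thesis using msum_count[of x p] msum_count[of x q] assms(1) by simp
  qed
qed

lemma msum_large: "(\<And>x. x \<in> set p \<Longrightarrow> x \<le> k) \<Longrightarrow> msum k p = sum_list p"
  by (induct p) (auto simp: msum_def)

lemma partitions_mset_eq:
  assumes "p \<in> partitions m" "q \<in> partitions m'" "mset p = mset q"
  shows "p = q"
proof -
  have "sorted (rev p)" "sorted (rev q)" using assms unfolding partitions_def by (auto simp: sorted_wrt_rev)
  thus ?thesis using assms(3) by (metis mset_rev properties_for_sort rev_rev_ident)
qed

section \<open>Generic Jordan types of incidence spaces\<close>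

lemma partitionsD: "p \<in> partitions m \<Longrightarrow> 0 \<notin> set p \<and> sum_list p = m"
  unfolding partitions_def by auto

lemma nilpotent_orbit_nonempty:
  assumes "p \<in> partitions m" shows "nilpotent_orbit m p \<noteq> {}"
proof -
  obtain \<beta> where L: "labelling m p \<beta>" using labelling_exists[of p] partitionsD[OF assms] by auto
  have "similar_mat (shift_mat m p \<beta>) (shift_mat m p \<beta>)" by (rule similar_mat_refl[of _ m]) (simp add: shift_mat_def)
  thus ?thesis using nilpotent_orbit_iff[OF L] partitionsD[OF assms] by blast
qed

lemma nilpotent_orbit_similar: "M \<in> nilpotent_orbit m p \<Longrightarrow> similar_mat M' M \<Longrightarrow> M' \<in> nilpotent_orbit m p"
  using similar_matD[of M' M] unfolding nilpotent_orbit_def jordan_nf_def by (auto intro: similar_mat_trans)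

lemma member_part_le: "x \<in> set p \<Longrightarrow> x \<le> sum_list (p :: nat list)"
  by (induct p) auto

lemma nilpotent_orbit_pow:
  assumes "M \<in> nilpotent_orbit m p" "0 \<notin> set p" "sum_list p = m"
  shows "M ^\<^sub>m m = 0\<^sub>m m m"
proof -
  obtain \<beta> where L: "labelling m p \<beta>" using labelling_exists[of p] assms by auto
  have "shift_mat m p \<beta> ^\<^sub>m m = 0\<^sub>m m m"
    unfolding shift_mat_pow[OF L]
  proof (rule eq_matI)
    fix i j assume "i < dim_row (0\<^sub>m m m)" "j < dim_col (0\<^sub>m m m)"
    hence ij: "i < m" "j < m" by auto
    obtain r c where rc: "r < length p" "c < p ! r" "j = \<beta> (r, c)" using labellingE[OF L ij(2)] by blast
    have "c < m" using rc member_part_le[of "p ! r" p] assms(3) by auto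
    thus "pmat m (shift_map p \<beta> m) $$ (i, j) = 0\<^sub>m m m $$ (i, j)"
      using ij shift_map_label[OF L rc(1,2), folded rc(3)] by simp
  qed auto
  hence "similar_mat (M ^\<^sub>m m) (0\<^sub>m m m)"
    using nilpotent_orbit_iff[OF L assms(2,3)] assms(1) similar_mat_pow by metis
  from similar_matD[OF this] obtain n P Q where PQ: "{M ^\<^sub>m m, 0\<^sub>m m m, P, Q} \<subseteq> carrier_mat n n"
    and M: "M ^\<^sub>m m = P * 0\<^sub>m m m * Q" by blast
  have "n = m" using PQ by (auto simp only: insert_subset carrier_mat_def mem_Collect_eq index_zero_mat)
  hence "P \<in> carrier_mat m m" "Q \<in> carrier_mat m m" using PQ by auto
  thus ?thesis unfolding M by simp
qed

lemma closure_M_carrier: "closure_M n S \<subseteq> carrier_mat n n"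
  unfolding closure_M_def by (rule zariski_closure_carrier)

text \<open>Nilpotency with a fixed exponent is a closed condition, since the entries of the power
  are polynomials.\<close>

lemma closure_orbit_pow:
  assumes M: "M \<in> closure_M m (nilpotent_orbit m p)" and p: "0 \<notin> set p" "sum_list p = m"
  shows "M ^\<^sub>m m = 0\<^sub>m m m"
proof (rule eq_matI)
  fix i j assume "i < dim_row (0\<^sub>m m m)" "j < dim_col (0\<^sub>m m m)"
  hence ij: "i < m" "j < m" by auto
  have f: "poly_on (carrier_mat m m) (mat_coords m) (\<lambda>x. (x ^\<^sub>m m) $$ (i, j))"
    using mat_poly_on_pow[OF mat_poly_on_id] ij unfolding mat_poly_on_def by blast
  have "(M ^\<^sub>m m) $$ (i, j) = 0"
    by (rule zariski_closureD[OF M[unfolded closure_M_def] _ f])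
       (use nilpotent_orbit_carrier nilpotent_orbit_pow[OF _ p] ij in auto)
  thus "(M ^\<^sub>m m) $$ (i, j) = 0\<^sub>m m m $$ (i, j)" using ij by simp
qed (use M closure_M_carrier in auto)

section \<open>Semicontinuity of kernel dimensions\<close>

text \<open>Upper bounds on a kernel dimension are open: the correction \<open>P Q\<close> found at
  \<open>x\<close> is kept fixed, and the determinant of the corrected matrix is the polynomial
  \<open>f\<close>.\<close>

lemma corank_le_poly:
  assumes "mat_poly_on X cs m F" "x \<in> X" "corank_le m s (F x)"
  shows "\<exists>f. poly_on X cs f \<and> f x \<noteq> 0 \<and> (\<forall>y\<in>X. f y \<noteq> 0 \<longrightarrow> corank_le m s (F y))"
proof -
  obtain P Q where PQ: "P \<in> carrier_mat m s" "Q \<in> carrier_mat s m" "det (F x + P * Q) \<noteq> 0"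
    using assms(3) unfolding corank_le_def by auto
  have "poly_on X cs (\<lambda>y. det (F y + P * Q))"
    by (rule mat_poly_on_det[OF mat_poly_on_add[OF assms(1) mat_poly_on_const]]) (use PQ in simp)
  thus ?thesis using PQ unfolding corank_le_def by blast
qed

text \<open>Kernels can only grow in the limit: where \<open>f\<close> is nonzero the kernel of the
  \<open>k\<close>-th power is at most as large as at \<open>M\<close>, and this open set contains a
  point of the orbit of \<open>p\<close>.\<close>

lemma closure_orbit_msum_le:
  assumes M: "M \<in> closure_M m (nilpotent_orbit m p)" and p: "0 \<notin> set p" "sum_list p = m"
    and Mq: "M \<in> nilpotent_orbit m q" and q: "0 \<notin> set q" "sum_list q = m"
  shows "msum k p \<le> msum k q"
proof -
  obtain f where f: "poly_on (carrier_mat m m) (mat_coords m) f" "f M \<noteq> 0"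
    "\<forall>y\<in>carrier_mat m m. f y \<noteq> 0 \<longrightarrow> corank_le m (msum k q) (y ^\<^sub>m k)"
    using corank_le_poly[OF mat_poly_on_pow[OF mat_poly_on_id] nilpotent_orbit_carrier[OF Mq] nilpotent_orbit_rank(2)[OF Mq q]]
    by blast
  have "\<exists>N\<in>nilpotent_orbit m p. f N \<noteq> 0"
  proof (rule ccontr)
    assume "\<not> ?thesis"
    hence "f M = 0"
      using zariski_closureD[OF M[unfolded closure_M_def] _ f(1)] nilpotent_orbit_carrier by blast
    thus False using f(2) by simp
  qed
  then obtain N where N: "N \<in> nilpotent_orbit m p" "f N \<noteq> 0" by blast
  have Nc: "N \<in> carrier_mat m m" by (rule nilpotent_orbit_carrier[OF N(1)])
  show ?thesis
    by (rule kills_le_corank[of "N ^\<^sub>m k" m])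
       (use f(3) Nc N nilpotent_orbit_rank(1)[OF N(1) p] in auto)
qed

text \<open>On the whole line the kernel dimensions are at least those of \<open>p\<close> by
  \<open>lower\<close>; where the determinants found at \<open>t0\<close> do not vanish they are at
  most those of \<open>p\<close>. Off the finitely many zeros they agree, and the kernel dimensions
  of the powers fix the type.\<close>

lemma orbit_line_finite:
  assumes F: "mat_poly_on UNIV {\<lambda>t. t} m F" and p: "0 \<notin> set p" "sum_list p = m"
    and t0: "F t0 \<in> nilpotent_orbit m p" and nil: "\<And>t. F t ^\<^sub>m m = 0\<^sub>m m m"
    and lower: "\<And>t k q. 0 \<notin> set q \<Longrightarrow> sum_list q = m \<Longrightarrow> F t \<in> nilpotent_orbit m q \<Longrightarrow> msum k p \<le> msum k q"
  shows "finite {t. F t \<notin> nilpotent_orbit m p}"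
proof -
  have Fc: "F t \<in> carrier_mat m m" for t using F unfolding mat_poly_on_def by auto
  have "\<exists>f. poly_on UNIV {\<lambda>t. t} f \<and> f t0 \<noteq> 0 \<and> (\<forall>t. f t \<noteq> 0 \<longrightarrow> corank_le m (msum k p) (F t ^\<^sub>m k))" for k
    using corank_le_poly[OF mat_poly_on_pow[OF F] UNIV_I nilpotent_orbit_rank(2)[OF t0 p], of k] by auto
  then obtain f where f: "\<And>k. poly_on UNIV {\<lambda>t. t} (f k)" "\<And>k. f k t0 \<noteq> 0"
    "\<And>k t. f k t \<noteq> 0 \<Longrightarrow> corank_le m (msum k p) (F t ^\<^sub>m k)" by metis
  \<comment> \<open>Powers beyond the \<open>m\<close>-th give no further condition, since every
    part is at most \<open>m\<close>; so finitely many polynomials decide.\<close>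
  have "{t. F t \<notin> nilpotent_orbit m p} \<subseteq> (\<Union>k\<le>m. {t. f k t = 0})"
  proof
    fix t assume t: "t \<in> {t. F t \<notin> nilpotent_orbit m p}"
    show "t \<in> (\<Union>k\<le>m. {t. f k t = 0})"
    proof (rule ccontr)
      assume nt: "t \<notin> (\<Union>k\<le>m. {t. f k t = 0})"
      obtain q where q: "0 \<notin> set q" "sum_list q = m" "F t \<in> nilpotent_orbit m q"
        using nilpotent_orbit_exists[OF Fc nil] by blast
      have "msum k p = msum k q" for k
      proof (cases "k \<le> m")
        case True
        hence "corank_le m (msum k p) (F t ^\<^sub>m k)" using f(3) nt by auto
        from kills_le_corank[OF _ this nilpotent_orbit_rank(1)[OF q(3,1,2)]]
        have "msum k q \<le> msum k p" using Fc by simp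
        thus ?thesis using lower[OF q] by (simp add: le_antisym)
      next
        case False
        hence "msum k p = sum_list p" "msum k q = sum_list q"
          using member_part_le p q by (force intro!: msum_large)+
        thus ?thesis using p q by simp
      qed
      hence "mset p = mset q" using msum_eq_mset p q by blast
      thus False using nilpotent_orbit_mset[of p q m] p q t by simp
    qed
  qed
  moreover have "finite (\<Union>k\<le>m. {t. f k t = 0})"
    using poly_on_line_finite[OF f(1,2)] by simp
  ultimately show ?thesis using finite_subset by blast
qed

lemma closure_orbit_antisym:
  assumes p: "p \<in> partitions m" and q: "q \<in> partitions m"
    and M: "M \<in> nilpotent_orbit m p" "M \<in> closure_M m (nilpotent_orbit m q)"
    and N: "N \<in> nilpotent_orbit m q" "N \<in> closure_M m (nilpotent_orbit m p)"
  shows "p = q"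
proof -
  note P = partitionsD[OF p] and Q = partitionsD[OF q]
  have "msum k p = msum k q" for k
    using closure_orbit_msum_le[of M m q p k] closure_orbit_msum_le[of N m p q k] M N P Q by (simp add: le_antisym)
  hence "mset p = mset q" using msum_eq_mset P Q by blast
  thus ?thesis using partitions_mset_eq[OF p q] by simp
qed

section \<open>Incidence spaces and their generic orbits\<close>

definition incidence :: "nat \<Rightarrow> (nat \<times> nat) set \<Rightarrow> complex mat set" where
  "incidence m R = {M \<in> carrier_mat m m. \<forall>i<m. \<forall>j<m. M $$ (i, j) \<noteq> 0 \<longrightarrow> (i, j) \<in> R}"

lemma incidence_carrier: "M \<in> incidence m R \<Longrightarrow> M \<in> carrier_mat m m"
  unfolding incidence_def by simp

definition line :: "complex mat \<Rightarrow> complex mat \<Rightarrow> complex \<Rightarrow> complex mat" where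
  "line A E t = A + t \<cdot>\<^sub>m E"

lemma line_poly: "A \<in> carrier_mat m m \<Longrightarrow> E \<in> carrier_mat m m \<Longrightarrow> mat_poly_on UNIV {\<lambda>t. t} m (line A E)"
  unfolding line_def[abs_def]
  by (intro mat_poly_on_add mat_poly_on_smult mat_poly_on_const poly_on_coord) auto

lemma line_incidence: "A \<in> incidence m R \<Longrightarrow> E \<in> incidence m R \<Longrightarrow> line A E t \<in> incidence m R"
  unfolding line_def incidence_def by (auto, metis add.right_neutral mult_zero_right)

text \<open>Formulated with the full orbit instead of its part inside the incidence space, so that
  single matrices may be conjugated out of the space.\<close>

definition generic_type :: "nat \<Rightarrow> (nat \<times> nat) set \<Rightarrow> nat list \<Rightarrow> bool" where
  "generic_type m R p \<longleftrightarrow> p \<in> partitions m \<and> incidence m R \<inter> nilpotent_orbit m p \<noteq> {} \<and>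
     incidence m R \<subseteq> closure_M m (nilpotent_orbit m p)"

lemma generic_type_unique:
  assumes "generic_type m R p" "generic_type m R q"
  shows "p = q"
proof -
  have pq: "p \<in> partitions m" "q \<in> partitions m" using assms unfolding generic_type_def by auto
  obtain M where M: "M \<in> incidence m R" "M \<in> nilpotent_orbit m p" using assms(1) unfolding generic_type_def by blast
  obtain N where N: "N \<in> incidence m R" "N \<in> nilpotent_orbit m q" using assms(2) unfolding generic_type_def by blast
  show ?thesis
    by (rule closure_orbit_antisym[OF pq M(2) _ N(2)]) (use assms M N in \<open>auto simp: generic_type_def\<close>)
qed

text \<open>The lower bounds on kernels hold on the whole space because it lies in the orbit
  closure; hence an orbit reached once on a line is left at finitely many points only.\<close>

lemma generic_type_generic:
  assumes g: "generic_type m R p" and F: "mat_poly_on UNIV {\<lambda>t. t} m F" "\<And>t. F t \<in> incidence m R"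
    and t0: "F t0 \<in> nilpotent_orbit m p"
  shows "finite {t. F t \<notin> nilpotent_orbit m p}"
proof -
  have p: "0 \<notin> set p" "sum_list p = m" using g partitionsD unfolding generic_type_def by auto
  have c: "F t \<in> closure_M m (nilpotent_orbit m p)" for t using g F(2) unfolding generic_type_def by blast
  show ?thesis
    by (rule orbit_line_finite[OF F(1) p t0 closure_orbit_pow[OF c p]]) (rule closure_orbit_msum_le[OF c p])
qed

text \<open>Conjugation by a fixed matrix is a polynomial map that preserves the orbit.\<close>

lemma closure_orbit_similar:
  assumes M: "M \<in> closure_M m (nilpotent_orbit m p)" and s: "similar_mat M' M"
  shows "M' \<in> closure_M m (nilpotent_orbit m p)"
proof -
  obtain n P Q where PQ: "{M', M, P, Q} \<subseteq> carrier_mat n n" "P * Q = 1\<^sub>m n" "Q * P = 1\<^sub>m n" "M' = P * M * Q"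
    using similar_matD[OF s] by blast
  have [simp]: "n = m" using PQ(1) subsetD[OF closure_M_carrier M] by auto
  have "P * M * Q \<in> closure_M m (nilpotent_orbit m p)"
  proof (rule closure_M_map[OF M[unfolded closure_M_def], where F = "\<lambda>X. P * X * Q"])
    show "mat_poly_on (carrier_mat m m) (mat_coords m) m (\<lambda>X. P * X * Q)"
      using PQ(1) by (intro mat_poly_on_mult mat_poly_on_const mat_poly_on_id) auto
    fix X assume X: "X \<in> nilpotent_orbit m p"
    have "similar_mat (P * X * Q) X"
      by (rule similar_matI[of _ _ P Q m]) (use PQ nilpotent_orbit_carrier[OF X] in auto)
    from nilpotent_orbit_similar[OF X this]
    show "P * X * Q \<in> closure_M m (nilpotent_orbit m p)"
      using zariski_closure_subset[of "nilpotent_orbit m p" "carrier_mat m m"] nilpotent_orbit_carrier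
      unfolding closure_M_def by blast
  qed (auto intro: nilpotent_orbit_carrier)
  thus ?thesis using PQ(4) by simp
qed

lemma generic_type_relabel:
  assumes g: "generic_type m R p" and \<pi>: "bij_betw \<pi> {..<m} {..<m}"
    and R: "\<And>i j. i < m \<Longrightarrow> j < m \<Longrightarrow> (i, j) \<in> R \<longleftrightarrow> (\<pi> i, \<pi> j) \<in> R'"
  shows "generic_type m R' p"
proof -
  obtain \<rho> where \<pi>m: "\<And>i. i < m \<Longrightarrow> \<pi> i < m" and \<rho>m: "\<And>i. i < m \<Longrightarrow> \<rho> i < m"
    and \<rho>\<pi>: "\<And>i. i < m \<Longrightarrow> \<rho> (\<pi> i) = i" and \<pi>\<rho>: "\<And>i. i < m \<Longrightarrow> \<pi> (\<rho> i) = i"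
    using bij_lessThan_inverse[OF \<pi>] by blast
  obtain N where N: "N \<in> incidence m R" "N \<in> nilpotent_orbit m p" using g unfolding generic_type_def by blast
  define N' where "N' = mat m m (\<lambda>(i, j). N $$ (\<rho> i, \<rho> j))"
  have "similar_mat N' N"
    by (rule similar_mat_relabel[OF \<pi>]) (use N incidence_carrier in \<open>auto simp: N'_def \<pi>m \<rho>\<pi>\<close>)
  moreover have "N' \<in> incidence m R'"
    unfolding incidence_def
  proof (intro CollectI conjI allI impI)
    fix i j assume ij: "i < m" "j < m" "N' $$ (i, j) \<noteq> 0"
    hence "(\<rho> i, \<rho> j) \<in> R" using N(1) \<rho>m unfolding incidence_def N'_def by simp
    thus "(i, j) \<in> R'" using R[OF \<rho>m \<rho>m] \<pi>\<rho> ij by simp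
  qed (simp add: N'_def)
  ultimately have 1: "incidence m R' \<inter> nilpotent_orbit m p \<noteq> {}" using nilpotent_orbit_similar[OF N(2)] by blast
  have "M \<in> closure_M m (nilpotent_orbit m p)" if M: "M \<in> incidence m R'" for M
  proof -
    define M' where "M' = mat m m (\<lambda>(i, j). M $$ (\<pi> i, \<pi> j))"
    have "similar_mat M M'"
      by (rule similar_mat_relabel[OF \<pi>]) (use M incidence_carrier in \<open>auto simp: M'_def\<close>)
    moreover have "M' \<in> incidence m R"
      unfolding incidence_def
    proof (intro CollectI conjI allI impI)
      fix i j assume ij: "i < m" "j < m" "M' $$ (i, j) \<noteq> 0"
      hence "(\<pi> i, \<pi> j) \<in> R'" using M \<pi>m unfolding incidence_def M'_def by simp
      thus "(i, j) \<in> R" using R ij by simp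
    qed (simp add: M'_def)
    ultimately show ?thesis using g closure_orbit_similar unfolding generic_type_def by blast
  qed
  thus ?thesis using g 1 unfolding generic_type_def by blast
qed

text \<open>A matrix of the larger space with nonzero entry at \<open>(u, v)\<close> is conjugate
  into the smaller one, and such matrices are dense: moving in the direction of the matrix unit at
  \<open>(u, v)\<close> makes this entry nonzero except at one parameter.\<close>

lemma generic_type_remove:
  assumes uv: "(u, v) \<in> R'" "u < m" "v < m" and sub: "R' \<subseteq> R"
    and conj: "\<And>M. M \<in> incidence m R \<Longrightarrow> M $$ (u, v) \<noteq> 0 \<Longrightarrow> \<exists>M'\<in>incidence m R'. similar_mat M' M"
  shows "generic_type m R p \<longleftrightarrow> generic_type m R' p"
proof -
  have incs: "incidence m R' \<subseteq> incidence m R" using sub unfolding incidence_def by auto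
  define E where "E = mat m m (\<lambda>(i, j). if i = u \<and> j = v then 1 else (0 :: complex))"
  have E: "E \<in> incidence m R" using uv sub unfolding incidence_def E_def by auto
  have Ec: "E \<in> carrier_mat m m" by (rule incidence_carrier[OF E])
  have entry: "line M E t $$ (u, v) = M $$ (u, v) + t" if "M \<in> incidence m R" for M t
    using incidence_carrier[OF that] uv unfolding line_def E_def by simp
  show ?thesis
  proof
    assume g: "generic_type m R' p"
    have *: "M \<in> closure_M m (nilpotent_orbit m p)" if "M \<in> incidence m R" "M $$ (u, v) \<noteq> 0" for M
      using conj[OF that] g closure_orbit_similar similar_mat_sym unfolding generic_type_def by blast
    have "M \<in> closure_M m (nilpotent_orbit m p)" if M: "M \<in> incidence m R" for M
    proof -
      have "{t. line M E t \<notin> closure_M m (nilpotent_orbit m p)} \<subseteq> {- M $$ (u, v)}"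
      proof
        fix t assume "t \<in> {t. line M E t \<notin> closure_M m (nilpotent_orbit m p)}"
        hence "line M E t $$ (u, v) = 0" using *[OF line_incidence[OF M E]] by blast
        thus "t \<in> {- M $$ (u, v)}" using entry[OF M] by (simp add: eq_neg_iff_add_eq_0 add.commute)
      qed
      hence "line M E 0 \<in> closure_M m (nilpotent_orbit m p)"
        by (intro closure_M_line line_poly incidence_carrier[OF M] Ec) (auto intro: finite_subset)
      moreover have "line M E 0 = M" unfolding line_def using incidence_carrier[OF M] Ec by (intro eq_matI) auto
      ultimately show ?thesis by simp
    qed
    thus "generic_type m R p" using g incs unfolding generic_type_def by blast
  next
    \<comment> \<open>Type \<open>p\<close> and a nonzero entry at \<open>(u, v)\<close> must hold
      at the same time; each fails at finitely many points of the line through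
      \<open>N\<close>.\<close>
    assume g: "generic_type m R p"
    then obtain N where N: "N \<in> incidence m R" "N \<in> nilpotent_orbit m p" unfolding generic_type_def by blast
    have N0: "line N E 0 = N" unfolding line_def using incidence_carrier[OF N(1)] Ec by (intro eq_matI) auto
    have "finite {t. line N E t \<notin> nilpotent_orbit m p}"
      by (rule generic_type_generic[OF g line_poly[OF incidence_carrier[OF N(1)] Ec] line_incidence[OF N(1) E], of 0])
         (use N N0 in simp)
    hence "finite ({t. line N E t \<notin> nilpotent_orbit m p} \<union> {- N $$ (u, v)})" by simp
    then obtain t where t: "t \<notin> {t. line N E t \<notin> nilpotent_orbit m p} \<union> {- N $$ (u, v)}"
      using ex_new_if_finite[OF infinite_UNIV_char_0] by blast
    hence "line N E t $$ (u, v) \<noteq> 0" using entry[OF N(1)] by (auto simp: eq_neg_iff_add_eq_0 add.commute)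
    from conj[OF line_incidence[OF N(1) E] this] obtain M' where "M' \<in> incidence m R'" "similar_mat M' (line N E t)" by blast
    moreover have "line N E t \<in> nilpotent_orbit m p" using t by simp
    ultimately have "incidence m R' \<inter> nilpotent_orbit m p \<noteq> {}" using nilpotent_orbit_similar by blast
    thus "generic_type m R' p" using g incs unfolding generic_type_def by blast
  qed
qed

section \<open>Clearing a position by an elementary conjugation\<close>

text \<open>The conjugation subtracts \<open>x\<close> times row \<open>b\<close> from row
  \<open>a\<close> and adds \<open>x\<close> times column \<open>a\<close> to column
  \<open>b\<close>; \<open>row\<close> and \<open>col\<close> keep both changes inside
  \<open>R\<close>. The excluded positions \<open>(a, a)\<close>, \<open>(b, b)\<close>,
  \<open>(b, a)\<close> are those that both operations together would bring to
  \<open>(a, b)\<close>.\<close>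

lemma incidence_transvection:
  assumes M: "M \<in> incidence m R" and ab: "a < m" "b < m" "a \<noteq> b" "(a, a) \<notin> R" "(b, b) \<notin> R" "(b, a) \<notin> R"
    and row: "\<And>l. (b, l) \<in> R \<Longrightarrow> (a, l) \<in> R" and col: "\<And>l. (l, a) \<in> R \<Longrightarrow> (l, b) \<in> R"
  shows "add_col_sub_row x a b M \<in> incidence m R"
proof -
  have Mc: "M \<in> carrier_mat m m" by (rule incidence_carrier[OF M])
  have z: "M $$ (i, j) = 0" if "i < m" "j < m" "(i, j) \<notin> R" for i j using M that unfolding incidence_def by blast
  have "(i, j) \<in> R" if ij: "i < m" "j < m" "add_col_sub_row x a b M $$ (i, j) \<noteq> 0" for i j
  proof (rule ccontr)
    assume nR: "(i, j) \<notin> R"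
    have "M $$ (b, j) = 0" if "i = a" using z[of b j] row[of j] nR that ij ab by auto
    moreover have "M $$ (i, a) = 0" if "j = b" using z[of i a] col[of i] nR that ij ab by auto
    ultimately have "add_col_sub_row x a b M $$ (i, j) = 0"
      using ij(1,2) Mc ab z[OF ij(1,2) nR] z[OF ab(1,1) ab(4)] z[OF ab(2,2) ab(5)] z[OF ab(2,1) ab(6)]
      by (subst add_col_sub_index_row) auto
    thus False using ij by simp
  qed
  thus ?thesis using Mc unfolding incidence_def by auto
qed

text \<open>Subtracting a multiple of row \<open>j\<close> from row \<open>i\<close> clears
  \<open>(i, k)\<close> with the pivot \<open>(j, k)\<close>.\<close>

lemma generic_type_remove_row:
  assumes d: "i < m" "j < m" "k < m" "(i, k) \<in> R" "(j, k) \<in> R" "i \<noteq> j" "(i, i) \<notin> R" "(j, j) \<notin> R" "(j, i) \<notin> R"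
    and row: "\<And>l. (j, l) \<in> R \<Longrightarrow> (i, l) \<in> R" and col: "\<And>l. (l, i) \<in> R \<Longrightarrow> (l, j) \<in> R"
  shows "generic_type m R p \<longleftrightarrow> generic_type m (R - {(i, k)}) p"
proof (rule generic_type_remove[of j k])
  fix M assume M: "M \<in> incidence m R" "M $$ (j, k) \<noteq> 0"
  let ?M = "add_col_sub_row (M $$ (i, k) / M $$ (j, k)) i j M"
  have Mc: "M \<in> carrier_mat m m" by (rule incidence_carrier[OF M(1)])
  have incidence: "?M \<in> incidence m R" by (rule incidence_transvection[OF M(1)]) (use d row col in auto)
  \<comment> \<open>The position \<open>(i, k)\<close> must not lie in column \<open>j\<close>,
    which the conjugation also changes.\<close>
  have "k \<noteq> j" using d by auto
  hence "?M $$ (i, k) = 0" using M(2) Mc d by simp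
  hence "?M \<in> incidence m (R - {(i, k)})" using incidence unfolding incidence_def by auto
  thus "\<exists>M'\<in>incidence m (R - {(i, k)}). similar_mat M' M" using add_col_sub_row_similar[OF Mc d(1,2,6)] by blast
qed (use d in auto)

text \<open>Dually, a multiple of column \<open>j\<close> added to column \<open>k\<close> clears
  \<open>(i, k)\<close> with the pivot \<open>(i, j)\<close>.\<close>

lemma generic_type_remove_col:
  assumes d: "i < m" "j < m" "k < m" "(i, k) \<in> R" "(i, j) \<in> R" "j \<noteq> k" "(j, j) \<notin> R" "(k, k) \<notin> R" "(k, j) \<notin> R"
    and row: "\<And>l. (k, l) \<in> R \<Longrightarrow> (j, l) \<in> R" and col: "\<And>l. (l, j) \<in> R \<Longrightarrow> (l, k) \<in> R"
  shows "generic_type m R p \<longleftrightarrow> generic_type m (R - {(i, k)}) p"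
proof (rule generic_type_remove[of i j])
  fix M assume M: "M \<in> incidence m R" "M $$ (i, j) \<noteq> 0"
  let ?M = "add_col_sub_row (- (M $$ (i, k) / M $$ (i, j))) j k M"
  have Mc: "M \<in> carrier_mat m m" by (rule incidence_carrier[OF M(1)])
  have incidence: "?M \<in> incidence m R" by (rule incidence_transvection[OF M(1)]) (use d row col in auto)
  have "i \<noteq> j" using d by auto
  hence "?M $$ (i, k) = 0" using M(2) Mc d by simp
  hence "?M \<in> incidence m (R - {(i, k)})" using incidence unfolding incidence_def by auto
  thus "\<exists>M'\<in>incidence m (R - {(i, k)}). similar_mat M' M" using add_col_sub_row_similar[OF Mc d(2,3,6)] by blast
qed (use d in auto)

section \<open>Incidence spaces graded by the columns of a diagram\<close>

text \<open>A nonzero entry of the power comes from a path of \<open>k\<close> positions in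
  \<open>R\<close>, each of which raises \<open>c\<close> by at least 1.\<close>

lemma incidence_graded_pow:
  assumes M: "M \<in> incidence m R" and gr: "\<And>i j. i < m \<Longrightarrow> j < m \<Longrightarrow> (i, j) \<in> R \<Longrightarrow> (c i :: nat) < c j"
    and ij: "i < m" "j < m" "(M ^\<^sub>m k) $$ (i, j) \<noteq> 0"
  shows "c i + k \<le> c j"
  using ij
proof (induct k arbitrary: j)
  case 0
  thus ?case using incidence_carrier[OF M] by (auto split: if_splits)
next
  case (Suc k)
  have Mc: "M \<in> carrier_mat m m" by (rule incidence_carrier[OF M])
  have "(M ^\<^sub>m Suc k) $$ (i, j) = (\<Sum>l<m. (M ^\<^sub>m k) $$ (i, l) * M $$ (l, j))"
    unfolding pow_mat.simps by (rule mat_mult_index) (use Mc Suc.prems in auto)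
  then obtain l where l: "l < m" "(M ^\<^sub>m k) $$ (i, l) \<noteq> 0" "M $$ (l, j) \<noteq> 0"
    using Suc.prems(3) by (metis (no_types, lifting) lessThan_iff mult_not_zero sum.not_neutral_contains_not_neutral)
  have "c i + k \<le> c l" by (rule Suc.hyps) (use l Suc.prems in auto)
  moreover have "c l < c j" using gr[of l j] M l Suc.prems unfolding incidence_def by blast
  ultimately show ?case by simp
qed

text \<open>The column index bounds the kernels from below on the whole space: the
  \<open>k\<close>-th power annihilates every box in the first \<open>k\<close> columns. The shift
  attains all these bounds, and a line joins it to any other matrix of the space, so
  \<open>orbit_line_finite\<close> puts that matrix into the orbit closure.\<close>

lemma generic_type_tableau:
  assumes p: "p \<in> partitions m" and L: "labelling m p \<beta>"
    and nb: "\<And>r c. r < length p \<Longrightarrow> Suc c < p ! r \<Longrightarrow> (\<beta> (r, c), \<beta> (r, Suc c)) \<in> R"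
    and gr: "\<And>r c r' c'. r < length p \<Longrightarrow> c < p ! r \<Longrightarrow> r' < length p \<Longrightarrow> c' < p ! r' \<Longrightarrow>
       (\<beta> (r, c), \<beta> (r', c')) \<in> R \<Longrightarrow> c < c'"
  shows "generic_type m R p"
proof -
  have p0: "0 \<notin> set p" "sum_list p = m" using partitionsD[OF p] by auto
  let ?N = "shift_mat m p \<beta>" and ?K = "\<lambda>k. \<beta> ` {b \<in> diagram p. snd b < k}"
  define col where "col = (\<lambda>i. snd (the_inv_into (diagram p) \<beta> i))"
  have col: "col (\<beta> (r, c)) = c" if "r < length p" "c < p ! r" for r c
    unfolding col_def labelling_inv[OF L that] by simp
  have gr': "col i < col j" if ij: "i < m" "j < m" "(i, j) \<in> R" for i j
  proof -
    obtain r c where rc: "r < length p" "c < p ! r" "i = \<beta> (r, c)" using labellingE[OF L ij(1)] by blast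
    obtain r' c' where rc': "r' < length p" "c' < p ! r'" "j = \<beta> (r', c')" using labellingE[OF L ij(2)] by blast
    show ?thesis using gr[OF rc(1,2) rc'(1,2)] ij(3) col[OF rc(1,2)] col[OF rc'(1,2)] unfolding rc(3) rc'(3) by simp
  qed
  have colm: "col j < m" if j: "j < m" for j
  proof -
    obtain r c where rc: "r < length p" "c < p ! r" "j = \<beta> (r, c)" using labellingE[OF L j] by blast
    thus ?thesis using col[OF rc(1,2)] member_part_le[of "p ! r" p] p0 by auto
  qed
  have K: "?K k \<subseteq> {..<m}" for k using L unfolding labelling_def bij_betw_def by auto
  have kills: "kills m (msum k p) (M ^\<^sub>m k)" if M: "M \<in> incidence m R" for M k
    unfolding card_first_columns_label[OF L, symmetric]
  proof (rule kills_coords[OF _ K])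
    show "M ^\<^sub>m k \<in> carrier_mat m m" using incidence_carrier[OF M] by simp
    fix i j assume i: "i < m" and "j \<in> ?K k"
    then obtain r c where rc: "r < length p" "c < p ! r" "c < k" "j = \<beta> (r, c)" by auto
    have "j < m" using rc labelling_less[OF L] by auto
    thus "(M ^\<^sub>m k) $$ (i, j) = 0"
      using incidence_graded_pow[OF M gr' i] col[OF rc(1,2)] rc(3,4) by fastforce
  qed
  have nil: "M ^\<^sub>m m = 0\<^sub>m m m" if M: "M \<in> incidence m R" for M
  proof (rule eq_matI)
    fix i j assume "i < dim_row (0\<^sub>m m m)" "j < dim_col (0\<^sub>m m m)"
    hence ij: "i < m" "j < m" by auto
    thus "(M ^\<^sub>m m) $$ (i, j) = 0\<^sub>m m m $$ (i, j)"
      using incidence_graded_pow[where k = m, OF M gr' ij] colm[OF ij(2)] by fastforce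
  qed (use incidence_carrier[OF M] in auto)
  have N: "?N \<in> incidence m R"
    unfolding incidence_def
  proof (intro CollectI conjI allI impI)
    fix i j assume ij: "i < m" "j < m" "?N $$ (i, j) \<noteq> 0"
    obtain r c where rc: "r < length p" "c < p ! r" "j = \<beta> (r, c)" using labellingE[OF L ij(2)] by blast
    have "c \<noteq> 0" "i = \<beta> (r, c - 1)"
      using ij shift_map_label[OF L rc(1,2), of 1, folded rc(3)] unfolding shift_mat_def by (auto split: if_splits)
    thus "(i, j) \<in> R" using nb[of r "c - 1"] rc by auto
  qed (simp add: shift_mat_def)
  have NO: "?N \<in> nilpotent_orbit m p"
    using nilpotent_orbit_iff[OF L p0] similar_mat_refl[OF incidence_carrier[OF N]] by blast
  have "M \<in> closure_M m (nilpotent_orbit m p)" if M: "M \<in> incidence m R" for M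
  proof -
    define E where "E = mat m m (\<lambda>(i, j). M $$ (i, j) - ?N $$ (i, j))"
    have E: "E \<in> incidence m R" using M N unfolding incidence_def E_def by fastforce
    have l0: "line ?N E 0 = ?N" and l1: "line ?N E 1 = M"
      unfolding line_def using incidence_carrier[OF N] incidence_carrier[OF E] incidence_carrier[OF M] by (auto intro!: eq_matI simp: E_def)
    note lp = line_poly[OF incidence_carrier[OF N] incidence_carrier[OF E]]
    have "finite {t. line ?N E t \<notin> nilpotent_orbit m p}"
    proof (rule orbit_line_finite[OF lp p0, of 0])
      show "line ?N E 0 \<in> nilpotent_orbit m p" using l0 NO by simp
      show "line ?N E t ^\<^sub>m m = 0\<^sub>m m m" for t by (rule nil[OF line_incidence[OF N E]])
      fix t k q assume q: "0 \<notin> set q" "sum_list q = m" "line ?N E t \<in> nilpotent_orbit m q"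
      show "msum k p \<le> msum k q"
        by (rule kills_le_corank[OF _ nilpotent_orbit_rank(2)[OF q(3,1,2)] kills[OF line_incidence[OF N E]]])
           (use incidence_carrier[OF line_incidence[OF N E]] in simp)
    qed
    hence "finite {t. line ?N E t \<notin> closure_M m (nilpotent_orbit m p)}"
      by (rule rev_finite_subset)
         (use zariski_closure_subset[of "nilpotent_orbit m p" "carrier_mat m m"] nilpotent_orbit_carrier in \<open>auto simp: closure_M_def\<close>)
    from closure_M_line[OF lp this, of 1] show ?thesis unfolding l1 .
  qed
  thus ?thesis using p N NO unfolding generic_type_def by blast
qed

subsection \<open>Words and Knuth moves\<close>

text \<open>The non-inversions. For distinct letters, the matrices supported on them are those that
  are strictly upper triangular both in the order of the positions and in the order of the
  letters.\<close>

definition word_rel :: "'a::linorder list \<Rightarrow> (nat \<times> nat) set" where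
  "word_rel w = {(p, q). p < q \<and> q < length w \<and> w ! p < w ! q}"

definition word_type :: "'a::linorder list \<Rightarrow> nat list \<Rightarrow> bool" where
  "word_type w p \<longleftrightarrow> generic_type (length w) (word_rel w) p"

inductive knuth1 :: "'a::linorder list \<Rightarrow> 'a list \<Rightarrow> bool" where
  yxz: "x < y \<Longrightarrow> y < z \<Longrightarrow> knuth1 (u @ [y, x, z] @ v) (u @ [y, z, x] @ v)"
| xzy: "x < y \<Longrightarrow> y < z \<Longrightarrow> knuth1 (u @ [x, z, y] @ v) (u @ [z, x, y] @ v)"

lemma nth_swap:
  "i < length (u @ [x, y] @ v) \<Longrightarrow>
   (u @ [y, x] @ v) ! Transposition.transpose (length u) (Suc (length u)) i = (u @ [x, y] @ v) ! i"
  by (auto simp: nth_append nth_Cons' Transposition.transpose_def)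

text \<open>Exchanging neighbours \<open>x < y\<close> destroys the non-inversion between them and
  no other, so the remaining ones match after a transposition of two indices.\<close>

lemma generic_type_swap:
  assumes xy: "x < y" and m: "m = length (u @ [x, y] @ v)"
  shows "generic_type m (word_rel (u @ [x, y] @ v) - {(length u, Suc (length u))}) p \<longleftrightarrow> generic_type m (word_rel (u @ [y, x] @ v)) p"
proof -
  let ?w = "u @ [x, y] @ v" and ?w' = "u @ [y, x] @ v" and ?n = "length u"
  let ?\<pi> = "Transposition.transpose ?n (Suc ?n)"
  have \<pi>m: "?\<pi> i < m" if "i < m" for i using that m by (auto simp: Transposition.transpose_def)
  have bij: "bij_betw ?\<pi> {..<m} {..<m}"
    by (rule bij_betw_byWitness[where f' = ?\<pi>]) (use \<pi>m in auto)
  have rel: "(i, j) \<in> word_rel ?w - {(?n, Suc ?n)} \<longleftrightarrow> (?\<pi> i, ?\<pi> j) \<in> word_rel ?w'" if ij: "i < m" "j < m" for i j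
  proof -
    have "?w' ! ?\<pi> i = ?w ! i" "?w' ! ?\<pi> j = ?w ! j" using nth_swap[of _ u x y v] ij m by auto
    moreover have "?w ! ?n = x" "?w ! Suc ?n = y" by (auto simp: nth_append)
    moreover have "?\<pi> i < length ?w'" "?\<pi> j < length ?w'" using \<pi>m ij m by auto
    ultimately show ?thesis using xy m ij unfolding word_rel_def
      by (auto simp: Transposition.transpose_def split: if_splits)
  qed
  have rel': "(i, j) \<in> word_rel ?w' \<longleftrightarrow> (?\<pi> i, ?\<pi> j) \<in> word_rel ?w - {(?n, Suc ?n)}" if ij: "i < m" "j < m" for i j
    using rel[OF \<pi>m[OF ij(1)] \<pi>m[OF ij(2)]] by simp
  show ?thesis
    using generic_type_relabel[OF _ bij rel] generic_type_relabel[OF _ bij rel'] by blast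
qed

text \<open>The letter \<open>y\<close> clears the position between \<open>x\<close> and
  \<open>z\<close>. In \<open>y x z\<close>, the row of \<open>y\<close> is contained in that of
  \<open>x\<close> and the column of \<open>x\<close> in that of \<open>y\<close>, so the row of
  \<open>y\<close> may be subtracted. In \<open>x z y\<close>, the column of \<open>y\<close> is
  contained in that of \<open>z\<close> and the row of \<open>z\<close> in that of \<open>y\<close>,
  so the column of \<open>y\<close> may be used. After the removal the neighbours \<open>x\<close>
  and \<open>z\<close> can be exchanged.\<close>

lemma word_type_knuth1:
  assumes "knuth1 w w'"
  shows "word_type w p \<longleftrightarrow> word_type w' p"
  using assms
proof cases
  case (yxz x y z u v)
  let ?n = "length u" and ?R = "word_rel w" and ?m = "length w"
  have nth: "w ! ?n = y" "w ! Suc ?n = x" "w ! Suc (Suc ?n) = z" and len: "Suc (Suc ?n) < ?m" "length w' = ?m"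
    unfolding yxz by (auto simp: nth_append)
  have "generic_type ?m ?R p \<longleftrightarrow> generic_type ?m (?R - {(Suc ?n, Suc (Suc ?n))}) p"
  proof (rule generic_type_remove_row[where j = ?n])
    fix l assume "(?n, l) \<in> ?R"
    thus "(Suc ?n, l) \<in> ?R" using yxz(3) nth unfolding word_rel_def by (cases "l = Suc ?n") auto
  next
    fix l assume "(l, Suc ?n) \<in> ?R"
    thus "(l, ?n) \<in> ?R" using yxz(3) nth unfolding word_rel_def by (cases "l = ?n") auto
  qed (use len nth yxz(3,4) in \<open>auto simp: word_rel_def\<close>)
  also have "\<dots> \<longleftrightarrow> generic_type ?m (word_rel w') p"
    using generic_type_swap[of x z ?m "u @ [y]" v p] yxz by simp
  finally show ?thesis unfolding word_type_def len(2) .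
next
  case (xzy x y z u v)
  let ?n = "length u" and ?R = "word_rel w" and ?m = "length w"
  have nth: "w ! ?n = x" "w ! Suc ?n = z" "w ! Suc (Suc ?n) = y" and len: "Suc (Suc ?n) < ?m" "length w' = ?m"
    unfolding xzy by (auto simp: nth_append)
  have "generic_type ?m ?R p \<longleftrightarrow> generic_type ?m (?R - {(?n, Suc ?n)}) p"
  proof (rule generic_type_remove_col[where j = "Suc (Suc ?n)"])
    fix l assume "(Suc ?n, l) \<in> ?R"
    thus "(Suc (Suc ?n), l) \<in> ?R" using xzy(4) nth unfolding word_rel_def by (cases "l = Suc (Suc ?n)") auto
  next
    fix l assume "(l, Suc (Suc ?n)) \<in> ?R"
    thus "(l, Suc ?n) \<in> ?R" using xzy(4) nth unfolding word_rel_def by (cases "l = Suc ?n") auto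
  qed (use len nth xzy(3,4) in \<open>auto simp: word_rel_def\<close>)
  also have "\<dots> \<longleftrightarrow> generic_type ?m (word_rel w') p"
    using generic_type_swap[of x z ?m u "y # v" p] xzy by simp
  finally show ?thesis unfolding word_type_def len(2) .
qed

definition knuth :: "'a::linorder list \<Rightarrow> 'a list \<Rightarrow> bool" where
  "knuth = (\<lambda>w w'. knuth1 w w' \<or> knuth1 w' w)\<^sup>*\<^sup>*"

lemma knuth_refl: "knuth w w" unfolding knuth_def by simp

lemma knuth_trans: "knuth u v \<Longrightarrow> knuth v w \<Longrightarrow> knuth u w" unfolding knuth_def by simp

lemma knuth_yxz: "x < y \<Longrightarrow> y < z \<Longrightarrow> knuth (u @ [y, x, z] @ v) (u @ [y, z, x] @ v)"
  unfolding knuth_def by (blast intro: knuth1.intros)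

lemma knuth_xzy: "x < y \<Longrightarrow> y < z \<Longrightarrow> knuth (u @ [x, z, y] @ v) (u @ [z, x, y] @ v)"
  unfolding knuth_def by (blast intro: knuth1.intros)

lemma knuth_sym: "knuth u v \<Longrightarrow> knuth v u"
  unfolding knuth_def
  by (induct rule: rtranclp_induct) (auto intro: converse_rtranclp_into_rtranclp)

lemma word_type_knuth: "knuth w w' \<Longrightarrow> word_type w p \<longleftrightarrow> word_type w' p"
  unfolding knuth_def by (induct rule: rtranclp_induct) (auto simp: word_type_knuth1)

lemma knuth1_context: "knuth1 w w' \<Longrightarrow> knuth1 (a @ w @ b) (a @ w' @ b)"
proof (induct rule: knuth1.induct)
  case (yxz x y z u v) thus ?case using knuth1.yxz[of x y z "a @ u" "v @ b"] by simp
next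
  case (xzy x y z u v) thus ?case using knuth1.xzy[of x y z "a @ u" "v @ b"] by simp
qed

lemma knuth_context: "knuth w w' \<Longrightarrow> knuth (a @ w @ b) (a @ w' @ b)"
  unfolding knuth_def
  by (induct rule: rtranclp_induct) (auto intro: rtranclp.rtrancl_into_rtrancl dest: knuth1_context[of _ _ a b])

text \<open>Reading backwards exchanges the two relations.\<close>

lemma knuth1_rev: "knuth1 w w' \<Longrightarrow> knuth1 (rev w') (rev w)"
proof (induct rule: knuth1.induct)
  case (yxz x y z u v) thus ?case using knuth1.xzy[of x y z "rev v" "rev u"] by simp
next
  case (xzy x y z u v) thus ?case using knuth1.yxz[of x y z "rev v" "rev u"] by simp
qed

lemma knuth_rev: "knuth w w' \<Longrightarrow> knuth (rev w) (rev w')"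
  unfolding knuth_def
  by (induct rule: rtranclp_induct) (auto intro: rtranclp.rtrancl_into_rtrancl dest: knuth1_rev)

section \<open>Row insertion\<close>

text \<open>Columns are compared between adjacent rows only, which suits the row by row recursion of
  insertion.\<close>

fun dom_row :: "'a::linorder list \<Rightarrow> 'a list list \<Rightarrow> bool" where
  "dom_row r [] = True"
| "dom_row r (t # T) = (length t \<le> length r \<and> (\<forall>j<length t. r ! j < t ! j))"

fun rows_tableau :: "'a::linorder list list \<Rightarrow> bool" where
  "rows_tableau [] = True"
| "rows_tableau (r # T) = (r \<noteq> [] \<and> sorted_wrt (<) r \<and> dom_row r T \<and> rows_tableau T)"

text \<open>Total, with value 0 beyond the last row, so that a shape can also be updated at the
  first empty row.\<close>

definition row_len :: "'a list list \<Rightarrow> nat \<Rightarrow> nat" where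
  "row_len T i = (if i < length T then length (T ! i) else 0)"

lemma row_len_Nil[simp]: "row_len [] i = 0" unfolding row_len_def by simp

lemma row_len_Cons_0[simp]: "row_len (r # T) 0 = length r" unfolding row_len_def by simp

lemma row_len_Cons_Suc[simp]: "row_len (r # T) (Suc i) = row_len T i" unfolding row_len_def by simp

text \<open>The row of the new box; the recursion follows the bumping.\<close>

fun ins_row :: "'a::linorder list list \<Rightarrow> 'a \<Rightarrow> nat" where
  "ins_row [] a = 0"
| "ins_row (r # T) a = (if \<forall>x\<in>set r. x < a then 0 else Suc (ins_row T (Min {x \<in> set r. a < x})))"

lemma row_insert_append[simp]:
  fixes a :: "'a::linorder"
  assumes "\<forall>x\<in>set r. x < a"
  shows "row_insert (r # T) a = (r @ [a]) # T" "ins_row (r # T) a = 0"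
  using assms by (simp_all add: row_insert.simps(2) ins_row.simps(2))

text \<open>With the row split at the bumped letter, \<open>Min\<close> and the replacement by
  \<open>map\<close> disappear; later inductions use only this form.\<close>

lemma row_insert_bump[simp]:
  fixes a :: "'a::linorder"
  assumes "\<forall>x\<in>set u. x < a" "a < b" "\<forall>x\<in>set v. b < x"
  shows "row_insert ((u @ b # v) # T) a = (u @ a # v) # row_insert T b"
    "ins_row ((u @ b # v) # T) a = Suc (ins_row T b)"
proof -
  have M: "Min {x \<in> set (u @ b # v). a < x} = b"
    by (rule Min_eqI) (use assms in \<open>auto intro: less_imp_le\<close>)
  have n: "\<not> (\<forall>x\<in>set (u @ b # v). x < a)" using assms(2) by auto
  have "b \<notin> set u" "b \<notin> set v" using assms by auto
  hence "map (\<lambda>x. if x = b then a else x) (u @ b # v) = u @ a # v"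
    by (auto intro!: map_idI)
  thus "row_insert ((u @ b # v) # T) a = (u @ a # v) # row_insert T b"
    using n M by (simp only: row_insert.simps if_False Let_def)
  show "ins_row ((u @ b # v) # T) a = Suc (ins_row T b)"
    using n M by (simp only: ins_row.simps if_False)
qed

declare row_insert.simps(2)[simp del] ins_row.simps(2)[simp del]

lemma row_split:
  fixes a :: "'a::linorder"
  assumes "sorted_wrt (<) r" "a \<notin> set r"
  obtains "\<forall>x\<in>set r. x < a" | u b v where "r = u @ b # v" "\<forall>x\<in>set u. x < a" "a < b" "\<forall>x\<in>set v. b < x"
proof -
  define u where "u = takeWhile (\<lambda>x. x < a) r"
  define v where "v = dropWhile (\<lambda>x. x < a) r"
  have r: "r = u @ v" and u: "\<forall>x\<in>set u. x < a" unfolding u_def v_def by (auto dest: set_takeWhileD)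
  show thesis
  proof (cases v)
    case Nil thus ?thesis using that(1) r u by auto
  next
    case (Cons b v')
    hence "\<not> b < a" using hd_dropWhile[of "\<lambda>x. x < a" r] unfolding v_def by auto
    moreover have "b \<noteq> a" using assms(2) r Cons by auto
    ultimately have "a < b" by auto
    moreover have "\<forall>x\<in>set v'. b < x" using assms(1) unfolding r Cons by (auto simp: sorted_wrt_append)
    ultimately show ?thesis using that(2)[of u b v'] r u Cons by auto
  qed
qed

definition entries :: "'a list list \<Rightarrow> 'a set" where
  "entries T = set (concat T)"

lemma entries_simps[simp]: "entries [] = {}" "entries (r # T) = set r \<union> entries T"
  unfolding entries_def by auto

definition tableau :: "'a::linorder list list \<Rightarrow> bool" where
  "tableau T \<longleftrightarrow> rows_tableau T \<and> distinct (concat T)"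

lemma tableau_Nil[simp]: "tableau []" unfolding tableau_def by simp

lemma tableau_Cons: "tableau (r # T) \<longleftrightarrow> r \<noteq> [] \<and> sorted_wrt (<) r \<and> dom_row r T \<and> tableau T \<and> set r \<inter> entries T = {}"
  unfolding tableau_def entries_def by (auto simp: strict_sorted_iff)

lemma row_insert_cases:
  assumes "tableau (r # T)" "a \<notin> entries (r # T)"
  obtains (append) "\<forall>x\<in>set r. x < a"
  | (bump) u b v where "r = u @ b # v" "\<forall>x\<in>set u. x < a" "a < b" "\<forall>x\<in>set v. b < x" "b \<notin> entries T"
proof -
  have "sorted_wrt (<) r" "a \<notin> set r" "set r \<inter> entries T = {}" using assms by (auto simp: tableau_Cons)
  thus thesis using that by (elim row_split) auto
qed

lemma entries_row_insert:
  assumes "tableau T" "a \<notin> entries T"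
  shows "entries (row_insert T a) = insert a (entries T)"
  using assms
proof (induct T arbitrary: a)
  case (Cons r T)
  show ?case using Cons.prems
  proof (cases rule: row_insert_cases)
    case (bump u b v)
    thus ?thesis using Cons.hyps[of b] Cons.prems(1) by (auto simp: tableau_Cons)
  qed auto
qed simp

text \<open>The bumping path moves weakly to the left: the entry below \<open>b\<close>, if there is
  one, exceeds \<open>b\<close>, so \<open>b\<close> enters the next row at or before the column it
  came from, where everything above is smaller.\<close>

lemma dom_row_insert:
  assumes d: "dom_row (u @ b # v) T" and a: "a < b" and u: "\<forall>x\<in>set u. x < a" and T: "tableau T" "b \<notin> entries T"
  shows "dom_row (u @ a # v) (row_insert T b)"
proof (cases T)
  case Nil
  show ?thesis using a u by (cases u) (auto simp: Nil)
next
  case (Cons t S)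
  have T': "tableau (t # S)" "b \<notin> entries (t # S)" using T Cons by auto
  have le: "(u @ a # v) ! j \<le> (u @ b # v) ! j" for j
    using a by (cases "j = length u") (auto simp: nth_append nth_Cons')
  have lt: "(u @ a # v) ! j < t ! j" if "j < length t" for j
    using d that le[of j] Cons by (auto intro: le_less_trans)
  have lb: "(u @ a # v) ! j < b" if "j \<le> length u" for j
    using that a u by (cases "j = length u") (auto simp: nth_append dest: nth_mem intro: less_trans)
  have len: "length t \<le> length (u @ a # v)" using d Cons by auto
  have bt: "b < t ! length u" if "length u < length t" using d Cons that by auto
  show ?thesis using T'
  proof (cases rule: row_insert_cases)
    case append
    have "length t \<le> length u" using append bt by (metis not_le nth_mem order_less_asym)
    thus ?thesis using append lt lb unfolding Cons by (auto simp: nth_append less_Suc_eq)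
  next
    case (bump u' c v')
    have "length u' \<le> length u"
    proof (rule ccontr)
      assume "\<not> ?thesis"
      hence l: "length u < length u'" by simp
      hence "t ! length u \<in> set u'" using bump(1) by (simp add: nth_append)
      hence "t ! length u < b" using bump(2) by auto
      thus False using bt l bump(1) by auto
    qed
    hence "(u @ a # v) ! j < (u' @ b # v') ! j" if "j < length t" for j
      using lt[OF that] lb[of j] bump(1) by (cases "j = length u'") (auto simp: nth_append nth_Cons')
    thus ?thesis using len bump unfolding Cons by auto
  qed
qed

lemma tableau_row_insert:
  assumes "tableau T" "a \<notin> entries T"
  shows "tableau (row_insert T a)"
  using assms
proof (induct T arbitrary: a)
  case Nil
  show ?case by (simp add: tableau_Cons)
next
  case (Cons r T)
  show ?case using Cons.prems
  proof (cases rule: row_insert_cases)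
    case append
    have "dom_row (r @ [a]) T" using Cons.prems(1) by (cases T) (auto simp: tableau_Cons nth_append)
    thus ?thesis using append Cons.prems by (auto simp: tableau_Cons sorted_wrt_append)
  next
    case (bump u b v)
    have T: "tableau T" using Cons.prems(1) by (simp add: tableau_Cons)
    have "tableau (row_insert T b)" by (rule Cons.hyps[OF T bump(5)])
    moreover have "dom_row (u @ a # v) (row_insert T b)"
      using dom_row_insert[OF _ bump(3,2) T bump(5)] Cons.prems(1) bump(1) by (auto simp: tableau_Cons)
    moreover have "set (u @ a # v) \<inter> entries (row_insert T b) = {}"
      using entries_row_insert[OF T bump(5)] Cons.prems bump by (auto simp: tableau_Cons)
    moreover have "sorted_wrt (<) (u @ a # v)"
      using Cons.prems(1) bump by (auto simp: tableau_Cons sorted_wrt_append intro: less_trans)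
    ultimately show ?thesis using bump by (auto simp: tableau_Cons)
  qed
qed

lemma row_len_row_insert:
  assumes "tableau T" "a \<notin> entries T"
  shows "row_len (row_insert T a) = (row_len T)(ins_row T a := Suc (row_len T (ins_row T a)))" "ins_row T a \<le> length T"
proof -
  have "(\<forall>i. row_len (row_insert T a) i = (if i = ins_row T a then Suc (row_len T i) else row_len T i)) \<and> ins_row T a \<le> length T"
    using assms
  proof (induct T arbitrary: a)
    case Nil
    show ?case by (auto simp: row_len_def)
  next
    case (Cons r T)
    show ?case using Cons.prems
    proof (cases rule: row_insert_cases)
      case append
      have "row_len ((r @ [a]) # T) i = (if i = 0 then Suc (row_len (r # T) i) else row_len (r # T) i)" for i by (cases i) auto
      thus ?thesis using append by simp
    next
      case (bump u b v)
      have *: "(\<forall>i. row_len (row_insert T b) i = (if i = ins_row T b then Suc (row_len T i) else row_len T i)) \<and> ins_row T b \<le> length T"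
        using Cons.hyps[of b] Cons.prems(1) bump(5) by (auto simp: tableau_Cons)
      have "row_len ((u @ a # v) # row_insert T b) i = (if i = Suc (ins_row T b) then Suc (row_len (r # T) i) else row_len (r # T) i)" for i
        using * bump(1) by (cases i) auto
      thus ?thesis using bump * by simp
    qed
  qed
  thus "row_len (row_insert T a) = (row_len T)(ins_row T a := Suc (row_len T (ins_row T a)))" "ins_row T a \<le> length T" by auto
qed

lemma row_len_antimono:
  assumes "rows_tableau T" "i \<le> j" shows "row_len T j \<le> row_len T i"
proof -
  have "row_len T (Suc i) \<le> row_len T i" for i
    using assms(1)
  proof (induct T arbitrary: i)
    case (Cons r T)
    show ?case
    proof (cases i)
      case 0 thus ?thesis using Cons.prems by (cases T) auto
    next
      case (Suc i') thus ?thesis using Cons by auto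
    qed
  qed simp
  thus ?thesis using assms(2) lift_Suc_antimono_le by blast
qed

section \<open>Row bumping and reverse insertion\<close>

lemma row_bumping:
  assumes "tableau T" "a \<notin> entries T" "b \<notin> entries T" "a \<noteq> b"
  shows "ins_row T a < ins_row (row_insert T a) b \<longleftrightarrow> b < a"
  using assms
proof (induct T arbitrary: a b)
  case Nil
  show ?case
  proof (cases "a < b")
    case True thus ?thesis by (auto)
  next
    case False
    hence "b < a" using Nil.prems(4) by auto
    thus ?thesis using row_insert_bump(2)[of "[]" b a "[]" "[]"] by simp
  qed
next
  case (Cons r T)
  note T' = tableau_row_insert[OF Cons.prems(1,2)]
  have bn: "b \<notin> entries (row_insert (r # T) a)" using entries_row_insert[OF Cons.prems(1,2)] Cons.prems by auto
  show ?case using Cons.prems(1,2)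
  proof (cases rule: row_insert_cases)
    case append
    show ?thesis
    proof (cases "a < b")
      case True
      hence "\<forall>x\<in>set (r @ [a]). x < b" using append by auto
      from row_insert_append(2)[OF this] show ?thesis using append True by auto
    next
      case False
      have "tableau ((r @ [a]) # T)" "b \<notin> entries ((r @ [a]) # T)" using T' bn append by auto
      thus ?thesis using append False Cons.prems(4) by (cases rule: row_insert_cases) auto
    qed
  next
    case (bump u c v)
    note o = bump
    have T: "tableau T" using Cons.prems(1) by (simp add: tableau_Cons)
    have IH: "ins_row T c < ins_row (row_insert T c) d \<longleftrightarrow> d < c" if "d \<notin> entries T" "c \<noteq> d" for d
      by (rule Cons.hyps[OF T bump(5) that])
    have y: "tableau ((u @ a # v) # row_insert T c)" "b \<notin> entries ((u @ a # v) # row_insert T c)" using T' bn bump by auto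
    show ?thesis using y
    proof (cases rule: row_insert_cases)
      case append
      thus ?thesis using bump row_insert_append(2)[OF append] by auto
    next
      case (bump u' d v')
      note b = this
      have dn: "d \<notin> entries T" "c \<noteq> d" using b(5) entries_row_insert[OF T \<open>c \<notin> entries T\<close>] by auto
      have i1: "ins_row (r # T) a = Suc (ins_row T c)" "row_insert (r # T) a = (u @ a # v) # row_insert T c"
        unfolding o(1) using row_insert_bump[OF o(2,3,4)] by blast+
      have i2: "ins_row ((u @ a # v) # row_insert T c) b = Suc (ins_row (row_insert T c) d)"
        unfolding b(1) by (rule row_insert_bump(2)[OF b(2,3,4)])
      have d: "d \<in> set (u @ a # v)" using b(1) by simp
      \<comment> \<open>\<open>c\<close> and \<open>d\<close> are the letters bumped from the first
        row by \<open>a\<close> and then by \<open>b\<close>; the induction continues with them in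
        place of \<open>a\<close> and \<open>b\<close>.\<close>
      have "d < c \<longleftrightarrow> b < a"
      proof
        assume "d < c"
        hence "d \<in> set u \<or> d = a" using d \<open>\<forall>x\<in>set v. c < x\<close> by auto
        thus "b < a" using b(3) \<open>\<forall>x\<in>set u. x < a\<close> by (auto intro: less_trans)
      next
        assume "b < a"
        have "a \<in> set (u' @ d # v')" using b(1)[symmetric] by simp
        hence "d \<le> a" using b(2,4) \<open>b < a\<close> by (auto dest: less_asym less_imp_le)
        thus "d < c" using \<open>a < c\<close> by (rule le_less_trans)
      qed
      thus ?thesis unfolding i1 i2 using IH[OF dn] by simp
    qed
  qed
qed

text \<open>The inserted \<open>a\<close> is the largest entry of the new row below the bumped
  \<open>b\<close>, so the bumped letter tells where to undo the step.\<close>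

lemma filter_less_split:
  fixes a :: "'a::linorder"
  assumes "\<forall>x\<in>set u. x < a" "a < b" "\<forall>x\<in>set v. b < x"
  shows "filter (\<lambda>x. x < b) (u @ a # v) = u @ [a]" "filter (\<lambda>x. \<not> x < b) (u @ a # v) = v"
proof -
  have "filter (\<lambda>x. x < b) u = u" "filter (\<lambda>x. \<not> x < b) u = []"
    using assms(1,2) by (auto simp: filter_id_conv filter_empty_conv intro: less_trans)
  moreover have "filter (\<lambda>x. x < b) v = []" "filter (\<lambda>x. \<not> x < b) v = v"
    using assms(3) by (auto simp: filter_id_conv filter_empty_conv dest: less_asym)
  ultimately show "filter (\<lambda>x. x < b) (u @ a # v) = u @ [a]" "filter (\<lambda>x. \<not> x < b) (u @ a # v) = v"
    using assms(2) by auto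
qed

text \<open>Undoing goes from the bottom: the lower rows and the letter bumped into them are
  recovered first, and that letter locates \<open>a\<close> in the first row.\<close>

lemma row_insert_inj:
  assumes "tableau T" "a \<notin> entries T" "tableau U" "b \<notin> entries U"
    and "row_insert T a = row_insert U b" "ins_row T a = ins_row U b"
  shows "T = U \<and> a = b"
  using assms
proof (induct T arbitrary: a b U)
  case Nil
  show ?case
  proof (cases U)
    case Nil thus ?thesis using Nil.prems by simp
  next
    case (Cons r S)
    have "tableau (r # S)" "b \<notin> entries (r # S)" using Nil.prems Cons by auto
    thus ?thesis using Nil.prems unfolding Cons by (cases rule: row_insert_cases) (auto simp: tableau_Cons)
  qed
next
  case (Cons r T)
  show ?case
  proof (cases U)
    case Nil
    show ?thesis using Cons.prems(1,2)
      by (cases rule: row_insert_cases) (use Cons.prems(5,6) Nil in \<open>auto simp: tableau_Cons\<close>, use Cons.prems in \<open>auto simp: tableau_Cons\<close>)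
  next
    case U: (Cons s S)
    have U': "tableau (s # S)" "b \<notin> entries (s # S)" using Cons.prems U by auto
    show ?thesis using Cons.prems(1,2)
    proof (cases rule: row_insert_cases)
      case append
      show ?thesis using U' by (cases rule: row_insert_cases) (use append Cons.prems(5,6) U in auto)
    next
      case (bump u c v)
      note b1 = this
      show ?thesis using U'
      proof (cases rule: row_insert_cases)
        case append
        thus ?thesis using b1 Cons.prems(6) U by auto
      next
        case (bump u' c' v')
        have e: "u @ a # v = u' @ b # v'" "row_insert T c = row_insert S c'" "ins_row T c = ins_row S c'"
          using Cons.prems(5,6) b1 bump U by auto
        have TS: "T = S \<and> c = c'"
          by (rule Cons.hyps) (use e b1 bump Cons.prems U' in \<open>auto simp: tableau_Cons\<close>)
        note f1 = filter_less_split[OF b1(2,3,4)] and f2 = filter_less_split[OF bump(2,3,4)]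
        have "u @ [a] = u' @ [b]" "v = v'" using f1 f2 TS e(1) by metis+
        thus ?thesis using TS b1 bump U by auto
      qed
    qed
  qed
qed

text \<open>Reverse bumping replaces \<open>c\<close> by the larger \<open>b\<close>. All entries
  right of \<open>c\<close> exceed \<open>b\<close>, so \<open>b\<close> had entered the lower row
  weakly left of \<open>c\<close>, and the columns stay increasing.\<close>

lemma dom_row_uninsert:
  assumes d: "dom_row (u @ c # v) (row_insert S b)" and cb: "c < b" and v: "\<forall>x\<in>set v. b < x" and S: "tableau S" "b \<notin> entries S"
    and srt: "sorted_wrt (<) (u @ c # v)"
  shows "dom_row (u @ b # v) S"
proof (cases S)
  case Nil thus ?thesis by simp
next
  case (Cons s S')
  have S': "tableau (s # S')" "b \<notin> entries (s # S')" using S Cons by auto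
  have ge: "b < (u @ c # v) ! j" if "length u < j" "j < length (u @ c # v)" for j
    using v that by (auto simp: nth_append nth_Cons')
  show ?thesis using S'
  proof (cases rule: row_insert_cases)
    case append
    have d': "length s < length (u @ c # v)" "\<forall>j<Suc (length s). (u @ c # v) ! j < (s @ [b]) ! j"
      using d append unfolding Cons by auto
    have "length s \<le> length u"
    proof (rule ccontr)
      assume "\<not> ?thesis"
      hence "b < (u @ c # v) ! length s" using ge d'(1) by simp
      moreover have "(u @ c # v) ! length s < b" using d'(2)[rule_format, of "length s"] by simp
      ultimately show False by (rule less_asym)
    qed
    hence "(u @ b # v) ! j < s ! j" if "j < length s" for j
      using d'(2)[rule_format, of j] that by (auto simp: nth_append)
    thus ?thesis using d'(1) unfolding Cons by auto
  next
    case (bump u' e v')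
    have d': "length s \<le> length (u @ c # v)" "\<forall>j<length s. (u @ c # v) ! j < (u' @ b # v') ! j"
      using d bump unfolding Cons by auto
    have lu: "length u' < length s" using bump by auto
    have lu': "length u' \<le> length u"
    proof (rule ccontr)
      assume "\<not> ?thesis"
      hence "b < (u @ c # v) ! length u'" using ge d'(1) lu by simp
      moreover have "(u @ c # v) ! length u' < b" using d'(2)[rule_format, OF lu] by simp
      ultimately show False by (rule less_asym)
    qed
    have "(u @ b # v) ! j < s ! j" if j: "j < length s" for j
    proof (cases "j = length u")
      case True
      have "b < s ! j"
      proof (cases "j = length u'")
        case True thus ?thesis using bump by simp
      next
        case False
        hence "s ! length u' < s ! j" using lu' \<open>j = length u\<close> j S'(1) sorted_wrt_nth_less[of "(<)" s "length u'" j] by (auto simp: tableau_Cons)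
        thus ?thesis using bump by auto
      qed
      thus ?thesis using True by simp
    next
      case False
      hence "(u @ b # v) ! j = (u @ c # v) ! j" by (auto simp: nth_append nth_Cons')
      moreover have "(u' @ b # v') ! j \<le> s ! j" using bump by (auto simp: nth_append nth_Cons')
      ultimately show ?thesis using d'(2) j by (metis less_le_trans)
    qed
    thus ?thesis using d'(1) unfolding Cons by auto
  qed
qed

text \<open>Guarantees that reverse bumping always finds a smaller letter to replace in the row
  above.\<close>

lemma entries_first_row_less:
  assumes "rows_tableau (r # T)" "b \<in> entries T"
  shows "\<exists>x\<in>set r. x < b"
  using assms
proof (induct T arbitrary: r)
  case (Cons t T)
  have "\<exists>x\<in>set r. x < y" if y: "y \<in> set t" for y
  proof -
    obtain j where j: "j < length t" "t ! j = y" using y by (metis in_set_conv_nth)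
    thus ?thesis using Cons.prems(1) by (auto intro!: bexI[of _ "r ! j"])
  qed
  thus ?case using Cons.hyps[of t] Cons.prems by (auto) (meson less_trans)
qed simp

text \<open>Reverse insertion: the letter at the end of row \<open>i\<close> is removed and carried
  upwards, replacing in each row the largest smaller entry.\<close>

lemma row_insert_surj:
  assumes "tableau T'" "row_len T' (Suc i) < row_len T' i"
  shows "\<exists>T a. tableau T \<and> a \<notin> entries T \<and> row_insert T a = T' \<and> ins_row T a = i"
  using assms
proof (induct T' arbitrary: i)
  case (Cons r S)
  show ?case
  proof (cases i)
    case 0
    obtain r0 a where r: "r = r0 @ [a]" using Cons.prems(1) by (cases r rule: rev_cases) (auto simp: tableau_Cons)
    have lt: "\<forall>x\<in>set r0. x < a" using Cons.prems(1) r by (auto simp: tableau_Cons sorted_wrt_append)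
    show ?thesis
    proof (cases r0)
      \<comment> \<open>A row of one box disappears instead of becoming empty; the next row would be
        shorter still, so there is none.\<close>
      case Nil
      hence "row_len S 0 = 0" using Cons.prems(2) r 0 by simp
      hence "S = []" using Cons.prems(1) by (cases S) (auto simp: tableau_Cons)
      thus ?thesis using Nil r 0 by (intro exI[of _ "[]"] exI[of _ a]) simp
    next
      case (Cons x xs)
      have "dom_row r0 S" using Cons.prems r 0 \<open>tableau (r # S)\<close> \<open>row_len (r # S) (Suc i) < row_len (r # S) i\<close>
        by (cases S) (auto simp: tableau_Cons nth_append)
      hence "tableau (r0 # S)" "a \<notin> entries (r0 # S)"
        using \<open>tableau (r # S)\<close> Cons lt unfolding r by (auto simp: tableau_Cons sorted_wrt_append)
      thus ?thesis using lt r 0 by (intro exI[of _ "r0 # S"] exI[of _ a]) simp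
    qed
  next
    case (Suc i')
    have yS: "tableau S" using Cons.prems(1) by (simp add: tableau_Cons)
    obtain S0 b where S0: "tableau S0" "b \<notin> entries S0" "row_insert S0 b = S" "ins_row S0 b = i'"
      using Cons.hyps[OF yS, of i'] Cons.prems(2) Suc by auto
    have bS: "b \<in> entries S" using entries_row_insert[OF S0(1,2)] S0(3) by simp
    have srt: "sorted_wrt (<) r" and disj: "set r \<inter> entries S = {}" and dom: "dom_row r S" using Cons.prems(1) by (auto simp: tableau_Cons)
    have br: "b \<notin> set r" using bS disj by auto
    obtain x where x: "x \<in> set r" "x < b" using entries_first_row_less[of r S b] Cons.prems(1) bS unfolding tableau_def by auto
    have "\<exists>u c v. r = u @ c # v \<and> c < b \<and> (\<forall>x\<in>set v. b < x)"
      using srt br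
    proof (cases rule: row_split)
      case 1
      obtain u c where "r = u @ [c]" using x by (cases r rule: rev_cases) auto
      thus ?thesis using 1 by (intro exI[of _ u] exI[of _ c] exI[of _ "[]"]) auto
    next
      case (2 u e v)
      hence "u \<noteq> []" using x by (auto dest: less_asym)
      then obtain u0 c where "u = u0 @ [c]" by (cases u rule: rev_cases) auto
      thus ?thesis using 2 by (intro exI[of _ u0] exI[of _ c] exI[of _ "e # v"]) (auto intro: less_trans)
    qed
    then obtain u c v where r: "r = u @ c # v" "c < b" "\<forall>x\<in>set v. b < x" by blast
    have uc: "\<forall>x\<in>set u. x < c" using srt r by (auto simp: sorted_wrt_append)
    have e: "entries S = insert b (entries S0)" using entries_row_insert[OF S0(1,2)] S0(3) by simp
    have "dom_row (u @ b # v) S0"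
      using dom_row_uninsert[OF _ r(2,3) S0(1,2)] dom srt r(1) S0(3) by auto
    moreover have "sorted_wrt (<) (u @ b # v)" using srt r uc by (auto simp: sorted_wrt_append intro: less_trans)
    ultimately have "tableau ((u @ b # v) # S0)" "c \<notin> entries ((u @ b # v) # S0)"
      using S0 disj e r uc srt by (auto simp: tableau_Cons sorted_wrt_append)
    moreover have "row_insert ((u @ b # v) # S0) c = r # S" "ins_row ((u @ b # v) # S0) c = i"
      using row_insert_bump[OF uc r(2,3), of S0] S0 r Suc by auto
    ultimately show ?thesis by blast
  qed
qed simp

section \<open>Insertion tableaux of words\<close>

definition row_word :: "'a list list \<Rightarrow> 'a list" where
  "row_word T = concat (rev T)"

lemma row_word_simps[simp]: "row_word [] = []" "row_word (r # T) = row_word T @ r"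
  unfolding row_word_def by simp_all

text \<open>\<open>a\<close> moves left past the entries of \<open>v\<close>. The left neighbour of
  the entry passed lies between \<open>a\<close> and that entry and serves as witness; for the first
  entry of \<open>v\<close> it is \<open>b\<close>.\<close>

lemma knuth_move_left:
  assumes "a < b" "\<forall>x\<in>set v. b < x" "sorted_wrt (<) v"
  shows "knuth (b # v @ [a]) (b # a # v)"
  using assms
proof (induct v rule: rev_induct)
  case Nil show ?case by (simp add: knuth_refl)
next
  case (snoc y v)
  have IH: "knuth (b # v @ [a]) (b # a # v)" by (rule snoc.hyps) (use snoc.prems in \<open>auto simp: sorted_wrt_append\<close>)
  obtain w z where w: "b # v = w @ [z]" by (cases "b # v" rule: rev_cases) auto
  have "z < y" using snoc.prems w by (cases v rule: rev_cases) (auto simp: sorted_wrt_append)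
  moreover have "a < z" using snoc.prems w by (cases v rule: rev_cases) (auto intro: less_trans)
  ultimately have "knuth (w @ [z, y, a] @ []) (w @ [z, a, y] @ [])"
    by (intro knuth_sym[OF knuth_yxz])
  moreover have "w @ z # l = b # v @ l" for l using w by (metis append_Cons append_assoc append_Nil)
  ultimately have "knuth (b # (v @ [y]) @ [a]) ((b # v @ [a]) @ [y])" by simp
  moreover have "knuth ((b # v @ [a]) @ [y]) ((b # a # v) @ [y])" using knuth_context[OF IH, of "[]" "[y]"] by simp
  ultimately show ?case using knuth_trans by fastforce
qed

text \<open>\<open>b\<close> moves left past \<open>u\<close>. The right neighbour of the entry
  passed lies between that entry and \<open>b\<close>; for the last entry of \<open>u\<close> it is
  \<open>a\<close>.\<close>

lemma knuth_move_right:
  assumes "a < b" "\<forall>x\<in>set u. x < a" "sorted_wrt (<) u"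
  shows "knuth (u @ [b, a]) (b # u @ [a])"
  using assms
proof (induct u)
  case Nil show ?case by (simp add: knuth_refl)
next
  case (Cons y u)
  have IH: "knuth (u @ [b, a]) (b # u @ [a])" by (rule Cons.hyps) (use Cons.prems in auto)
  obtain w z where w: "u @ [a] = z # w" by (cases "u @ [a]") auto
  have "y < z" using Cons.prems w by (cases u) auto
  moreover have "z < b" using Cons.prems w by (cases u) (auto intro: less_trans)
  ultimately have "knuth ([] @ [y, b, z] @ w) ([] @ [b, y, z] @ w)" by (rule knuth_xzy)
  hence "knuth (y # b # u @ [a]) (b # y # u @ [a])" using w by simp
  moreover have "knuth (y # u @ [b, a]) (y # b # u @ [a])" using knuth_context[OF IH, of "[y]" "[]"] by simp
  ultimately show ?case using knuth_trans by fastforce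
qed

text \<open>One row of the bumping is
  \<open>u b v a \<rightarrow> u b a v \<rightarrow> b u a v\<close>: the bumped letter arrives
  behind the word of the lower rows, into which it is inserted next.\<close>

lemma knuth_row_insert:
  assumes "tableau T" "a \<notin> entries T"
  shows "knuth (row_word T @ [a]) (row_word (row_insert T a))"
  using assms
proof (induct T arbitrary: a)
  case Nil show ?case by (simp add: knuth_refl)
next
  case (Cons r T)
  show ?case using Cons.prems
  proof (cases rule: row_insert_cases)
    case append
    thus ?thesis by (simp add: knuth_refl)
  next
    case (bump u b v)
    have srt: "sorted_wrt (<) u" "sorted_wrt (<) v" using Cons.prems(1) bump(1) by (auto simp: tableau_Cons sorted_wrt_append)
    have IH: "knuth (row_word T @ [b]) (row_word (row_insert T b))"
      by (rule Cons.hyps) (use Cons.prems bump in \<open>auto simp: tableau_Cons\<close>)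
    have "knuth (u @ b # v @ [a]) (u @ b # a # v)"
      using knuth_context[OF knuth_move_left[OF bump(3,4) srt(2)], of u "[]"] by simp
    moreover have "knuth (u @ b # a # v) (b # u @ a # v)"
      using knuth_context[OF knuth_move_right[OF bump(3,2) srt(1)], of "[]" v] by simp
    ultimately have "knuth (u @ b # v @ [a]) (b # u @ a # v)" using knuth_trans by blast
    from knuth_context[OF this, of "row_word T" "[]"]
    have "knuth (row_word T @ u @ b # v @ [a]) ((row_word T @ [b]) @ u @ a # v)" by simp
    moreover have "knuth ((row_word T @ [b]) @ u @ a # v) (row_word (row_insert T b) @ u @ a # v)"
      using knuth_context[OF IH, of "[]" "u @ a # v"] by simp
    ultimately show ?thesis using bump knuth_trans by fastforce
  qed
qed

definition ptab :: "'a::linorder list \<Rightarrow> 'a list list" where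
  "ptab w = foldl row_insert [] w"

lemma ptab_Nil[simp]: "ptab [] = []" unfolding ptab_def by simp

lemma ptab_snoc[simp]: "ptab (w @ [a]) = row_insert (ptab w) a" unfolding ptab_def by simp

lemma ptab_tableau:
  assumes "distinct w"
  shows "tableau (ptab w)" "entries (ptab w) = set w"
proof -
  have "tableau (ptab w) \<and> entries (ptab w) = set w" using assms
  proof (induct w rule: rev_induct)
    case (snoc a w)
    thus ?case using tableau_row_insert[of "ptab w" a] entries_row_insert[of "ptab w" a] by auto
  qed simp
  thus "tableau (ptab w)" "entries (ptab w) = set w" by auto
qed

lemma knuth_ptab: "distinct w \<Longrightarrow> knuth w (row_word (ptab w))"
proof (induct w rule: rev_induct)
  case (snoc a w)
  have "knuth (row_word (ptab w) @ [a]) (row_word (row_insert (ptab w) a))"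
    by (rule knuth_row_insert) (use snoc.prems ptab_tableau[of w] in auto)
  moreover have "knuth (w @ [a]) (row_word (ptab w) @ [a])" using knuth_context[of w "row_word (ptab w)" "[]" "[a]"] snoc by simp
  ultimately show ?case using knuth_trans by fastforce
qed (simp add: knuth_refl)

section \<open>Restriction of tableaux to small letters\<close>

definition restr :: "('a \<Rightarrow> bool) \<Rightarrow> 'a list list \<Rightarrow> 'a list list" where
  "restr P T = filter (\<lambda>r. r \<noteq> []) (map (filter P) T)"

lemma restr_simps[simp]: "restr P [] = []" "restr P (r # T) = (if filter P r = [] then [] else [filter P r]) @ restr P T"
  unfolding restr_def by simp_all

lemma restr_empty:
  assumes "rows_tableau (r # T)" "filter P r = []" "\<And>x y. x < y \<Longrightarrow> P y \<Longrightarrow> P x"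
  shows "restr P T = []"
proof -
  have "\<not> P b" if b: "b \<in> entries T" for b
    using entries_first_row_less[OF assms(1) b] assms(2,3) by (auto simp: filter_empty_conv)
  thus ?thesis unfolding restr_def entries_def by (auto simp: filter_empty_conv)
qed

text \<open>A bumped letter is larger than the one that bumps it, so letters outside the down-closed
  \<open>P\<close> never influence those inside.\<close>

lemma restr_row_insert:
  assumes "tableau T" "a \<notin> entries T" and P: "\<And>x y. x < y \<Longrightarrow> P y \<Longrightarrow> P x"
  shows "restr P (row_insert T a) = (if P a then row_insert (restr P T) a else restr P T)"
  using assms(1,2)
proof (induct T arbitrary: a)
  case (Cons r T)
  have re: "restr P T = []" if "filter P r = []"
    by (rule restr_empty[OF _ that P]) (use Cons.prems in \<open>auto simp: tableau_def\<close>)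
  show ?case using Cons.prems
  proof (cases rule: row_insert_cases)
    case append
    hence "P a \<Longrightarrow> filter P r = r" using P by (auto simp: filter_id_conv)
    moreover have "r \<noteq> []" using Cons.prems by (simp add: tableau_Cons)
    ultimately show ?thesis using append by auto
  next
    case (bump u b v)
    have IH: "restr P (row_insert T b) = (if P b then row_insert (restr P T) b else restr P T)"
      by (rule Cons.hyps) (use Cons.prems bump in \<open>auto simp: tableau_Cons\<close>)
    have nb: "filter P v = []" if "\<not> P b" using that P bump(4) by (auto simp: filter_empty_conv)
    show ?thesis
    proof (cases "P a")
      case True
      hence u: "filter P u = u" using bump(2) P by (auto simp: filter_id_conv)
      show ?thesis
      proof (cases "P b")
        case True
        have "row_insert ((u @ b # filter P v) # restr P T) a = (u @ a # filter P v) # row_insert (restr P T) b"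
          by (rule row_insert_bump) (use bump in auto)
        thus ?thesis using bump IH True u \<open>P a\<close> by simp
      next
        case False
        show ?thesis
        proof (cases u)
          \<comment> \<open>Nothing of the old row lies in \<open>P\<close>; by
            \<open>restr_empty\<close> the same holds below, and \<open>a\<close> starts a new
            tableau.\<close>
          case Nil
          thus ?thesis using bump IH False nb re u \<open>P a\<close> row_insert_bump(1)[of "[]" a b v T] by simp
        next
          case (Cons z zs)
          hence "u \<noteq> []" by simp
          thus ?thesis unfolding bump(1) row_insert_bump(1)[OF bump(2-4)]
            using IH False nb[OF False] u \<open>P a\<close> row_insert_append(1)[OF bump(2), of "restr P T"] by simp
        qed
      qed
    next
      case False
      hence "\<not> P b" using bump(3) P by blast
      thus ?thesis using False bump IH by simp
    qed
  qed
qed simp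

lemma restr_ptab:
  assumes "distinct w" "\<And>x y. x < y \<Longrightarrow> P y \<Longrightarrow> P x"
  shows "restr P (ptab w) = ptab (filter P w)"
  using assms(1)
proof (induct w rule: rev_induct)
  case (snoc a w)
  thus ?case using restr_row_insert[of "ptab w" a P] ptab_tableau[of w] assms(2) by auto
qed simp

section \<open>Shapes and transposes\<close>

lemma rows_tableau_iff:
  "rows_tableau T \<longleftrightarrow> (\<forall>r\<in>set T. r \<noteq> [] \<and> sorted_wrt (<) r) \<and>
     (\<forall>i. Suc i < length T \<longrightarrow> length (T ! Suc i) \<le> length (T ! i) \<and> (\<forall>j<length (T ! Suc i). T ! i ! j < T ! Suc i ! j))"
proof (induct T)
  case (Cons r T)
  show ?case
  proof (cases T)
    case Nil thus ?thesis by simp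
  next
    case (Cons t S)
    have "(\<forall>i. Suc i < length (r # T) \<longrightarrow> P ((r # T) ! i) ((r # T) ! Suc i)) \<longleftrightarrow>
      P r t \<and> (\<forall>i. Suc i < length T \<longrightarrow> P (T ! i) (T ! Suc i))" for P
      unfolding Cons by (auto simp: nth_Cons split: nat.splits)
    from this[of "\<lambda>a b. length b \<le> length a \<and> (\<forall>j<length b. a ! j < b ! j)"]
    show ?thesis using Cons.hyps Cons by auto
  qed
qed simp

lemma diagram_shape: "(i, j) \<in> diagram (shape T) \<longleftrightarrow> j < row_len T i"
  unfolding shape_def row_len_def by auto

lemma row_len_pos: "rows_tableau T \<Longrightarrow> 0 < row_len T i \<longleftrightarrow> i < length T"
  unfolding row_len_def rows_tableau_iff by auto

lemma row_len_lessD: "j < row_len T i \<Longrightarrow> i < length T \<and> j < length (T ! i)"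
  unfolding row_len_def by (auto split: if_splits)

lemma cell_row:
  assumes "rows_tableau T" "j < j'" "j' < row_len T i" shows "T ! i ! j < T ! i ! j'"
  using assms row_len_lessD[of j' T i] unfolding rows_tableau_iff by (auto simp: sorted_wrt_nth_less)

lemma cell_col:
  assumes "rows_tableau T" "i < i'" "j < row_len T i'" shows "T ! i ! j < T ! i' ! j"
  using assms(2,3)
proof (induct i' rule: nat_induct)
  case (Suc k)
  have kl: "Suc k < length T" "j < length (T ! Suc k)" using row_len_lessD[OF Suc.prems(2)] by auto
  have s: "T ! k ! j < T ! Suc k ! j" using assms(1) kl unfolding rows_tableau_iff by blast
  show ?case
  proof (cases "i = k")
    case True thus ?thesis using s by simp
  next
    case False
    moreover have "j < row_len T k" using Suc.prems(2) row_len_antimono[OF assms(1), of k "Suc k"] by simp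
    ultimately show ?thesis using Suc s by auto
  qed
qed simp

lemma entries_cells: "x \<in> entries T \<longleftrightarrow> (\<exists>i j. j < row_len T i \<and> x = T ! i ! j)"
proof
  assume "x \<in> entries T"
  then obtain r where r: "r \<in> set T" "x \<in> set r" unfolding entries_def by auto
  then obtain i j where "i < length T" "T ! i = r" "j < length r" "r ! j = x" by (metis in_set_conv_nth)
  thus "\<exists>i j. j < row_len T i \<and> x = T ! i ! j" unfolding row_len_def by (intro exI[of _ i] exI[of _ j]) auto
next
  assume "\<exists>i j. j < row_len T i \<and> x = T ! i ! j"
  then obtain i j where "i < length T" "j < length (T ! i)" "x = T ! i ! j" using row_len_lessD by blast
  thus "x \<in> entries T" unfolding entries_def by (auto intro!: bexI[of _ "T ! i"])
qed

lemma cells_inj: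
  assumes "distinct (concat T)" "j < row_len T i" "j' < row_len T i'" "T ! i ! j = T ! i' ! j'"
  shows "i = i' \<and> j = j'"
  using assms
proof (induct T arbitrary: i i')
  case (Cons r T)
  have d: "distinct r" "set r \<inter> entries T = {}" "distinct (concat T)" using Cons.prems(1) unfolding entries_def by auto
  have e: "T ! k ! l \<in> entries T" if "l < row_len T k" for k l
    unfolding entries_cells using that by blast
  show ?case
  proof (cases i; cases i')
    assume "i = 0" "i' = 0" thus ?thesis using Cons.prems d(1) by (auto simp: nth_eq_iff_index_eq)
  next
    fix k assume "i = 0" "i' = Suc k"
    hence "r ! j \<in> set r" "r ! j \<in> entries T" using Cons.prems(2-4) nth_mem[of j r] e[of j' k] by auto
    thus ?thesis using d(2) by blast
  next
    fix k assume "i = Suc k" "i' = 0"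
    hence "r ! j' \<in> set r" "r ! j' \<in> entries T" using Cons.prems(2-4) nth_mem[of j' r] e[of j k] by auto
    thus ?thesis using d(2) by blast
  next
    fix k l assume "i = Suc k" "i' = Suc l"
    thus ?thesis using Cons.hyps[of k l] Cons.prems d by auto
  qed
qed simp

text \<open>\<open>transpose\<close> forms column \<open>j\<close> from the rows longer than
  \<open>j\<close>; with decreasing lengths these are the first rows.\<close>

lemma length_filter_transpose:
  assumes "sorted_wrt (\<ge>) (map length T)"
  shows "i < length (filter (\<lambda>ys. j < length ys) T) \<longleftrightarrow> j < row_len T i"
  using assms
proof (induct T arbitrary: i)
  case (Cons r T)
  show ?case
  proof (cases "j < length r")
    case True thus ?thesis using Cons by (cases i) auto
  next
    case False
    hence "\<forall>t\<in>set T. \<not> j < length t" using Cons.prems by auto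
    moreover from this have "\<not> j < row_len (r # T) i" using False
      by (cases i) (auto simp: row_len_def)
    ultimately show ?thesis using False by simp
  qed
qed simp

lemma rows_tableau_lengths: "rows_tableau T \<Longrightarrow> sorted_wrt (\<ge>) (map length T)"
proof (induct T)
  case (Cons r T)
  have "length t \<le> length r" if t: "t \<in> set T" for t
  proof -
    obtain i where i: "i < length T" "T ! i = t" using t by (metis in_set_conv_nth)
    thus ?thesis using row_len_antimono[OF Cons.prems, of 0 "Suc i"] by (simp add: row_len_def)
  qed
  thus ?case using Cons by auto
qed simp

lemma length_transpose_row_len:
  assumes "sorted_wrt (\<ge>) (map length T)" shows "length (List.transpose T) = row_len T 0"
proof -
  have "sorted (rev (map length T))" using assms by (simp add: sorted_wrt_rev)
  thus ?thesis by (auto simp: length_transpose_sorted row_len_def)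
qed

lemma transpose_cells:
  assumes "sorted_wrt (\<ge>) (map length T)"
  shows "i < row_len (List.transpose T) j \<longleftrightarrow> j < row_len T i"
    "j < row_len T i \<Longrightarrow> List.transpose T ! j ! i = T ! i ! j"
proof -
  have s: "sorted (rev (map length T))" using assms by (simp add: sorted_wrt_rev)
  have mono: "row_len T i \<le> row_len T 0"
  proof (cases T)
    case (Cons r S) thus ?thesis using assms by (cases i) (auto simp: row_len_def)
  qed simp
  have len: "length (List.transpose T ! j) = length (filter (\<lambda>ys. j < length ys) T)" if "j < length (List.transpose T)"
    using nth_transpose[OF that] by simp
  show "i < row_len (List.transpose T) j \<longleftrightarrow> j < row_len T i"
    using len length_filter_transpose[OF assms, of i j] length_transpose_row_len[OF assms] mono
    by (auto simp: row_len_def[of "List.transpose T"])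
  assume j: "j < row_len T i"
  show "List.transpose T ! j ! i = T ! i ! j"
    by (rule nth_nth_transpose_sorted[OF s])
       (use j mono length_transpose_row_len[OF assms] length_filter_transpose[OF assms] in auto)
qed

lemma rows_tableau_transpose:
  assumes "rows_tableau T" shows "rows_tableau (List.transpose T)"
proof -
  note L = rows_tableau_lengths[OF assms]
  note C = transpose_cells[OF L] and len = length_transpose_row_len[OF L]
  let ?U = "List.transpose T"
  have rlU: "row_len ?U j = length (?U ! j)" if "j < length ?U" for j using that by (simp add: row_len_def)
  show ?thesis
    unfolding rows_tableau_iff
  proof (intro conjI ballI allI impI)
    fix c assume "c \<in> set ?U"
    then obtain j where j: "j < length ?U" "?U ! j = c" by (metis in_set_conv_nth)
    show "c \<noteq> []" using C(1)[of 0 j] rlU[OF j(1)] j len by auto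
    show "sorted_wrt (<) c"
      unfolding sorted_wrt_iff_nth_less
    proof (intro allI impI)
      fix i i' assume i: "i < i'" "i' < length c"
      have "j < row_len T i'" using C(1)[of i' j] rlU[OF j(1)] j i by simp
      moreover have "j < row_len T i" using C(1)[of i j] rlU[OF j(1)] j i by simp
      ultimately show "c ! i < c ! i'" using cell_col[OF assms i(1), of j] C(2) j by auto
    qed
  next
    fix j assume j: "Suc j < length ?U"
    have *: "j < row_len T i \<and> Suc j < row_len T i" if "i < length (?U ! Suc j)" for i
      using C(1)[of i "Suc j"] rlU[OF j] that by auto
    show "length (?U ! Suc j) \<le> length (?U ! j)"
    proof (rule ccontr)
      assume "\<not> ?thesis"
      hence "length (?U ! j) < length (?U ! Suc j)" by simp
      from *[OF this] C(1)[of "length (?U ! j)" j] rlU[of j] j show False by auto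
    qed
    fix i assume "i < length (?U ! Suc j)"
    from *[OF this] show "?U ! j ! i < ?U ! Suc j ! i" using C(2) cell_row[OF assms, of j "Suc j" i] by auto
  qed
qed

lemma transpose_transpose_rows_tableau: "rows_tableau T \<Longrightarrow> List.transpose (List.transpose T) = T"
  using List.transpose_transpose[of T] rows_tableau_lengths[of T] unfolding rows_tableau_iff
  by (auto simp: sorted_wrt_rev takeWhile_eq_all_conv)

lemma entries_transpose:
  assumes y: "rows_tableau T" shows "entries (List.transpose T) = entries T"
proof (intro Set.set_eqI iffI)
  note C = transpose_cells[OF rows_tableau_lengths[OF y]]
  fix x
  { assume "x \<in> entries (List.transpose T)"
    then obtain i j where "j < row_len (List.transpose T) i" "x = List.transpose T ! i ! j" unfolding entries_cells by blast
    hence "i < row_len T j" "x = T ! j ! i" using C by auto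
    thus "x \<in> entries T" unfolding entries_cells by blast }
  assume "x \<in> entries T"
  then obtain i j where "j < row_len T i" "x = T ! i ! j" unfolding entries_cells by blast
  hence "i < row_len (List.transpose T) j" "x = List.transpose T ! j ! i" using C by auto
  thus "x \<in> entries (List.transpose T)" unfolding entries_cells by blast
qed

lemma length_concat_card: "length (concat T) = card {(i, j). j < row_len T i}"
proof -
  have "{(i, j). j < row_len T i} = Sigma {..<length T} (\<lambda>i. {..<length (T ! i)})" by (auto simp: row_len_def split: if_splits)
  hence "card {(i, j). j < row_len T i} = (\<Sum>i<length T. length (T ! i))" by simp
  also have "\<dots> = length (concat T)" by (simp add: length_concat sum_list_sum_nth atLeast0LessThan)
  finally show ?thesis by simp
qed

text \<open>Distinctness by counting: the transpose has the same entries and the same number of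
  boxes.\<close>

lemma tableau_transpose:
  assumes "tableau T" shows "tableau (List.transpose T)"
proof -
  have y: "rows_tableau T" and d: "distinct (concat T)" using assms unfolding tableau_def by auto
  have "{(i, j). j < row_len (List.transpose T) i} = prod.swap ` {(i, j). j < row_len T i}"
    using transpose_cells(1)[OF rows_tableau_lengths[OF y]] by (auto simp: image_iff)
  hence "length (concat (List.transpose T)) = length (concat T)"
    unfolding length_concat_card by (simp add: card_image)
  also have "\<dots> = card (entries T)" unfolding entries_def by (rule distinct_card[OF d, symmetric])
  also have "\<dots> = card (set (concat (List.transpose T)))" using entries_transpose[OF y] unfolding entries_def by simp
  finally show ?thesis unfolding tableau_def using rows_tableau_transpose[OF y] by (metis card_distinct)
qed

lemma row_len_shape: "shape T \<in> partitions m \<longleftrightarrow> sorted_wrt (\<ge>) (map length T) \<and> (\<forall>r\<in>set T. r \<noteq> []) \<and> length (concat T) = m"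
  unfolding partitions_def shape_def by (auto simp: length_concat)

text \<open>Bridges the column condition on the transposed list and the comparison of adjacent
  rows.\<close>

lemma young_tableau_iff: "young_tableau T \<longleftrightarrow> tableau T"
proof
  assume y: "young_tableau T"
  have L: "sorted_wrt (\<ge>) (map length T)" and ne: "\<forall>r\<in>set T. r \<noteq> []" and d: "distinct (concat T)"
    and r: "\<forall>r\<in>set T. sorted_wrt (<) r" and c: "\<forall>c\<in>set (List.transpose T). sorted_wrt (<) c"
    using y unfolding young_tableau_def row_len_shape by auto
  have "rows_tableau T"
    unfolding rows_tableau_iff
  proof (intro conjI ballI allI impI)
    fix i assume i: "Suc i < length T"
    show le: "length (T ! Suc i) \<le> length (T ! i)" using sorted_wrt_nth_less[OF L, of i "Suc i"] i by simp
    fix j assume j: "j < length (T ! Suc i)"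
    have j1: "j < row_len T i" "j < row_len T (Suc i)" using i j le by (auto simp: row_len_def)
    have "Suc i < row_len (List.transpose T) j" using transpose_cells(1)[OF L] j1 by simp
    hence "j < length (List.transpose T)" "Suc i < length (List.transpose T ! j)" using row_len_lessD by auto
    hence "List.transpose T ! j ! i < List.transpose T ! j ! Suc i" using c by (simp add: sorted_wrt_nth_less)
    thus "T ! i ! j < T ! Suc i ! j" using transpose_cells(2)[OF L] j1 by simp
  qed (use ne r in auto)
  thus "tableau T" using d unfolding tableau_def by simp
next
  assume "tableau T"
  hence y: "rows_tableau T" and d: "distinct (concat T)" unfolding tableau_def by auto
  have "shape T \<in> partitions (sum_list (shape T))"
    using rows_tableau_lengths[OF y] y unfolding row_len_shape rows_tableau_iff by (auto simp: shape_def length_concat)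
  thus "young_tableau T" unfolding young_tableau_def using d y rows_tableau_transpose[OF y] unfolding rows_tableau_iff by blast
qed

lemma shape_partition: "tableau T \<Longrightarrow> shape T \<in> partitions (card (entries T))"
  unfolding row_len_shape tableau_def entries_def
  using rows_tableau_lengths[of T] distinct_card[of "concat T"] by (simp add: rows_tableau_iff[of T] del: set_concat)

lemma standard_tableau_iff: "standard_tableau n T \<longleftrightarrow> tableau T \<and> entries T = {1..n}"
  unfolding standard_tableau_def young_tableau_iff entries_def ..

section \<open>Partitions as row length functions\<close>

definition part :: "nat list \<Rightarrow> nat \<Rightarrow> nat" where
  "part p i = (if i < length p then p ! i else 0)"

lemma row_len_part: "row_len T = part (shape T)"
  unfolding row_len_def part_def shape_def by auto

lemma part_inj:
  assumes "0 \<notin> set p" "0 \<notin> set q" "part p = part q"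
  shows "p = q"
proof -
  have *: "part p i = 0 \<longleftrightarrow> length p \<le> i" if "0 \<notin> set p" for p i
    using that by (auto simp: part_def) (metis gr0I nth_mem)
  have "length p \<le> i \<longleftrightarrow> length q \<le> i" for i using *[OF assms(1), of i] *[OF assms(2), of i] assms(3) by simp
  hence l: "length p = length q" by (metis le_antisym le_refl)
  moreover have "p ! i = q ! i" if "i < length p" for i
    using fun_cong[OF assms(3), of i] that l by (simp add: part_def)
  ultimately show ?thesis by (rule nth_equalityI)
qed

lemma shape_eqI: "rows_tableau T \<Longrightarrow> rows_tableau U \<Longrightarrow> row_len T = row_len U \<Longrightarrow> shape T = shape U"
  by (rule part_inj) (auto simp: row_len_part shape_def rows_tableau_iff)

lemma part_diagram: "(i, j) \<in> diagram p \<longleftrightarrow> j < part p i"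
  unfolding part_def by auto

lemma diagram_subset: "diagram p \<subseteq> diagram q \<longleftrightarrow> (\<forall>i. part p i \<le> part q i)"
proof -
  have "diagram p \<subseteq> diagram q \<longleftrightarrow> (\<forall>i j. j < part p i \<longrightarrow> j < part q i)"
    unfolding part_diagram[symmetric] by (auto simp del: diagram_iff)
  also have "\<dots> \<longleftrightarrow> (\<forall>i. part p i \<le> part q i)" by (meson leD leI less_le_trans nat_less_le)
  finally show ?thesis .
qed

lemma column_strip_iff: "column_strip (diagram q - diagram p) \<longleftrightarrow> (\<forall>i. part q i \<le> Suc (part p i))"
proof -
  have "{j. (i, j) \<in> diagram q - diagram p} = {part p i..<part q i}" for i
    by (auto simp: part_diagram simp del: diagram_iff)
  thus ?thesis unfolding column_strip_def by (simp add: le_diff_conv)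
qed

lemma partitions_part_antimono: "p \<in> partitions r \<Longrightarrow> part p (Suc i) \<le> part p i"
  using sorted_wrt_nth_less[of "(\<ge>)" p i "Suc i"] unfolding partitions_def part_def by auto

section \<open>Generic Jordan type of a tableau word\<close>

text \<open>Stated on letters, because the boxes of a tableau are known by their letters and not by
  positions in the word.\<close>

definition before :: "'a list \<Rightarrow> 'a \<Rightarrow> 'a \<Rightarrow> bool" where
  "before w x y \<longleftrightarrow> (\<exists>p q. p < q \<and> q < length w \<and> w ! p = x \<and> w ! q = y)"

lemma before_append1: "before u x y \<Longrightarrow> before (u @ v) x y"
  unfolding before_def by (metis (no_types, lifting) length_append less_trans nth_append trans_less_add1)

lemma before_append2:
  assumes "before v x y" shows "before (u @ v) x y"
proof -
  obtain p q where "p < q" "q < length v" "v ! p = x" "v ! q = y" using assms unfolding before_def by auto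
  thus ?thesis unfolding before_def by (intro exI[of _ "length u + p"] exI[of _ "length u + q"]) auto
qed

lemma before_append12:
  assumes "x \<in> set u" "y \<in> set v" shows "before (u @ v) x y"
proof -
  obtain p q where "p < length u" "u ! p = x" "q < length v" "v ! q = y" using assms by (metis in_set_conv_nth)
  thus ?thesis unfolding before_def by (intro exI[of _ p] exI[of _ "length u + q"]) (auto simp: nth_append)
qed

lemma before_rev:
  assumes "before w x y" shows "before (rev w) y x"
proof -
  obtain p q where "p < q" "q < length w" "w ! p = x" "w ! q = y" using assms unfolding before_def by auto
  thus ?thesis unfolding before_def
    by (intro exI[of _ "length w - Suc q"] exI[of _ "length w - Suc p"]) (auto simp: rev_nth)
qed

lemma before_asym: "distinct w \<Longrightarrow> before w x y \<Longrightarrow> \<not> before w y x"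
  unfolding before_def by (metis less_asym less_trans nth_eq_iff_index_eq)

lemma before_row_word:
  shows "j < j' \<Longrightarrow> j' < row_len T i \<Longrightarrow> before (row_word T) (T ! i ! j) (T ! i ! j')"
    "i' < i \<Longrightarrow> j < row_len T i \<Longrightarrow> j' < row_len T i' \<Longrightarrow> before (row_word T) (T ! i ! j) (T ! i' ! j')"
proof -
  show "j < j' \<Longrightarrow> j' < row_len T i \<Longrightarrow> before (row_word T) (T ! i ! j) (T ! i ! j')"
  proof (induct T arbitrary: i)
    case (Cons r T)
    show ?case
    proof (cases i)
      case 0
      hence "before r (r ! j) (r ! j')" using Cons.prems unfolding before_def by auto
      thus ?thesis using 0 by (simp add: before_append2)
    next
      case (Suc k) thus ?thesis using Cons by (simp add: before_append1)
    qed
  qed simp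
  show "i' < i \<Longrightarrow> j < row_len T i \<Longrightarrow> j' < row_len T i' \<Longrightarrow> before (row_word T) (T ! i ! j) (T ! i' ! j')"
  proof (induct T arbitrary: i i')
    case (Cons r T)
    obtain k where k: "i = Suc k" using Cons.prems(1) by (cases i) auto
    show ?case
    proof (cases i')
      case 0
      have "T ! k ! j \<in> set (row_word T)" using Cons.prems k entries_cells[of "T ! k ! j" T]
        by (auto simp: row_word_def entries_def)
      thus ?thesis using 0 k Cons.prems by (auto intro: before_append12)
    next
      case (Suc l) thus ?thesis using Cons k by (simp add: before_append1)
    qed
  qed simp
qed

text \<open>This is \<open>generic_type_tableau\<close> with each box labelled by the position of
  its letter in \<open>w\<close>, so that both hypotheses speak of the order of letters
  only.\<close>

lemma word_type_tableau:
  assumes y: "tableau T" and w: "distinct w" "set w = entries T"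
    and nb: "\<And>i j. Suc j < row_len T i \<Longrightarrow> before w (T ! i ! j) (T ! i ! Suc j)"
    and gr: "\<And>i j i' j'. j < row_len T i \<Longrightarrow> j' < row_len T i' \<Longrightarrow> before w (T ! i ! j) (T ! i' ! j') \<Longrightarrow>
      T ! i ! j < T ! i' ! j' \<Longrightarrow> j < j'"
  shows "word_type w (shape T)"
proof -
  have yt: "rows_tableau T" and d: "distinct (concat T)" using y unfolding tableau_def by auto
  define pos where "pos = the_inv_into {..<length w} (\<lambda>p. w ! p)"
  have inj: "inj_on (\<lambda>p. w ! p) {..<length w}" using w(1) by (auto simp: inj_on_def nth_eq_iff_index_eq)
  have im: "(\<lambda>p. w ! p) ` {..<length w} = entries T" unfolding w(2)[symmetric] by (auto simp: set_conv_nth)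
  have pos: "pos x < length w" "w ! pos x = x" if "x \<in> entries T" for x
    using that the_inv_into_into[OF inj, of x "{..<length w}"] f_the_inv_into_f[OF inj, of x] im unfolding pos_def by auto
  have posw: "pos (w ! p) = p" if "p < length w" for p
    unfolding pos_def using the_inv_into_f_f[OF inj, of p] that by simp
  have cell: "T ! i ! j \<in> entries T" if "j < row_len T i" for i j
    unfolding entries_cells using that by blast
  define \<beta> where "\<beta> = (\<lambda>(i, j). pos (T ! i ! j))"
  have row_len: "i < length (shape T) \<and> j < shape T ! i \<longleftrightarrow> j < row_len T i" for i j unfolding diagram_shape[symmetric] by simp
  have L: "labelling (length w) (shape T) \<beta>"
    unfolding labelling_def bij_betw_def
  proof (intro conjI inj_onI equalityI subsetI)
    fix a b assume ab: "a \<in> diagram (shape T)" "b \<in> diagram (shape T)" "\<beta> a = \<beta> b"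
    obtain i j where a: "a = (i, j)" "j < row_len T i" using ab(1) diagram_shape by (cases a) blast
    obtain i' j' where b: "b = (i', j')" "j' < row_len T i'" using ab(2) diagram_shape by (cases b) blast
    have "pos (T ! i ! j) = pos (T ! i' ! j')" using ab(3) unfolding \<beta>_def a(1) b(1) by simp
    hence "T ! i ! j = T ! i' ! j'" using pos(2)[OF cell[OF a(2)]] pos(2)[OF cell[OF b(2)]] by metis
    thus "a = b" using cells_inj[OF d a(2) b(2)] a b by simp
  next
    fix p assume "p \<in> \<beta> ` diagram (shape T)"
    then obtain i j where "(i, j) \<in> diagram (shape T)" "p = \<beta> (i, j)" by (metis imageE surj_pair)
    hence "j < row_len T i" "p = pos (T ! i ! j)" unfolding diagram_shape \<beta>_def by auto
    thus "p \<in> {..<length w}" using pos cell by auto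
  next
    fix p assume p: "p \<in> {..<length w}"
    hence "w ! p \<in> entries T" using w(2) by (metis lessThan_iff nth_mem)
    then obtain i j where ij: "j < row_len T i" "w ! p = T ! i ! j" unfolding entries_cells by blast
    hence "p = \<beta> (i, j)" unfolding \<beta>_def using posw p by (metis case_prod_conv lessThan_iff)
    thus "p \<in> \<beta> ` diagram (shape T)" using ij diagram_shape by blast
  qed
  have bef: "(\<beta> (i, j), \<beta> (i', j')) \<in> word_rel w \<longleftrightarrow> before w (T ! i ! j) (T ! i' ! j') \<and> T ! i ! j < T ! i' ! j'"
    if "j < row_len T i" "j' < row_len T i'" for i j i' j'
  proof -
    have "before w (T ! i ! j) (T ! i' ! j') \<longleftrightarrow> \<beta> (i, j) < \<beta> (i', j')"
    proof
      assume "before w (T ! i ! j) (T ! i' ! j')"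
      then obtain p q where "p < q" "q < length w" "w ! p = T ! i ! j" "w ! q = T ! i' ! j'" unfolding before_def by auto
      thus "\<beta> (i, j) < \<beta> (i', j')" unfolding \<beta>_def using posw[of p] posw[of q] by auto
    next
      assume "\<beta> (i, j) < \<beta> (i', j')"
      thus "before w (T ! i ! j) (T ! i' ! j')" unfolding before_def \<beta>_def
        using pos[OF cell[OF that(1)]] pos[OF cell[OF that(2)]] by (metis case_prod_conv)
    qed
    thus ?thesis unfolding word_rel_def \<beta>_def using pos[OF cell[OF that(1)]] pos[OF cell[OF that(2)]] by auto
  qed
  have "card (entries T) = length w" using w by (metis distinct_card)
  hence P: "shape T \<in> partitions (length w)" using shape_partition[OF y] by simp
  show ?thesis
    unfolding word_type_def
  proof (rule generic_type_tableau[OF P L])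
    fix i j assume "i < length (shape T)" "Suc j < shape T ! i"
    hence "Suc j < row_len T i" using row_len by blast
    thus "(\<beta> (i, j), \<beta> (i, Suc j)) \<in> word_rel w" using bef[of j i "Suc j" i] nb cell_row[OF yt, of j "Suc j" i] by simp
  next
    fix i j i' j'
    assume "i < length (shape T)" "j < shape T ! i" "i' < length (shape T)" "j' < shape T ! i'"
      and r: "(\<beta> (i, j), \<beta> (i', j')) \<in> word_rel w"
    hence "j < row_len T i" "j' < row_len T i'" using row_len by blast+
    thus "j < j'" using gr bef r by blast
  qed
qed

lemma distinct_row_word: "tableau T \<Longrightarrow> distinct (row_word T)" "set (row_word T) = entries T"
proof -
  show s: "set (row_word T) = entries T" unfolding row_word_def entries_def by simp
  assume "tableau T"
  hence "length (concat T) = card (entries T)" unfolding tableau_def entries_def by (metis distinct_card)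
  moreover have "length (row_word T) = length (concat T)" by (induct T) auto
  ultimately have "length (row_word T) = card (entries T)" by simp
  thus "distinct (row_word T)" using s by (metis card_distinct)
qed

text \<open>The reading word visits the rows from the bottom up, so a later letter at
  \<open>(i', j')\<close> lies weakly above. Were it also weakly left, comparison through the box
  \<open>(i', j)\<close> would show that it is not larger.\<close>

lemma word_type_row_word:
  assumes y: "tableau T" shows "word_type (row_word T) (shape T)"
proof (rule word_type_tableau[OF y distinct_row_word(1)[OF y] distinct_row_word(2)])
  have yt: "rows_tableau T" using y unfolding tableau_def by auto
  fix i j i' j'
  assume c: "j < row_len T i" "j' < row_len T i'" and b: "before (row_word T) (T ! i ! j) (T ! i' ! j')" and lt: "T ! i ! j < T ! i' ! j'"
  have i: "i' \<le> i" using before_row_word(2)[of i i' j' T j] c b before_asym[OF distinct_row_word(1)[OF y]] by (meson not_le)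
  show "j < j'"
  proof (rule ccontr)
    assume "\<not> j < j'"
    hence j: "j' \<le> j" by simp
    have j': "j < row_len T i'" using c row_len_antimono[OF yt i] by simp
    have "T ! i' ! j' \<le> T ! i' ! j" using cell_row[OF yt, of j' j i'] j j' by (cases "j' = j") auto
    also have "\<dots> \<le> T ! i ! j" using cell_col[OF yt, of i' i j] i c(1) by (cases "i' = i") auto
    finally show False using lt by simp
  qed
qed (use before_row_word(1) in auto)

text \<open>Read backwards, the word visits the rows of \<open>U\<close>, which are the columns of
  the transpose, from the top down, each of them decreasing. So an increasing pair lies in different
  rows and goes down, and vertical neighbours in \<open>U\<close> become the horizontal neighbours
  of the transpose.\<close>

lemma word_type_column_word:
  assumes y: "tableau U" shows "word_type (rev (row_word U)) (shape (List.transpose U))"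
proof -
  let ?T = "List.transpose U"
  have yu: "rows_tableau U" using y unfolding tableau_def by auto
  note C = transpose_cells[OF rows_tableau_lengths[OF yu]]
  have yT: "tableau ?T" by (rule tableau_transpose[OF y])
  have c: "i < row_len U j \<and> ?T ! i ! j = U ! j ! i" if "j < row_len ?T i" for i j
    using C(1)[of j i] C(2)[of i j] that by simp
  have d: "distinct (row_word U)" by (rule distinct_row_word(1)[OF y])
  show ?thesis
  proof (rule word_type_tableau[OF yT])
    show "distinct (rev (row_word U))" using d by simp
    show "set (rev (row_word U)) = entries ?T" using distinct_row_word(2)[of U] entries_transpose[OF yu] by simp
    fix i j assume j: "Suc j < row_len ?T i"
    hence "before (row_word U) (U ! Suc j ! i) (U ! j ! i)" using c[of j i] c[OF j] by (intro before_row_word(2)) auto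
    thus "before (rev (row_word U)) (?T ! i ! j) (?T ! i ! Suc j)" using c[of j i] c[OF j] j before_rev by fastforce
  next
    fix i j i' j' assume j: "j < row_len ?T i" and j': "j' < row_len ?T i'"
      and b: "before (rev (row_word U)) (?T ! i ! j) (?T ! i' ! j')" and lt: "?T ! i ! j < ?T ! i' ! j'"
    have b': "before (row_word U) (U ! j' ! i') (U ! j ! i)" using before_rev[OF b] c[OF j] c[OF j'] by simp
    have nb: "\<not> before (row_word U) (U ! j ! i) (U ! j' ! i')" using before_asym[OF d b'] .
    hence "\<not> j' < j" using before_row_word(2)[of j' j i U i'] c[OF j] c[OF j'] by blast
    moreover have "j \<noteq> j'"
    proof
      assume e: "j = j'"
      have "\<not> i < i'" using nb before_row_word(1)[of i i' U j] c[OF j'] e by auto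
      hence "U ! j ! i' \<le> U ! j ! i" using cell_row[OF yu, of i' i j] c[OF j] by (cases "i = i'") auto
      thus False using lt c[OF j] c[OF j'] e by simp
    qed
    ultimately show "j < j'" by simp
  qed
qed

lemma word_type_ptab: "distinct w \<Longrightarrow> word_type w (shape (ptab w))"
  using word_type_knuth[OF knuth_ptab] word_type_row_word[OF ptab_tableau(1)] by blast

lemma word_type_ptab_transpose: "distinct w \<Longrightarrow> word_type (rev w) (shape (List.transpose (ptab w)))"
  using word_type_knuth[OF knuth_rev[OF knuth_ptab]] word_type_column_word[OF ptab_tableau(1)] by blast

section \<open>Recording tableaux\<close>

lemma row_len_append_to_row: "k \<le> length Q \<Longrightarrow> row_len (append_to_row b k Q) = (row_len Q)(k := Suc (row_len Q k))"
  unfolding append_to_row_def row_len_def by (auto simp: fun_eq_iff nth_append)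

lemma entries_append_to_row: "entries (append_to_row b k Q) = insert b (entries Q)"
proof (cases "k < length Q")
  case True
  have "set (Q[k := Q ! k @ [b]]) = insert (Q ! k @ [b]) (set (take k Q) \<union> set (drop (Suc k) Q))"
    using True by (simp add: upd_conv_take_nth_drop)
  moreover have "set Q = insert (Q ! k) (set (take k Q) \<union> set (drop (Suc k) Q))"
    using arg_cong[OF id_take_nth_drop[OF True], of set] by auto
  ultimately show ?thesis using True unfolding append_to_row_def entries_def by auto
qed (auto simp: append_to_row_def entries_def)

lemma append_to_row_cells:
  assumes "k \<le> length Q"
  shows "j < row_len Q i \<Longrightarrow> append_to_row b k Q ! i ! j = Q ! i ! j" "append_to_row b k Q ! k ! row_len Q k = b"
proof -
  assume "j < row_len Q i"
  hence "i < length Q" "j < length (Q ! i)" using row_len_lessD by auto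
  thus "append_to_row b k Q ! i ! j = Q ! i ! j"
    unfolding append_to_row_def by (cases "i = k") (auto simp: nth_append)
next
  show "append_to_row b k Q ! k ! row_len Q k = b"
    using assms unfolding append_to_row_def row_len_def by (auto simp: nth_append)
qed

lemma append_to_row_simps[simp]:
  "append_to_row b 0 [] = [[b]]" "append_to_row b 0 (r # S) = (r @ [b]) # S"
  "append_to_row b (Suc k) (r # S) = r # append_to_row b k S"
  unfolding append_to_row_def by auto

lemma tableau_append_to_row:
  assumes "tableau Q" "\<forall>x\<in>entries Q. x < b" "k \<le> length Q" "\<forall>i<k. row_len Q k < row_len Q i"
  shows "tableau (append_to_row b k Q)"
  using assms
proof (induct Q arbitrary: k)
  case Nil thus ?case by (simp add: tableau_Cons)
next
  case (Cons r S)
  show ?case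
  proof (cases k)
    case 0
    have "dom_row (r @ [b]) S" using Cons.prems(1) by (cases S) (auto simp: tableau_Cons nth_append)
    thus ?thesis using Cons.prems 0 by (auto simp: tableau_Cons sorted_wrt_append)
  next
    case (Suc l)
    have *: "row_len S l < row_len (r # S) i" if "i < k" for i using Cons.prems(4) Suc that by auto
    have "tableau (append_to_row b l S)"
      by (rule Cons.hyps) (use Cons.prems Suc *[of "Suc _"] in \<open>auto simp: tableau_Cons\<close>)
    moreover have "dom_row r (append_to_row b l S)"
    proof (cases S)
      case Nil
      have "r \<noteq> []" using Cons.prems(1) by (simp add: tableau_Cons)
      thus ?thesis using Nil Cons.prems Suc by (cases r) auto
    next
      case (Cons s S')
      show ?thesis
      proof (cases l)
        case 0
        hence "length s < length r" using *[of 0] Suc Cons by simp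
        moreover have "r ! length s < b" using calculation \<open>\<forall>x\<in>entries (r # S). x < b\<close> by auto
        ultimately show ?thesis using \<open>tableau (r # S)\<close> Cons 0 by (auto simp: tableau_Cons nth_append less_Suc_eq)
      next
        case (Suc l') thus ?thesis using \<open>tableau (r # S)\<close> Cons by (auto simp: tableau_Cons)
      qed
    qed
    ultimately show ?thesis using Cons.prems Suc by (auto simp: tableau_Cons entries_append_to_row)
  qed
qed

lemma restr_id:
  assumes "tableau S" "\<forall>x\<in>entries S. P x" shows "restr P S = S"
  using assms by (induct S) (auto simp: tableau_Cons filter_id_conv)

lemma restr_append_to_row:
  assumes "tableau Q" "\<forall>x\<in>entries Q. P x" "k \<le> length Q" "\<not> P b"
  shows "restr P (append_to_row b k Q) = Q"
  using assms
proof (induct Q arbitrary: k)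
  case (Cons r S)
  have "restr P S = S" by (rule restr_id) (use Cons.prems in \<open>auto simp: tableau_Cons\<close>)
  thus ?case using Cons by (cases k) (auto simp: tableau_Cons filter_id_conv)
qed simp

text \<open>The largest entry is at the end of its row with nothing below it, so deleting it leaves
  a tableau.\<close>

lemma max_corner:
  assumes "tableau U" "b \<in> entries U" "\<forall>x\<in>entries U. x \<le> b"
  shows "\<exists>k. U = append_to_row b k (restr (\<lambda>x. x < b) U) \<and> k \<le> length (restr (\<lambda>x. x < b) U) \<and>
    tableau (restr (\<lambda>x. x < b) U) \<and> entries (restr (\<lambda>x. x < b) U) = entries U - {b}"
  using assms
proof (induct U)
  case (Cons r S)
  let ?R = "restr (\<lambda>x. x < b)"
  have yS: "tableau S" and r: "sorted_wrt (<) r" "r \<noteq> []" "dom_row r S" "set r \<inter> entries S = {}" using Cons.prems(1) by (auto simp: tableau_Cons)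
  show ?case
  proof (cases "b \<in> set r")
    case True
    have lt: "x < b" if "x \<in> entries S" for x using True r(4) Cons.prems(3) that by (metis UnCI disjoint_iff entries_simps(2) order_le_less)
    have RS: "?R S = S" by (rule restr_id[OF yS]) (use lt in auto)
    obtain r0 c where rc: "r = r0 @ [c]" using r(2) by (cases r rule: rev_cases) auto
    have "c = b"
    proof (rule ccontr)
      assume "c \<noteq> b"
      hence "b < c" using True r(1) rc by (auto simp: sorted_wrt_append)
      thus False using Cons.prems(3) rc by auto
    qed
    hence rb: "r = r0 @ [b]" using rc by simp
    have r0: "\<forall>x\<in>set r0. x < b" using r(1) rb by (auto simp: sorted_wrt_append)
    have f: "filter (\<lambda>x. x < b) r = r0" using r0 rb by (simp add: filter_id_conv)
    show ?thesis
    proof (cases "r0 = []")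
      case True
      have "S = []"
      proof (cases S)
        case (Cons s S')
        hence "s \<noteq> []" "r ! 0 < s ! 0" using yS r(3) by (auto simp: tableau_Cons)
        moreover have "s ! 0 \<in> entries S" using Cons calculation(1) by simp
        ultimately show ?thesis using lt[of "s ! 0"] rb True by auto
      qed
      thus ?thesis using True rb by (intro exI[of _ 0]) auto
    next
      case False
      have "dom_row r0 S"
      proof (cases S)
        case (Cons s S')
        have "length s \<noteq> length r"
        proof
          assume l: "length s = length r"
          hence "length r0 < length s" using rb by simp
          hence "r ! length r0 < s ! length r0" using r(3) Cons by auto
          moreover have "s ! length r0 \<in> entries S" using Cons \<open>length r0 < length s\<close> by simp
          ultimately show False using lt rb by (metis less_asym nth_append_length)
        qed
        thus ?thesis using r(3) Cons rb by (auto simp: nth_append)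
      qed simp
      moreover have "sorted_wrt (<) r0" using r(1) rb by (simp add: sorted_wrt_append)
      moreover have "?R (r # S) = r0 # S" using f False RS by simp
      moreover have "b \<notin> entries S" using lt by auto
      ultimately show ?thesis using False yS r(4) rb r0
        by (intro exI[of _ 0]) (auto simp: tableau_Cons)
    qed
  next
    case False
    hence bS: "b \<in> entries S" using Cons.prems by auto
    obtain k where k: "S = append_to_row b k (?R S)" "k \<le> length (?R S)" "tableau (?R S)" "entries (?R S) = entries S - {b}"
      using Cons.hyps[OF yS bS] Cons.prems(3) by auto
    have row_len: "\<forall>x\<in>set r. x < b" using False Cons.prems(3) by (metis UnCI entries_simps(2) order_le_less)
    hence f: "?R (r # S) = r # ?R S" using r(2) by (simp add: filter_id_conv)
    have "dom_row r (?R S)"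
    proof (cases "?R S")
      case (Cons s S')
      have "S = (if k = 0 then (s @ [b]) # S' else s # append_to_row b (k - 1) S')"
        using k(1) unfolding Cons by (cases k) auto
      thus ?thesis using r(3) unfolding Cons by (auto split: if_splits simp: nth_append)
    qed simp
    hence "tableau (r # ?R S)" using k(3,4) r by (auto simp: tableau_Cons)
    thus ?thesis unfolding f using k(1,2,4) False by (intro exI[of _ "Suc k"]) auto
  qed
qed simp

text \<open>The new box is a corner: the rows above are strictly longer, so its column held exactly
  \<open>k\<close> boxes, and the box becomes the end of that row of the transpose.\<close>

lemma transpose_append_to_row:
  assumes "tableau U0" "k \<le> length U0" and U: "tableau (append_to_row b k U0)"
  shows "List.transpose (append_to_row b k U0) = append_to_row b (row_len U0 k) (List.transpose U0)"
    (is "List.transpose ?U = append_to_row b ?c ?V")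
proof -
  have y0: "rows_tableau U0" and y: "rows_tableau ?U" and d: "distinct (concat ?U)" using assms unfolding tableau_def by auto
  note C0 = transpose_cells[OF rows_tableau_lengths[OF y0]] and C = transpose_cells[OF rows_tableau_lengths[OF y]]
  note rlU = row_len_append_to_row[OF assms(2), of b]
  have corner: "row_len U0 k < row_len U0 i" if "i < k" for i
    using row_len_antimono[OF y, of i k] that unfolding rlU by auto
  have Vk: "row_len ?V ?c = k"
  proof -
    have "i < row_len ?V ?c \<longleftrightarrow> i < k" for i
      using C0(1)[of i ?c] corner[of i] row_len_antimono[OF y0, of k i] by (cases "i < k") auto
    thus ?thesis by (metis less_irrefl nat_neq_iff)
  qed
  have cV: "?c \<le> length ?V"
    using length_transpose_row_len[OF rows_tableau_lengths[OF y0]] row_len_antimono[OF y0, of 0 k] by simp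
  note rlR = row_len_append_to_row[OF cV, of b]
  have yV: "tableau ?V" by (rule tableau_transpose[OF assms(1)])
  have eq: "row_len (List.transpose ?U) = row_len (append_to_row b ?c ?V)"
  proof
    fix j
    have "i < row_len (List.transpose ?U) j \<longleftrightarrow> i < row_len (append_to_row b ?c ?V) j" for i
      unfolding C(1) rlU rlR using C0(1)[of i j] Vk C0(1)[of k j] by (auto simp: less_Suc_eq)
    thus "row_len (List.transpose ?U) j = row_len (append_to_row b ?c ?V) j" by (metis less_irrefl nat_neq_iff)
  qed
  have cell: "List.transpose ?U ! j ! i = append_to_row b ?c ?V ! j ! i" if "i < row_len (List.transpose ?U) j" for i j
  proof -
    have ji: "j < row_len ?U i" using that C(1) by simp
    have l: "List.transpose ?U ! j ! i = ?U ! i ! j" by (rule C(2)[OF ji])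
    show ?thesis
    proof (cases "j < row_len U0 i")
      case True
      thus ?thesis unfolding l using append_to_row_cells(1)[OF assms(2) True] append_to_row_cells(1)[OF cV, of i j] C0[of i j] C0(1)[of i j] C0(2)[of j i] by simp
    next
      case False
      hence "i = k" "j = ?c" using ji unfolding rlU by (auto split: if_splits)
      thus ?thesis unfolding l using append_to_row_cells(2)[OF assms(2), of b] append_to_row_cells(2)[OF cV, of b] Vk by simp
    qed
  qed
  have yU: "rows_tableau (List.transpose ?U)" by (rule rows_tableau_transpose[OF y])
  have ne: "\<forall>r\<in>set (append_to_row b ?c ?V). r \<noteq> []"
    using yV set_update_subset_insert[of ?V] unfolding append_to_row_def tableau_def rows_tableau_iff by auto
  have len: "length (List.transpose ?U) = length (append_to_row b ?c ?V)"
  proof -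
    have "i < length (List.transpose ?U) \<longleftrightarrow> i < length (append_to_row b ?c ?V)" for i
      using fun_cong[OF eq, of i] row_len_pos[OF yU, of i] ne unfolding row_len_def[of "append_to_row b ?c ?V"]
      by (metis length_greater_0_conv nat_neq_iff not_less_zero nth_mem)
    thus ?thesis by (metis less_irrefl nat_neq_iff)
  qed
  show ?thesis
  proof (rule nth_equalityI[OF len])
    fix j assume j: "j < length (List.transpose ?U)"
    have ll: "length (List.transpose ?U ! j) = length (append_to_row b ?c ?V ! j)"
      using fun_cong[OF eq, of j] j len by (simp add: row_len_def)
    show "List.transpose ?U ! j = append_to_row b ?c ?V ! j"
      by (rule nth_equalityI[OF ll]) (use cell j in \<open>auto simp: row_len_def\<close>)
  qed
qed

section \<open>The Robinson-Schensted correspondence on lists\<close>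

text \<open>\<open>RS\<close> on an explicit list, so that inductions can strip the last element,
  which is the largest one recorded.\<close>

definition RS_word :: "('b \<Rightarrow> 'a::linorder) \<Rightarrow> 'b list \<Rightarrow> 'a list list \<times> 'b list list" where
  "RS_word w bs = foldl (RS_step w) ([], []) bs"

text \<open>The description by \<open>THE\<close> is meaningful because insertion adds exactly one
  box, in row \<open>ins_row\<close>.\<close>

lemma RS_step_eq:
  assumes "tableau P" "w b \<notin> entries P"
  shows "RS_step w (P, Q) b = (row_insert P (w b), append_to_row b (ins_row P (w b)) Q)"
proof -
  let ?k = "ins_row P (w b)"
  have "diagram (shape (row_insert P (w b))) - diagram (shape P) = {(?k, row_len P ?k)}"
    by (auto simp: diagram_shape row_len_row_insert(1)[OF assms] simp del: diagram_iff split: if_splits)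
  hence box: "(THE c. c \<in> diagram (shape (row_insert P (w b))) - diagram (shape P)) = (?k, row_len P ?k)" by simp
  show ?thesis unfolding RS_step_def Let_def fst_conv snd_conv box ..
qed

lemma RS_word_snoc: "RS_word w (bs @ [b]) = RS_step w (RS_word w bs) b"
  unfolding RS_word_def by simp

lemma RS_word_invariant_step:
  fixes w :: "'b::linorder \<Rightarrow> 'a::linorder"
  assumes s: "sorted_wrt (<) (bs @ [b])" "inj_on w (set (bs @ [b]))"
    and I: "fst (RS_word w bs) = ptab (map w bs)" "tableau (snd (RS_word w bs))" "entries (snd (RS_word w bs)) = set bs"
      "row_len (snd (RS_word w bs)) = row_len (ptab (map w bs))"
  defines "P \<equiv> ptab (map w bs)" and "Q \<equiv> snd (RS_word w bs)" and "k \<equiv> ins_row (ptab (map w bs)) (w b)"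
  shows "RS_word w (bs @ [b]) = (row_insert P (w b), append_to_row b k Q)" "tableau P" "w b \<notin> entries P" "k \<le> length Q"
proof -
  have "distinct (map w (bs @ [b]))" using s by (auto simp: distinct_map strict_sorted_iff)
  thus P: "tableau P" "w b \<notin> entries P" using ptab_tableau[of "map w bs"] unfolding P_def by auto
  show "RS_word w (bs @ [b]) = (row_insert P (w b), append_to_row b k Q)"
    unfolding RS_word_snoc using RS_step_eq[where w = w and b = b, OF P, of Q] I(1) unfolding Q_def k_def P_def by (metis prod.collapse)
  show "k \<le> length Q"
  proof (rule ccontr)
    assume "\<not> ?thesis"
    hence "length Q < length P" using row_len_row_insert(2)[OF P] unfolding k_def P_def by simp
    thus False using row_len_pos[of P "length Q"] row_len_pos[of Q "length Q"] I P unfolding tableau_def P_def Q_def by simp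
  qed
qed

lemma RS_word_invariant:
  fixes w :: "'b::linorder \<Rightarrow> 'a::linorder"
  assumes "sorted_wrt (<) bs" "inj_on w (set bs)"
  shows "fst (RS_word w bs) = ptab (map w bs) \<and> tableau (snd (RS_word w bs)) \<and> entries (snd (RS_word w bs)) = set bs \<and>
    row_len (snd (RS_word w bs)) = row_len (ptab (map w bs))"
  using assms
proof (induct bs rule: rev_induct)
  case Nil show ?case by (simp add: RS_word_def)
next
  case (snoc b bs)
  let ?P = "ptab (map w bs)" and ?Q = "snd (RS_word w bs)"
  let ?k = "ins_row ?P (w b)"
  have IH: "fst (RS_word w bs) = ?P" "tableau ?Q" "entries ?Q = set bs" "row_len ?Q = row_len ?P"
    using snoc.hyps snoc.prems by (auto simp: sorted_wrt_append intro: inj_on_subset)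
  note step = RS_word_invariant_step[OF snoc.prems IH]
  note P = step(2,3)
  have yP: "rows_tableau (row_insert ?P (w b))" using tableau_row_insert[OF P] unfolding tableau_def by auto
  have corner: "\<forall>i<?k. row_len ?Q ?k < row_len ?Q i"
  proof (intro allI impI)
    fix i assume "i < ?k"
    thus "row_len ?Q ?k < row_len ?Q i"
      using row_len_antimono[OF yP, of i ?k] unfolding row_len_row_insert(1)[OF P] IH(4) by auto
  qed
  have "tableau (append_to_row b ?k ?Q)"
    by (rule tableau_append_to_row[OF IH(2) _ step(4) corner]) (use IH(3) snoc.prems in \<open>auto simp: sorted_wrt_append\<close>)
  moreover have "row_len (append_to_row b ?k ?Q) = row_len (ptab (map w (bs @ [b])))"
    unfolding row_len_append_to_row[OF step(4)] IH(4) using row_len_row_insert(1)[OF P] by simp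
  ultimately show ?case unfolding step(1) using IH(3) by (simp add: entries_append_to_row)
qed

lemma RS_word_step:
  fixes w :: "'b::linorder \<Rightarrow> 'a::linorder"
  assumes "sorted_wrt (<) (bs @ [b])" "inj_on w (set (bs @ [b]))"
  defines "P \<equiv> ptab (map w bs)" and "Q \<equiv> snd (RS_word w bs)" and "k \<equiv> ins_row (ptab (map w bs)) (w b)"
  shows "RS_word w (bs @ [b]) = (row_insert P (w b), append_to_row b k Q)" "fst (RS_word w bs) = P" "tableau P" "w b \<notin> entries P"
    "tableau Q" "entries Q = set bs" "row_len Q = row_len P" "k \<le> length Q"
proof -
  have I: "fst (RS_word w bs) = P" "tableau Q" "entries Q = set bs" "row_len Q = row_len P"
    using RS_word_invariant[of bs w] assms by (auto simp: sorted_wrt_append intro: inj_on_subset)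
  note step = RS_word_invariant_step[OF assms(1,2) I[unfolded P_def Q_def], folded P_def Q_def k_def]
  show "RS_word w (bs @ [b]) = (row_insert P (w b), append_to_row b k Q)" "fst (RS_word w bs) = P" "tableau P" "w b \<notin> entries P"
    "tableau Q" "entries Q = set bs" "row_len Q = row_len P" "k \<le> length Q" using I step by auto
qed

text \<open>The largest entry of the recording tableau marks the last new box; undoing the insertion
  there recovers the last letter and the previous pair.\<close>

lemma RS_word_inj:
  fixes w :: "'b::linorder \<Rightarrow> 'a::linorder"
  assumes "sorted_wrt (<) bs" "inj_on w (set bs)" "inj_on w' (set bs)" "RS_word w bs = RS_word w' bs"
  shows "\<forall>b\<in>set bs. w b = w' b"
  using assms
proof (induct bs rule: rev_induct)
  case (snoc b bs)
  note s = RS_word_step[OF snoc.prems(1,2)] and s' = RS_word_step[OF snoc.prems(1,3)]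
  let ?Q = "snd (RS_word w bs)" and ?Q' = "snd (RS_word w' bs)" and ?P = "ptab (map w bs)" and ?P' = "ptab (map w' bs)"
  let ?k = "ins_row ?P (w b)" and ?k' = "ins_row ?P' (w' b)"
  have lt: "\<forall>x\<in>set bs. x < b" using snoc.prems(1) by (auto simp: sorted_wrt_append)
  have app: "append_to_row b ?k ?Q = append_to_row b ?k' ?Q'" and ri: "row_insert ?P (w b) = row_insert ?P' (w' b)"
    using snoc.prems(4) s(1) s'(1) by auto
  have "restr (\<lambda>x. x < b) (append_to_row b ?k ?Q) = ?Q"
    by (rule restr_append_to_row[OF s(5) _ s(8)]) (use s(6) lt in auto)
  moreover have "restr (\<lambda>x. x < b) (append_to_row b ?k' ?Q') = ?Q'"
    by (rule restr_append_to_row[OF s'(5) _ s'(8)]) (use s'(6) lt in auto)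
  ultimately have Q: "?Q = ?Q'" using app by simp
  \<comment> \<open>With the earlier recording tableaux equal, the row lengths show where
    \<open>b\<close> was added.\<close>
  have "?k = ?k'"
  proof (rule ccontr)
    assume ne: "?k \<noteq> ?k'"
    have "row_len (append_to_row b ?k ?Q) ?k = row_len (append_to_row b ?k' ?Q') ?k" using app by simp
    thus False using ne Q fun_cong[OF row_len_append_to_row[OF s(8), of b], of ?k]
        fun_cong[OF row_len_append_to_row[OF s'(8), of b], of ?k] by simp
  qed
  hence PP: "?P = ?P' \<and> w b = w' b" using row_insert_inj[OF s(3,4) s'(3,4) ri] by simp
  hence "RS_word w bs = RS_word w' bs" using Q s(2) s'(2) by (metis prod.collapse)
  hence "\<forall>b\<in>set bs. w b = w' b" using snoc by (auto simp: sorted_wrt_append)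
  thus ?case using PP by simp
qed simp

lemma RS_word_cong: "(\<And>b. b \<in> set bs \<Longrightarrow> w b = w' b) \<Longrightarrow> RS_word w bs = RS_word w' bs"
  unfolding RS_word_def by (rule foldl_cong) (auto simp: RS_step_def)

text \<open>The largest entry of \<open>Q\<close> sits in a corner, and reverse insertion into
  \<open>P\<close> from the same corner yields the last letter of the word.\<close>

lemma RS_word_surj:
  fixes P :: "'a::linorder list list" and Q :: "'b::linorder list list"
  assumes "sorted_wrt (<) bs" "tableau P" "tableau Q" "row_len P = row_len Q" "entries Q = set bs"
  shows "\<exists>w. inj_on w (set bs) \<and> RS_word w bs = (P, Q)"
  using assms
proof (induct bs arbitrary: P Q rule: rev_induct)
  case Nil
  have "Q = []" using Nil.prems(3,5) by (cases Q) (auto simp: tableau_Cons)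
  moreover from this have "P = []" using Nil.prems(2) fun_cong[OF Nil.prems(4), of 0] row_len_pos[of P 0] unfolding tableau_def by simp
  ultimately show ?case by (simp add: RS_word_def)
next
  case (snoc b bs)
  have lt: "\<forall>x\<in>set bs. x < b" using snoc.prems(1) by (auto simp: sorted_wrt_append)
  let ?Q0 = "restr (\<lambda>x. x < b) Q"
  obtain k where k: "Q = append_to_row b k ?Q0" "k \<le> length ?Q0" "tableau ?Q0" "entries ?Q0 = entries Q - {b}"
    using max_corner[OF snoc.prems(3), of b] snoc.prems(5) lt by force
  have rlQ: "row_len Q = (row_len ?Q0)(k := Suc (row_len ?Q0 k))" using row_len_append_to_row[OF k(2), of b] k(1) by simp
  have "row_len P (Suc k) < row_len P k" unfolding snoc.prems(4) rlQ
    using row_len_antimono[of ?Q0 k "Suc k"] k(3) unfolding tableau_def by simp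
  from row_insert_surj[OF snoc.prems(2) this] obtain P0 a where
    P0: "tableau P0" "a \<notin> entries P0" "row_insert P0 a = P" "ins_row P0 a = k" by blast
  have e0: "entries ?Q0 = set bs" using k(4) snoc.prems(5) lt by auto
  have "row_len P0 = row_len ?Q0"
  proof
    fix i show "row_len P0 i = row_len ?Q0 i"
      using fun_cong[OF snoc.prems(4), of i] row_len_row_insert(1)[OF P0(1,2)] unfolding P0(3,4) rlQ by (auto split: if_splits)
  qed
  then obtain w0 where w0: "inj_on w0 (set bs)" "RS_word w0 bs = (P0, ?Q0)"
    using snoc.hyps[of P0 ?Q0] snoc.prems(1) P0 k(3) e0 by (auto simp: sorted_wrt_append)
  define w where "w = w0(b := a)"
  have bn: "b \<notin> set bs" using lt by auto
  have "RS_word w bs = RS_word w0 bs" by (rule RS_word_cong) (use bn in \<open>auto simp: w_def\<close>)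
  hence rsw: "RS_word w bs = (P0, ?Q0)" using w0(2) by simp
  have sb: "sorted_wrt (<) bs" using snoc.prems(1) by (simp add: sorted_wrt_append)
  have db: "distinct (map w0 bs)" using w0(1) sb by (simp add: distinct_map strict_sorted_iff)
  have "P0 = ptab (map w0 bs)" using RS_word_invariant[OF sb w0(1)] w0(2) by simp
  hence "entries P0 = w0 ` set bs" using ptab_tableau(2)[OF db] by simp
  hence inj: "inj_on w (set (bs @ [b]))" using w0(1) P0(2) bn unfolding w_def by (auto simp: inj_on_def)
  have "RS_word w (bs @ [b]) = (P, Q)"
    unfolding RS_word_snoc rsw using RS_step_eq[of P0 w b ?Q0] P0 k(1) unfolding w_def by simp
  thus ?case using inj by blast
qed

text \<open>\<open>vs\<close> lists the letters by their values, which is the inverse word. Being a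
  non-inversion is symmetric in position and value, so a permutation of the indices matches the two
  relations.\<close>

lemma word_type_inverse:
  fixes w :: "'a::linorder \<Rightarrow> 'b::linorder"
  assumes bs: "sorted_wrt (<) bs" and vs: "mset vs = mset bs" "sorted_wrt (\<lambda>x y. w x < w y) vs" and g: "word_type (map w bs) p"
  shows "word_type vs p"
proof -
  have len: "length vs = length bs" using vs(1) by (rule mset_eq_length)
  obtain f where f: "f permutes {..<length vs}" "permute_list f vs = bs"
    using mset_eq_permutation[OF vs(1)[symmetric]] by blast
  have fl: "f i < length vs" if "i < length vs" for i using permutes_in_image[OF f(1), of i] that by simp
  have nth: "bs ! i = vs ! f i" if "i < length vs" for i
    using permute_list_nth[OF f(1) that] f(2) by simp
  have ord: "i < j \<longleftrightarrow> bs ! i < bs ! j" if "i < length bs" "j < length bs" for i j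
    using sorted_wrt_nth_less[OF bs, of i j] sorted_wrt_nth_less[OF bs, of j i] that
    by (metis less_asym less_irrefl nat_neq_iff)
  have ord': "i < j \<longleftrightarrow> w (vs ! i) < w (vs ! j)" if "i < length vs" "j < length vs" for i j
    using sorted_wrt_nth_less[OF vs(2), of i j] sorted_wrt_nth_less[OF vs(2), of j i] that
    by (metis less_asym less_irrefl nat_neq_iff)
  have "generic_type (length vs) (word_rel vs) p"
  proof (rule generic_type_relabel[where \<pi> = f])
    show "generic_type (length vs) (word_rel (map w bs)) p" using g len unfolding word_type_def by simp
    show "bij_betw f {..<length vs} {..<length vs}" using f(1) by (rule permutes_imp_bij)
    fix i j assume ij: "i < length vs" "j < length vs"
    show "(i, j) \<in> word_rel (map w bs) \<longleftrightarrow> (f i, f j) \<in> word_rel vs"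
      unfolding word_rel_def
      using ij fl[OF ij(1)] fl[OF ij(2)] nth[OF ij(1)] nth[OF ij(2)] ord[of i j] ord'[OF fl[OF ij(1)] fl[OF ij(2)]] len by auto
  qed
  thus ?thesis unfolding word_type_def .
qed

text \<open>Both sides grow by the box of the new largest letter, and the two new shapes agree because the
  generic Jordan type does not see whether a permutation is read by positions or by values. This
  replaces the symmetry of the Robinson-Schensted correspondence.\<close>

lemma RS_word_transpose:
  fixes w :: "'a::linorder \<Rightarrow> 'b::linorder"
  assumes "sorted_wrt (<) bs" "inj_on w (set bs)"
  shows "snd (RS_word w bs) = List.transpose (ptab (rev (sort_key w bs)))"
  using assms
proof (induct bs rule: rev_induct)
  case Nil thus ?case by (simp add: RS_word_def)
next
  case (snoc b bs)
  note s = RS_word_step[OF snoc.prems]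
  let ?Q = "snd (RS_word w bs)" and ?P = "ptab (map w bs)" and ?v = "sort_key w bs" and ?v' = "sort_key w (bs @ [b])"
  let ?k = "ins_row ?P (w b)" and ?U = "ptab (rev (sort_key w (bs @ [b])))"
  have lt: "\<forall>x\<in>set bs. x < b" using snoc.prems(1) by (auto simp: sorted_wrt_append)
  have sb: "sorted_wrt (<) bs" "inj_on w (set bs)" using snoc.prems by (auto simp: sorted_wrt_append intro: inj_on_subset)
  have IH: "?Q = List.transpose (ptab (rev ?v))" using snoc.hyps sb by simp
  have dv: "distinct ?v'" using snoc.prems(1) by (simp add: strict_sorted_iff)
  hence U: "tableau ?U" "entries ?U = set (bs @ [b])" using ptab_tableau[of "rev ?v'"] by auto
  have "filter (\<lambda>x. x < b) (bs @ [b]) = bs" using lt by (simp add: filter_id_conv)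
  \<comment> \<open>Deleting the largest letter from the word deletes it from the insertion tableau
    and leaves the tableau of the induction hypothesis.\<close>
  hence "restr (\<lambda>x. x < b) ?U = ptab (rev ?v)"
    by (subst restr_ptab) (use dv in \<open>auto simp: rev_filter[symmetric] filter_sort\<close>)
  then obtain k where k: "?U = append_to_row b k (ptab (rev ?v))" "k \<le> length (ptab (rev ?v))" "tableau (ptab (rev ?v))"
    using max_corner[OF U(1), of b] U(2) lt by force
  have tU: "List.transpose ?U = append_to_row b (row_len (ptab (rev ?v)) k) ?Q"
    unfolding IH k(1) by (rule transpose_append_to_row[OF k(3,2)]) (use U(1) k(1) in simp)
  let ?c = "row_len (ptab (rev ?v)) k"
  have y0: "rows_tableau (ptab (rev ?v))" using k(3) unfolding tableau_def by simp
  have cV: "?c \<le> length ?Q"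
    unfolding IH using length_transpose_row_len[OF rows_tableau_lengths[OF y0]] row_len_antimono[OF y0, of 0 k] by simp
  \<comment> \<open>\<open>?v'\<close> is the inverse word, so its type is the shape obtained from
    the word itself; the same type is computed below from the reversal of
    \<open>?v'\<close>.\<close>
  have g1: "word_type ?v' (shape (ptab (map w (bs @ [b]))))"
  proof (rule word_type_inverse[OF snoc.prems(1)])
    have "sorted (map w ?v')" by simp
    moreover have "distinct (map w ?v')" using dv snoc.prems(2) by (simp add: distinct_map)
    ultimately show "sorted_wrt (\<lambda>x y. w x < w y) ?v'" using strict_sorted_iff[of "map w ?v'"] by (simp add: sorted_wrt_map)
    show "word_type (map w (bs @ [b])) (shape (ptab (map w (bs @ [b]))))"
      by (rule word_type_ptab) (use snoc.prems in \<open>auto simp: distinct_map strict_sorted_iff\<close>)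
  qed simp
  have "word_type (rev (rev ?v')) (shape (List.transpose ?U))" by (rule word_type_ptab_transpose) (use dv in simp)
  hence "shape (List.transpose ?U) = shape (ptab (map w (bs @ [b])))"
    using g1 generic_type_unique unfolding word_type_def by auto
  hence "row_len (List.transpose ?U) = row_len (ptab (map w (bs @ [b])))" by (simp add: row_len_part)
  hence e: "row_len (append_to_row b ?c ?Q) = row_len (append_to_row b ?k ?Q)"
    unfolding tU using row_len_append_to_row[OF s(8)] s(7) row_len_row_insert(1)[OF s(3,4)] by simp
  \<comment> \<open>Both shapes have one box more than \<open>?Q\<close>, so their equality forces
    the same row.\<close>
  have "?c = ?k"
  proof (rule ccontr)
    assume "?c \<noteq> ?k"
    thus False using fun_cong[OF e, of ?k] unfolding row_len_append_to_row[OF s(8)] row_len_append_to_row[OF cV] by simp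
  qed
  thus ?case using s(1) tU by simp
qed

section \<open>Column strips\<close>

text \<open>Row insertion of decreasing words and column insertion of increasing words both fill column strips
  from top to bottom; \<open>rw T a\<close> is the row of the new box, and \<open>lt\<close> is the order of successive letters.\<close>

locale strip_insertion =
  fixes ins :: "nat list list \<Rightarrow> nat \<Rightarrow> nat list list" and rw :: "nat list list \<Rightarrow> nat \<Rightarrow> nat"
    and lt :: "nat \<Rightarrow> nat \<Rightarrow> bool"
  assumes tableau_ins: "tableau T \<Longrightarrow> a \<notin> entries T \<Longrightarrow> tableau (ins T a)"
    and entries_ins: "tableau T \<Longrightarrow> a \<notin> entries T \<Longrightarrow> entries (ins T a) = insert a (entries T)"
    and row_len_ins: "tableau T \<Longrightarrow> a \<notin> entries T \<Longrightarrow> row_len (ins T a) = (row_len T)(rw T a := Suc (row_len T (rw T a)))"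
    and ins_inj: "tableau T \<Longrightarrow> a \<notin> entries T \<Longrightarrow> tableau U \<Longrightarrow> b \<notin> entries U \<Longrightarrow> ins T a = ins U b \<Longrightarrow>
      rw T a = rw U b \<Longrightarrow> T = U \<and> a = b"
    and ins_surj: "tableau T' \<Longrightarrow> row_len T' (Suc i) < row_len T' i \<Longrightarrow>
      \<exists>T a. tableau T \<and> a \<notin> entries T \<and> ins T a = T' \<and> rw T a = i"
    and bumping: "tableau T \<Longrightarrow> a \<notin> entries T \<Longrightarrow> b \<notin> entries T \<Longrightarrow> a \<noteq> b \<Longrightarrow>
      rw T a < rw (ins T a) b \<longleftrightarrow> lt a b"
    and lt_trans: "lt a b \<Longrightarrow> lt b c \<Longrightarrow> lt a c"
    and lt_irrefl: "\<not> lt a a"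
begin

lemma distinct_lt: "sorted_wrt lt l \<Longrightarrow> distinct l"
  using lt_irrefl by (induct l) auto

text \<open>Successive boxes move strictly down by \<open>bumping\<close>, so every row gains at
  most one. The last conjunct, by which the final box is in the lowest row changed, drives the
  induction and later identifies the box to be removed.\<close>

lemma foldl_ins:
  assumes "tableau T" "sorted_wrt lt l" "set l \<inter> entries T = {}"
  shows "tableau (foldl ins T l) \<and> entries (foldl ins T l) = entries T \<union> set l \<and>
    (\<forall>i. row_len T i \<le> row_len (foldl ins T l) i \<and> row_len (foldl ins T l) i \<le> Suc (row_len T i)) \<and>
    (\<forall>l0 x. l = l0 @ [x] \<longrightarrow> row_len (foldl ins T l) (rw (foldl ins T l0) x) = Suc (row_len T (rw (foldl ins T l0) x)) \<and>
      (\<forall>i>rw (foldl ins T l0) x. row_len (foldl ins T l) i = row_len T i))"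
  using assms(2,3)
proof (induct l rule: rev_induct)
  case Nil thus ?case using assms(1) by simp
next
  case (snoc x l)
  let ?T = "foldl ins T l" and ?k = "rw (foldl ins T l) x"
  have IH: "tableau ?T" "entries ?T = entries T \<union> set l" "\<And>i. row_len T i \<le> row_len ?T i" "\<And>i. row_len ?T i \<le> Suc (row_len T i)"
    "\<And>l0 y. l = l0 @ [y] \<Longrightarrow> \<forall>i>rw (foldl ins T l0) y. row_len ?T i = row_len T i"
    using snoc by (auto simp: sorted_wrt_append)
  have x: "x \<notin> entries ?T" using IH(2) snoc.prems distinct_lt[OF snoc.prems(1)] by auto
  \<comment> \<open>The new box lies strictly below the previous one, hence in a row that has not
    grown yet.\<close>
  have top: "row_len ?T i = row_len T i" if "i \<ge> ?k" for i
  proof (cases l rule: rev_cases)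
    case (snoc l0 y)
    let ?T0 = "foldl ins T l0"
    have s: "sorted_wrt lt (l0 @ [y, x])" using \<open>sorted_wrt lt (l @ [x])\<close> snoc by simp
    have d: "distinct (l0 @ [y, x])" using distinct_lt[OF s] .
    have T0: "tableau ?T0 \<and> entries ?T0 = entries T \<union> set l0"
      using \<open>tableau T\<close> s d snoc \<open>set (l @ [x]) \<inter> entries T = {}\<close>
    proof -
      have "tableau (foldl ins T m) \<and> entries (foldl ins T m) = entries T \<union> set m"
        if "distinct m" "set m \<inter> entries T = {}" for m
        using that by (induct m rule: rev_induct) (use assms(1) in \<open>auto simp: tableau_ins entries_ins\<close>)
      thus ?thesis using d snoc \<open>set (l @ [x]) \<inter> entries T = {}\<close> by auto
    qed
    have "rw ?T0 y < rw (ins ?T0 y) x"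
      by (subst bumping) (use T0 d s snoc \<open>set (l @ [x]) \<inter> entries T = {}\<close> in \<open>auto simp: sorted_wrt_append\<close>)
    hence "rw ?T0 y < ?k" using snoc by simp
    thus ?thesis using IH(5)[OF snoc] that by auto
  qed simp
  have r: "row_len (ins ?T x) = (row_len ?T)(?k := Suc (row_len ?T ?k))" by (rule row_len_ins[OF IH(1) x])
  have "row_len (ins ?T x) ?k = Suc (row_len T ?k)" "\<forall>i>?k. row_len (ins ?T x) i = row_len T i" using r top by auto
  moreover have "row_len T i \<le> row_len (ins ?T x) i \<and> row_len (ins ?T x) i \<le> Suc (row_len T i)" for i
    using r top[of ?k] IH(3,4)[of i] by auto
  ultimately show ?case using tableau_ins[OF IH(1) x] entries_ins[OF IH(1) x] IH(2) by auto
qed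

text \<open>Starting and final shapes agree, and the last box lies in the lowest row in which they
  differ; so the last insertions end in the same row and can be undone together.\<close>

lemma foldl_ins_inj:
  assumes "tableau T" "sorted_wrt lt l" "set l \<inter> entries T = {}"
    and "tableau U" "sorted_wrt lt l'" "set l' \<inter> entries U = {}"
    and "foldl ins T l = foldl ins U l'" "row_len T = row_len U"
  shows "T = U \<and> l = l'"
  using assms
proof (induct l arbitrary: l' rule: rev_induct)
  case Nil
  show ?case
  proof (cases l' rule: rev_cases)
    case (snoc l0 x)
    let ?k = "rw (foldl ins U l0) x"
    have "row_len (foldl ins U l') ?k = Suc (row_len U ?k)" using foldl_ins[OF Nil.prems(4-6)] snoc by blast
    thus ?thesis using Nil.prems(7,8) by auto
  qed (use Nil in simp)
next
  case (snoc x l)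
  let ?k = "rw (foldl ins T l) x"
  have F: "tableau (foldl ins T l)" "entries (foldl ins T l) = entries T \<union> set l"
    using foldl_ins[of T l] snoc.prems by (auto simp: sorted_wrt_append)
  have k: "row_len (foldl ins T (l @ [x])) ?k = Suc (row_len T ?k)" "\<forall>i>?k. row_len (foldl ins T (l @ [x])) i = row_len T i"
    using foldl_ins[OF snoc.prems(1-3)] by blast+
  show ?case
  proof (cases l' rule: rev_cases)
    case Nil
    thus ?thesis using k(1) snoc.prems(7,8) by auto
  next
    case l': (snoc l0 y)
    let ?k' = "rw (foldl ins U l0) y"
    have F': "tableau (foldl ins U l0)" "entries (foldl ins U l0) = entries U \<union> set l0"
      using foldl_ins[of U l0] snoc.prems l' by (auto simp: sorted_wrt_append)
    have k': "row_len (foldl ins U l') ?k' = Suc (row_len U ?k')" "\<forall>i>?k'. row_len (foldl ins U l') i = row_len U i"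
      using foldl_ins[OF snoc.prems(4-6)] l' by blast+
    have kk: "?k = ?k'"
    proof (rule linorder_cases[of ?k ?k'])
      assume "?k < ?k'" thus ?thesis using k(2) k'(1) snoc.prems(7,8) by (metis n_not_Suc_n)
    next
      assume "?k' < ?k" thus ?thesis using k(1) k'(2) snoc.prems(7,8) by (metis n_not_Suc_n)
    qed
    have x: "x \<notin> entries (foldl ins T l)" using F(2) snoc.prems(3) distinct_lt[OF snoc.prems(2)] by auto
    have y: "y \<notin> entries (foldl ins U l0)" using F'(2) snoc.prems(6) distinct_lt[OF snoc.prems(5)] l' by auto
    have "foldl ins T l = foldl ins U l0 \<and> x = y"
      using ins_inj[OF F(1) x F'(1) y] kk snoc.prems(7) l' by simp
    moreover from this have "T = U \<and> l = l0"
      using snoc.hyps[of l0] snoc.prems l' by (auto simp: sorted_wrt_append)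
    ultimately show ?thesis using l' by simp
  qed
qed

text \<open>The boxes of the strip are removed from the lowest row upwards. That the removed letters
  are ordered by \<open>lt\<close> is \<open>bumping\<close> read backwards, because the rows of
  their boxes increase.\<close>

lemma foldl_ins_surj:
  assumes "tableau T'" "\<And>i. \<nu> (Suc i) \<le> \<nu> i" "\<And>i. \<nu> i \<le> row_len T' i" "\<And>i. row_len T' i \<le> Suc (\<nu> i)"
  shows "\<exists>T l. tableau T \<and> row_len T = \<nu> \<and> sorted_wrt lt l \<and> set l \<inter> entries T = {} \<and> foldl ins T l = T'"
  using assms(1,3,4)
proof (induct "card {i. row_len T' i \<noteq> \<nu> i}" arbitrary: T' rule: less_induct)
  case less
  let ?S = "{i. row_len T' i \<noteq> \<nu> i}"
  have "?S \<subseteq> {..<length T'}"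
  proof
    fix i assume "i \<in> ?S"
    hence "row_len T' i \<noteq> 0" using less.prems(2)[of i] by auto
    thus "i \<in> {..<length T'}" unfolding row_len_def by (auto split: if_splits)
  qed
  hence fin: "finite ?S" using finite_subset by blast
  show ?case
  proof (cases "?S = {}")
    case True
    hence "row_len T' = \<nu>" by auto
    thus ?thesis using less.prems(1) by (intro exI[of _ T'] exI[of _ "[]"]) simp
  next
    case False
    define k where "k = Max ?S"
    have kS: "k \<in> ?S" and kM: "\<And>i. i \<in> ?S \<Longrightarrow> i \<le> k" using Max_in[OF fin False] Max_ge[OF fin] unfolding k_def by blast+
    have rk: "row_len T' k = Suc (\<nu> k)" using kS less.prems(2,3)[of k] by auto
    have ra: "row_len T' i = \<nu> i" if "i > k" for i using kM[of i] that by auto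
    \<comment> \<open>The lowest box of the strip is a corner: the next row has length
      \<open>\<nu> (Suc k)\<close>, which is at most \<open>\<nu> k\<close>.\<close>
    have "row_len T' (Suc k) < row_len T' k" using ra[of "Suc k"] rk assms(2)[of k] by simp
    from ins_surj[OF less.prems(1) this] obtain T1 x where
      T1: "tableau T1" "x \<notin> entries T1" "ins T1 x = T'" "rw T1 x = k" by blast
    have r1: "row_len T' = (row_len T1)(k := Suc (row_len T1 k))" using row_len_ins[OF T1(1,2)] T1(3,4) by simp
    have r1k: "row_len T1 k = \<nu> k" using rk r1 by simp
    have r1i: "i \<noteq> k \<Longrightarrow> row_len T1 i = row_len T' i" for i using r1 by simp
    have S1: "{i. row_len T1 i \<noteq> \<nu> i} = ?S - {k}" using r1k r1i by (auto; metis)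
    have "card {i. row_len T1 i \<noteq> \<nu> i} < card ?S" unfolding S1 using fin kS by (meson card_Diff1_less)
    from less.hyps[OF this T1(1)] obtain T l where
      T: "tableau T" "row_len T = \<nu>" "sorted_wrt lt l" "set l \<inter> entries T = {}" "foldl ins T l = T1"
      using less.prems(2,3) r1k r1i by (metis le_SucI order_refl)
    have e1: "entries T1 = entries T \<union> set l" using foldl_ins[OF T(1,3,4)] T(5) by simp
    have "sorted_wrt lt (l @ [x])"
    proof (cases l rule: rev_cases)
      case (snoc l0 y)
      let ?T0 = "foldl ins T l0"
      have F: "tableau ?T0" "entries ?T0 = entries T \<union> set l0"
        using foldl_ins[of T l0] T snoc by (auto simp: sorted_wrt_append)
      have "row_len T1 (rw ?T0 y) = Suc (row_len T (rw ?T0 y))"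
        using foldl_ins[OF T(1,3,4)] T(5) snoc by blast
      hence "rw ?T0 y \<in> ?S - {k}" unfolding S1[symmetric] using T(2) by simp
      hence "rw ?T0 y < k" using kM by fastforce
      hence "rw ?T0 y < rw (ins ?T0 y) x" using T1(4) T(5) snoc by simp
      moreover have "y \<notin> entries ?T0" "x \<notin> entries ?T0" "y \<noteq> x"
        using F(2) T(3,4) snoc distinct_lt[OF T(3)] T1(2) e1 by auto
      ultimately have "lt y x" using bumping[OF F(1)] by blast
      thus ?thesis using T(3) snoc lt_trans by (auto simp: sorted_wrt_append)
    qed simp
    moreover have "set (l @ [x]) \<inter> entries T = {}" using T(4) T1(2) e1 by auto
    ultimately show ?thesis using T T1(3) by (intro exI[of _ T] exI[of _ "l @ [x]"]) simp
  qed
qed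

end

interpretation row: strip_insertion row_insert ins_row "\<lambda>a b. b < a"
  by (unfold_locales; ((rule tableau_row_insert entries_row_insert row_len_row_insert(1) row_insert_inj row_insert_surj row_bumping; assumption) | simp))

text \<open>Column insertion adds its box at the bottom of column
  \<open>ins_row (transpose T) a\<close>; the row index of this box is the former length of that
  column.\<close>

definition ins_col :: "nat list list \<Rightarrow> nat \<Rightarrow> nat" where
  "ins_col T a = row_len (List.transpose T) (ins_row (List.transpose T) a)"

text \<open>Everything is transported through the transpose, which reverses the order of the
  letters: in row insertion a larger second letter gives a box weakly above, hence strictly to the
  right, and right becomes down after transposing.\<close>

interpretation col: strip_insertion "\<lambda>T a. column_insert a T" ins_col "(<)"
proof
  fix T U :: "nat list list" and a b c :: nat
  { fix T :: "nat list list" and a :: nat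
    assume T: "tableau T" and a: "a \<notin> entries T"
    have y: "rows_tableau T" using T unfolding tableau_def by simp
    have "tableau (List.transpose T)" "a \<notin> entries (List.transpose T)"
      using tableau_transpose[OF T] entries_transpose[OF y] a by auto
  } note tr = this
  { assume T: "tableau T" and a: "a \<notin> entries T"
    let ?V = "List.transpose T" and ?k = "ins_row (List.transpose T) a"
    note V = tr[OF T a]
    have V': "tableau (row_insert ?V a)" by (rule tableau_row_insert[OF V])
    have y: "rows_tableau T" "rows_tableau ?V" "rows_tableau (row_insert ?V a)" using T V V' unfolding tableau_def by auto
    show "tableau (column_insert a T)" unfolding column_insert_def by (rule tableau_transpose[OF V'])
    show "entries (column_insert a T) = insert a (entries T)"
      unfolding column_insert_def entries_transpose[OF y(3)] entries_row_insert[OF V] entries_transpose[OF y(1)] ..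
    show "row_len (column_insert a T) = (row_len T)(ins_col T a := Suc (row_len T (ins_col T a)))"
    proof
      fix j
      have corner: "row_len ?V ?k < row_len ?V i" if "i < ?k" for i
        using row_len_antimono[OF y(3), of i ?k] that unfolding row_len_row_insert(1)[OF V] by auto
      have "i < row_len (column_insert a T) j \<longleftrightarrow> i < ((row_len T)(ins_col T a := Suc (row_len T (ins_col T a)))) j" for i
      proof -
        have TV: "i < row_len T j \<longleftrightarrow> j < row_len ?V i" for i j
          using transpose_cells(1)[OF rows_tableau_lengths[OF y(1)], of j i] by simp
        have "row_len T (row_len ?V ?k) = ?k"
        proof -
          have "i < row_len T (row_len ?V ?k) \<longleftrightarrow> i < ?k" for i
            using TV[of i "row_len ?V ?k"] corner[of i] row_len_antimono[OF y(2), of ?k i] by (cases "i < ?k") auto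
          thus ?thesis by (metis less_irrefl nat_neq_iff)
        qed
        thus ?thesis
          unfolding column_insert_def transpose_cells(1)[OF rows_tableau_lengths[OF y(3)]] row_len_row_insert(1)[OF V] ins_col_def
          using TV[of i j] TV[of ?k j] by (auto simp: less_Suc_eq)
      qed
      thus "row_len (column_insert a T) j = ((row_len T)(ins_col T a := Suc (row_len T (ins_col T a)))) j"
        by (metis less_irrefl nat_neq_iff)
    qed
  }
  { assume T: "tableau T" "tableau U" and a: "a \<notin> entries T" "b \<notin> entries U"
      and e: "column_insert a T = column_insert b U" "ins_col T a = ins_col U b"
    note V = tr[OF T(1) a(1)] and W = tr[OF T(2) a(2)]
    let ?V = "List.transpose T" and ?W = "List.transpose U"
    let ?k = "ins_row ?V a" and ?l = "ins_row ?W b"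
    have V': "rows_tableau (row_insert ?V a)" "rows_tableau (row_insert ?W b)" using tableau_row_insert[OF V] tableau_row_insert[OF W] unfolding tableau_def by auto
    have y: "rows_tableau T" "rows_tableau U" "rows_tableau ?V" "rows_tableau ?W" using T V W unfolding tableau_def by auto
    have eq: "row_insert ?V a = row_insert ?W b"
      using e(1) transpose_transpose_rows_tableau[OF V'(1)] transpose_transpose_rows_tableau[OF V'(2)] unfolding column_insert_def by metis
    have lk: "row_len ?V ?k = row_len ?W ?l" using e(2) unfolding ins_col_def .
    have rV: "row_len (row_insert ?V a) = (row_len ?V)(?k := Suc (row_len ?V ?k))" by (rule row_len_row_insert(1)[OF V])
    have rW: "row_len (row_insert ?V a) = (row_len ?W)(?l := Suc (row_len ?W ?l))" unfolding eq by (rule row_len_row_insert(1)[OF W])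
    \<comment> \<open>Both new boxes are corners of the same shape with the same column index in the
      transpose, hence they coincide.\<close>
    have "?k = ?l"
    proof (rule linorder_cases[of ?k ?l])
      assume kl: "?k < ?l"
      have "row_len (row_insert ?V a) ?l = row_len ?V ?l" using rV kl by simp
      also have "\<dots> \<le> row_len ?V ?k" using row_len_antimono[OF y(3), of ?k ?l] kl by simp
      finally show ?thesis using fun_cong[OF rW, of ?l] lk by simp
    next
      assume kl: "?l < ?k"
      have "row_len (row_insert ?V a) ?k = row_len ?W ?k" using rW kl by simp
      also have "\<dots> \<le> row_len ?W ?l" using row_len_antimono[OF y(4), of ?l ?k] kl by simp
      finally show ?thesis using fun_cong[OF rV, of ?k] lk by simp
    qed
    from row_insert_inj[OF V W eq this] have "?V = ?W" "a = b" by auto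
    thus "T = U \<and> a = b" using transpose_transpose_rows_tableau y(1,2) by metis
  }
  { fix T' :: "nat list list" and i
    assume T': "tableau T'" and c: "row_len T' (Suc i) < row_len T' i"
    have y: "rows_tableau T'" using T' unfolding tableau_def by simp
    let ?V' = "List.transpose T'"
    have V': "tableau ?V'" by (rule tableau_transpose[OF T'])
    note C = transpose_cells(1)[OF rows_tableau_lengths[OF y]]
    \<comment> \<open>The last column of row \<open>i\<close>; since row \<open>i + 1\<close> is
      shorter, this column ends in row \<open>i\<close>.\<close>
    define k where "k = row_len T' i - 1"
    have k: "k < row_len T' i" "\<not> k < row_len T' (Suc i)" "\<not> Suc k < row_len T' i" using c unfolding k_def by auto
    have vk: "row_len ?V' k = Suc i" using C[of i k] C[of "Suc i" k] k by auto
    have "row_len ?V' (Suc k) < row_len ?V' k" using C[of i "Suc k"] k vk by auto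
    from row_insert_surj[OF V' this] obtain V a where
      V: "tableau V" "a \<notin> entries V" "row_insert V a = ?V'" "ins_row V a = k" by blast
    have yV: "rows_tableau V" using V unfolding tableau_def by simp
    have "row_len V k = i" using fun_cong[OF row_len_row_insert(1)[OF V(1,2)], of k] V(3,4) vk by simp
    hence "ins_col (List.transpose V) a = i" unfolding ins_col_def transpose_transpose_rows_tableau[OF yV] V(4) .
    moreover have "column_insert a (List.transpose V) = T'"
      unfolding column_insert_def transpose_transpose_rows_tableau[OF yV] V(3) by (rule transpose_transpose_rows_tableau[OF y])
    ultimately show "\<exists>T a. tableau T \<and> a \<notin> entries T \<and> column_insert a T = T' \<and> ins_col T a = i"
      using tableau_transpose[OF V(1)] entries_transpose[OF yV] V(2) by blast
  }
  { assume T: "tableau T" and a: "a \<notin> entries T" and b: "b \<notin> entries T" and ab: "a \<noteq> b"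
    let ?V = "List.transpose T" and ?k = "ins_row (List.transpose T) a"
    note V = tr[OF T a] and Vb = tr[OF T b]
    have V': "tableau (row_insert ?V a)" by (rule tableau_row_insert[OF V])
    have y: "rows_tableau ?V" "rows_tableau (row_insert ?V a)" using V V' unfolding tableau_def by auto
    let ?l = "ins_row (row_insert ?V a) b"
    have bump: "?k < ?l \<longleftrightarrow> b < a" by (rule row_bumping[OF V Vb(2) ab])
    have l: "ins_col (column_insert a T) b = row_len (row_insert ?V a) ?l"
      unfolding ins_col_def column_insert_def transpose_transpose_rows_tableau[OF y(2)] ..
    note r = row_len_row_insert(1)[OF V]
    show "ins_col T a < ins_col (column_insert a T) b \<longleftrightarrow> a < b"
    proof (cases "a < b")
      case True
      hence "?l \<le> ?k" using bump by auto
      hence "row_len (row_insert ?V a) ?k \<le> row_len (row_insert ?V a) ?l" by (rule row_len_antimono[OF y(2)])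
      thus ?thesis using True unfolding l unfolding ins_col_def r by auto
    next
      case False
      hence "?k < ?l" using bump ab by auto
      thus ?thesis using False row_len_antimono[OF y(1), of ?k ?l] unfolding l unfolding ins_col_def r by auto
    qed
  }
qed auto

section \<open>Partial permutations\<close>

text \<open>A partial permutation given by its domain and a map, whose values off \<open>D\<close>
  do not affect the matrix. \<open>Suc\<close> converts matrix indices to arguments and values of
  the map.\<close>

definition pp_mat :: "nat \<Rightarrow> nat set \<Rightarrow> (nat \<Rightarrow> nat) \<Rightarrow> complex mat" where
  "pp_mat n D w = mat n n (\<lambda>(i, j). if Suc j \<in> D \<and> w (Suc j) = Suc i then 1 else 0)"

definition pp_data :: "nat \<Rightarrow> nat set \<Rightarrow> (nat \<Rightarrow> nat) \<Rightarrow> bool" where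
  "pp_data n D w \<longleftrightarrow> D \<subseteq> {1..n} \<and> inj_on w D \<and> w ` D \<subseteq> {1..n}"

lemma pp_mat_index: "i < n \<Longrightarrow> j < n \<Longrightarrow> pp_mat n D w $$ (i, j) = (if Suc j \<in> D \<and> w (Suc j) = Suc i then 1 else 0)"
  unfolding pp_mat_def by simp

lemma pp_mat_carrier: "pp_mat n D w \<in> carrier_mat n n"
  unfolding pp_mat_def by simp

lemma card_le_1_iff:
  fixes P :: "nat \<Rightarrow> bool"
  shows "card {j. j < n \<and> P j} \<le> 1 \<longleftrightarrow> (\<forall>j<n. \<forall>k<n. P j \<longrightarrow> P k \<longrightarrow> j = k)"
  by (subst card_le_Suc0_iff_eq[folded One_nat_def]) auto

lemma pp_mat_in_partial_perms:
  assumes "pp_data n D w" shows "pp_mat n D w \<in> partial_perms n"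
  unfolding partial_perms_def card_le_1_iff
proof (intro CollectI conjI allI impI)
  fix i j k assume "i < n" "j < n" "k < n" "pp_mat n D w $$ (i, j) = 1" "pp_mat n D w $$ (i, k) = 1"
  hence "Suc j \<in> D" "Suc k \<in> D" "w (Suc j) = w (Suc k)" by (auto simp: pp_mat_index split: if_splits)
  thus "j = k" using assms unfolding pp_data_def inj_on_def by blast
qed (auto simp: pp_mat_carrier pp_mat_index split: if_splits)

lemma pp_row:
  "\<tau> \<in> partial_perms n \<Longrightarrow> \<tau> $$ (i, j) = 1 \<Longrightarrow> \<tau> $$ (i, k) = 1 \<Longrightarrow> i < n \<Longrightarrow> j < n \<Longrightarrow> k < n \<Longrightarrow> j = k"
  unfolding partial_perms_def card_le_1_iff by blast

lemma pp_col:
  "\<tau> \<in> partial_perms n \<Longrightarrow> \<tau> $$ (i, j) = 1 \<Longrightarrow> \<tau> $$ (k, j) = 1 \<Longrightarrow> i < n \<Longrightarrow> j < n \<Longrightarrow> k < n \<Longrightarrow> i = k"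
  unfolding partial_perms_def card_le_1_iff by blast

lemma pp_map_eq:
  assumes t: "\<tau> \<in> partial_perms n" and ij: "i \<in> {1..n}" "j \<in> {1..n}"
  shows "pp_map n \<tau> j = i \<longleftrightarrow> \<tau> $$ (i - 1, j - 1) = 1"
proof -
  have u: "i = i'" if "i \<in> {1..n}" "i' \<in> {1..n}" "\<tau> $$ (i - 1, j - 1) = 1" "\<tau> $$ (i' - 1, j - 1) = 1" for i i'
  proof -
    have "i - 1 = i' - 1" by (rule pp_col[OF t that(3,4)]) (use that ij in auto)
    thus ?thesis using that by auto
  qed
  show ?thesis
  proof
    assume *: "\<tau> $$ (i - 1, j - 1) = 1"
    have "(THE i. i \<in> {1..n} \<and> \<tau> $$ (i - 1, j - 1) = 1) = i" by (rule the_equality) (use u ij * in auto)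
    thus "pp_map n \<tau> j = i" using ij * unfolding pp_map_def by auto
  next
    assume e: "pp_map n \<tau> j = i"
    show "\<tau> $$ (i - 1, j - 1) = 1"
    proof (cases "\<exists>i\<in>{1..n}. \<tau> $$ (i - 1, j - 1) = 1")
      case True
      then obtain i' where i': "i' \<in> {1..n}" "\<tau> $$ (i' - 1, j - 1) = 1" by blast
      have "(THE i. i \<in> {1..n} \<and> \<tau> $$ (i - 1, j - 1) = 1) = i'" by (rule the_equality) (use u i' in auto)
      thus ?thesis using e i' True unfolding pp_map_def by auto
    next
      case False thus ?thesis using e ij unfolding pp_map_def by auto
    qed
  qed
qed

lemma pp_map_range: "pp_map n \<tau> j \<noteq> 0 \<Longrightarrow> \<tau> \<in> partial_perms n \<Longrightarrow> j \<in> {1..n} \<Longrightarrow> pp_map n \<tau> j \<in> {1..n}"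
proof -
  assume nz: "pp_map n \<tau> j \<noteq> 0" and t: "\<tau> \<in> partial_perms n" and j: "j \<in> {1..n}"
  then obtain i where "i \<in> {1..n}" "\<tau> $$ (i - 1, j - 1) = 1" unfolding pp_map_def by (auto split: if_splits)
  thus ?thesis using pp_map_eq[OF t _ j] by metis
qed

lemma pp_pp_data:
  assumes t: "\<tau> \<in> partial_perms n" shows "pp_data n (pp_dom n \<tau>) (pp_map n \<tau>)"
  unfolding pp_data_def
proof (intro conjI inj_onI)
  show "pp_dom n \<tau> \<subseteq> {1..n}" unfolding pp_dom_def by auto
  show r: "pp_map n \<tau> ` pp_dom n \<tau> \<subseteq> {1..n}" using pp_map_range[OF _ t] unfolding pp_dom_def by auto
  fix j k assume j: "j \<in> pp_dom n \<tau>" and k: "k \<in> pp_dom n \<tau>" and e: "pp_map n \<tau> j = pp_map n \<tau> k"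
  define i where "i = pp_map n \<tau> j"
  have i: "i \<in> {1..n}" using r j unfolding i_def by auto
  have jk: "j \<in> {1..n}" "k \<in> {1..n}" using j k unfolding pp_dom_def by auto
  have "\<tau> $$ (i - 1, j - 1) = 1" "\<tau> $$ (i - 1, k - 1) = 1"
    using pp_map_eq[OF t i jk(1)] pp_map_eq[OF t i jk(2)] e unfolding i_def by auto
  hence "j - 1 = k - 1" by (rule pp_row[OF t]) (use i jk in auto)
  thus "j = k" using jk by auto
qed

lemma pp_mat_pp:
  assumes t: "\<tau> \<in> partial_perms n" shows "\<tau> = pp_mat n (pp_dom n \<tau>) (pp_map n \<tau>)"
proof (rule eq_matI)
  have c: "\<tau> \<in> carrier_mat n n" using t unfolding partial_perms_def by auto
  fix i j assume "i < dim_row (pp_mat n (pp_dom n \<tau>) (pp_map n \<tau>))" "j < dim_col (pp_mat n (pp_dom n \<tau>) (pp_map n \<tau>))"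
  hence ij: "i < n" "j < n" by (auto simp: pp_mat_def)
  have "\<tau> $$ (i, j) = 0 \<or> \<tau> $$ (i, j) = 1" using t ij unfolding partial_perms_def by auto
  thus "\<tau> $$ (i, j) = pp_mat n (pp_dom n \<tau>) (pp_map n \<tau>) $$ (i, j)"
    using pp_map_eq[OF t, of "Suc i" "Suc j"] ij unfolding pp_mat_index[OF ij] pp_dom_def by auto
qed (use t in \<open>auto simp: partial_perms_def pp_mat_def\<close>)

lemma pp_mat_pp_map:
  assumes p: "pp_data n D w" shows "pp_dom n (pp_mat n D w) = D" "\<And>j. j \<in> D \<Longrightarrow> pp_map n (pp_mat n D w) j = w j"
proof -
  note t = pp_mat_in_partial_perms[OF p]
  have w: "pp_map n (pp_mat n D w) j = w j" if j: "j \<in> D" for j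
  proof (subst pp_map_eq[OF t])
    have "j \<in> {1..n}" "w j \<in> {1..n}" using p j unfolding pp_data_def by auto
    thus "w j \<in> {1..n}" "j \<in> {1..n}" "pp_mat n D w $$ (w j - 1, j - 1) = 1" using j by (auto simp: pp_mat_index)
  qed
  show "\<And>j. j \<in> D \<Longrightarrow> pp_map n (pp_mat n D w) j = w j" by (rule w)
  show "pp_dom n (pp_mat n D w) = D"
  proof (intro equalityI subsetI)
    fix j assume j: "j \<in> D"
    thus "j \<in> pp_dom n (pp_mat n D w)" using p w[OF j] unfolding pp_dom_def pp_data_def by auto
  next
    fix j assume "j \<in> pp_dom n (pp_mat n D w)"
    hence j: "j \<in> {1..n}" "pp_map n (pp_mat n D w) j \<noteq> 0" unfolding pp_dom_def by auto
    from pp_map_range[OF j(2) t j(1)] have r: "pp_map n (pp_mat n D w) j \<in> {1..n}" .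
    have "pp_mat n D w $$ (pp_map n (pp_mat n D w) j - 1, j - 1) = 1" using pp_map_eq[OF t r j(1)] by blast
    thus "j \<in> D" using r j(1) by (subst (asm) pp_mat_index) (auto split: if_splits)
  qed
qed

section \<open>The words of the two tableaux\<close>

definition word1 :: "nat \<Rightarrow> nat set \<Rightarrow> (nat \<Rightarrow> nat) \<Rightarrow> nat list" where
  "word1 n D w = map w (sorted_list_of_set D) @ rev (sorted_list_of_set ({1..n} - w ` D))"

text \<open>Transposing turns column insertion into row insertion, so row inserting this word forms
  the transpose of the second tableau. Its first part is the reversed inverse word of
  \<open>w\<close>, as \<open>RS_word_transpose\<close> requires.\<close>

definition word2 :: "nat \<Rightarrow> nat set \<Rightarrow> (nat \<Rightarrow> nat) \<Rightarrow> nat list" where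
  "word2 n D w = rev (sort_key w (sorted_list_of_set D)) @ sorted_list_of_set ({1..n} - D)"

lemma RS_RS_word: "RS D w = RS_word w (sorted_list_of_set D)"
  unfolding RS_def RS_word_def ..

lemma finite_pp_data: "pp_data n D w \<Longrightarrow> finite D"
  unfolding pp_data_def using finite_subset by blast

lemma RS1_eq: "pp_data n D w \<Longrightarrow> RS1 D w = ptab (map w (sorted_list_of_set D))"
  unfolding RS1_def RS_RS_word using RS_word_invariant[of "sorted_list_of_set D" w] finite_pp_data[of n D w] by (simp add: pp_data_def)

lemma RS2_eq: "pp_data n D w \<Longrightarrow> RS2 D w = List.transpose (ptab (rev (sort_key w (sorted_list_of_set D))))"
  unfolding RS2_def RS_RS_word using RS_word_transpose[of "sorted_list_of_set D" w] finite_pp_data[of n D w] by (simp add: pp_data_def)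

lemma foldl_ptab: "foldl row_insert (ptab u) v = ptab (u @ v)"
  unfolding ptab_def by simp

lemma foldl_column_insert:
  assumes "distinct (u @ v)"
  shows "foldl (\<lambda>T m. column_insert m T) (List.transpose (ptab u)) v = List.transpose (ptab (u @ v))"
  using assms
proof (induct v rule: rev_induct)
  case (snoc a v)
  have "rows_tableau (ptab (u @ v))" using ptab_tableau(1)[of "u @ v"] snoc.prems unfolding tableau_def by auto
  moreover have "ptab (u @ v @ [a]) = row_insert (ptab (u @ v)) a" using ptab_snoc[of "u @ v" a] by simp
  ultimately show ?case using snoc by (simp add: column_insert_def transpose_transpose_rows_tableau)
qed simp

lemma distinct_words:
  assumes p: "pp_data n D w"
  shows "distinct (word1 n D w)" "set (word1 n D w) = {1..n}" "distinct (word2 n D w)" "set (word2 n D w) = {1..n}"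
  using p finite_pp_data[OF p] unfolding word1_def word2_def pp_data_def by (auto simp: distinct_map)

definition ins_T1 :: "nat \<Rightarrow> nat set \<Rightarrow> (nat \<Rightarrow> nat) \<Rightarrow> nat list list" where
  "ins_T1 n D w = foldl row_insert (RS1 D w) (rev (sorted_list_of_set ({1..n} - w ` D)))"

definition ins_T2 :: "nat \<Rightarrow> nat set \<Rightarrow> (nat \<Rightarrow> nat) \<Rightarrow> nat list list" where
  "ins_T2 n D w = foldl (\<lambda>T m. column_insert m T) (RS2 D w) (sorted_list_of_set ({1..n} - D))"

lemma T1_ins_T1: "T1 n \<tau> = ins_T1 n (pp_dom n \<tau>) (pp_map n \<tau>)"
  unfolding T1_def ins_T1_def pp_img_def ..

lemma T2_ins_T2: "T2 n \<tau> = ins_T2 n (pp_dom n \<tau>) (pp_map n \<tau>)"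
  unfolding T2_def ins_T2_def ..

lemma RS_cong: "finite D \<Longrightarrow> (\<And>j. j \<in> D \<Longrightarrow> w j = w' j) \<Longrightarrow> RS D w = RS D w'"
  unfolding RS_RS_word by (rule RS_word_cong) auto

lemma tableaux_pp_mat:
  assumes p: "pp_data n D w"
  shows "T1 n (pp_mat n D w) = ins_T1 n D w" "T2 n (pp_mat n D w) = ins_T2 n D w" "nu n (pp_mat n D w) = shape (RS1 D w)"
proof -
  note m = pp_mat_pp_map[OF p]
  have RS: "RS D (pp_map n (pp_mat n D w)) = RS D w" by (rule RS_cong[OF finite_pp_data[OF p]]) (rule m(2))
  have im: "pp_map n (pp_mat n D w) ` D = w ` D" using m(2) by (simp cong: image_cong)
  show "T1 n (pp_mat n D w) = ins_T1 n D w" "T2 n (pp_mat n D w) = ins_T2 n D w" "nu n (pp_mat n D w) = shape (RS1 D w)"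
    unfolding T1_ins_T1 T2_ins_T2 ins_T1_def ins_T2_def nu_def m(1) RS1_def RS2_def RS im by simp_all
qed

lemma ins_T1_eq: "pp_data n D w \<Longrightarrow> ins_T1 n D w = ptab (word1 n D w)"
  unfolding ins_T1_def word1_def using RS1_eq foldl_ptab by metis

lemma ins_T2_eq: "pp_data n D w \<Longrightarrow> ins_T2 n D w = List.transpose (ptab (word2 n D w))"
  unfolding ins_T2_def word2_def using RS2_eq foldl_column_insert distinct_words(3)[unfolded word2_def] by metis

lemma standard_ins_T1: "pp_data n D w \<Longrightarrow> standard_tableau n (ins_T1 n D w)"
  unfolding standard_tableau_iff ins_T1_eq using ptab_tableau distinct_words by metis

lemma standard_ins_T2: "pp_data n D w \<Longrightarrow> standard_tableau n (ins_T2 n D w)"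
  unfolding standard_tableau_iff ins_T2_eq
  using ptab_tableau distinct_words(3,4) tableau_transpose entries_transpose unfolding tableau_def by metis

lemma RS_tableaux:
  assumes p: "pp_data n D w"
  shows "tableau (RS1 D w)" "entries (RS1 D w) = w ` D" "tableau (RS2 D w)" "entries (RS2 D w) = D" "row_len (RS2 D w) = row_len (RS1 D w)"
proof -
  have D: "finite D" by (rule finite_pp_data[OF p])
  have d: "distinct (map w (sorted_list_of_set D))" using D p by (auto simp: distinct_map pp_data_def)
  note I = RS_word_invariant[of "sorted_list_of_set D" w]
  have I: "fst (RS D w) = ptab (map w (sorted_list_of_set D)) \<and> tableau (snd (RS D w)) \<and> entries (snd (RS D w)) = D \<and>
    row_len (snd (RS D w)) = row_len (ptab (map w (sorted_list_of_set D)))"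
    using I D p unfolding RS_RS_word pp_data_def by simp
  thus "tableau (RS1 D w)" "entries (RS1 D w) = w ` D" "tableau (RS2 D w)" "entries (RS2 D w) = D" "row_len (RS2 D w) = row_len (RS1 D w)"
    using ptab_tableau[OF d] D unfolding RS1_def RS2_def by auto
qed

lemma ins_T1_strip:
  assumes p: "pp_data n D w"
  shows "sorted_wrt (\<lambda>a b. b < a) (rev (sorted_list_of_set ({1..n} - w ` D)))"
    "set (rev (sorted_list_of_set ({1..n} - w ` D))) \<inter> entries (RS1 D w) = {}"
  using RS_tableaux(2)[OF p] by (auto simp: sorted_wrt_rev)

lemma ins_T2_strip:
  assumes p: "pp_data n D w"
  shows "sorted_wrt (<) (sorted_list_of_set ({1..n} - D))" "set (sorted_list_of_set ({1..n} - D)) \<inter> entries (RS2 D w) = {}"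
  using RS_tableaux(4)[OF p] by auto

section \<open>The bijection with triples\<close>

lemma triple_in_Upsilon:
  assumes p: "pp_data n D w"
  shows "(ins_T1 n D w, ins_T2 n D w, shape (RS1 D w)) \<in> Upsilon n (card D)"
proof -
  have s: "standard_tableau n (ins_T1 n D w)" "standard_tableau n (ins_T2 n D w)" using standard_ins_T1[OF p] standard_ins_T2[OF p] by auto
  have "shape (ins_T1 n D w) \<in> partitions n" "shape (ins_T2 n D w) \<in> partitions n"
    using s shape_partition[of "ins_T1 n D w"] shape_partition[of "ins_T2 n D w"] unfolding standard_tableau_iff by auto
  moreover have "shape (RS1 D w) \<in> partitions (card D)"
    using shape_partition[OF RS_tableaux(1)[OF p]] RS_tableaux(2)[OF p] p by (auto simp: pp_data_def card_image)
  moreover have "row_len (RS1 D w) i \<le> row_len (ins_T1 n D w) i \<and> row_len (ins_T1 n D w) i \<le> Suc (row_len (RS1 D w) i)" for i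
    using row.foldl_ins[OF RS_tableaux(1)[OF p] ins_T1_strip[OF p]] unfolding ins_T1_def by blast
  moreover have "row_len (RS1 D w) i \<le> row_len (ins_T2 n D w) i \<and> row_len (ins_T2 n D w) i \<le> Suc (row_len (RS1 D w) i)" for i
    using col.foldl_ins[OF RS_tableaux(3)[OF p] ins_T2_strip[OF p]] unfolding ins_T2_def RS_tableaux(5)[OF p] by blast
  ultimately show ?thesis
    using s unfolding Upsilon_def diagram_subset column_strip_iff row_len_part by auto
qed

text \<open>The common shape fixes where both strips start, so each sequence of insertions can be
  undone. This returns the Robinson-Schensted pair, whose recording tableau has the domain as its
  entries.\<close>

lemma triple_inj:
  assumes p: "pp_data n D w" and p': "pp_data n D' w'"
    and e: "ins_T1 n D w = ins_T1 n D' w'" "ins_T2 n D w = ins_T2 n D' w'" "shape (RS1 D w) = shape (RS1 D' w')"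
  shows "D = D' \<and> (\<forall>j\<in>D. w j = w' j)"
proof -
  have row_len: "row_len (RS1 D w) = row_len (RS1 D' w')" using e(3) by (simp add: row_len_part)
  have 1: "RS1 D w = RS1 D' w'"
    using row.foldl_ins_inj[OF RS_tableaux(1)[OF p] ins_T1_strip[OF p] RS_tableaux(1)[OF p'] ins_T1_strip[OF p'] e(1)[unfolded ins_T1_def] row_len] by blast
  have rl2: "row_len (RS2 D w) = row_len (RS2 D' w')" using row_len RS_tableaux(5)[OF p] RS_tableaux(5)[OF p'] by simp
  have 2: "RS2 D w = RS2 D' w'"
    using col.foldl_ins_inj[OF RS_tableaux(3)[OF p] ins_T2_strip[OF p] RS_tableaux(3)[OF p'] ins_T2_strip[OF p'] e(2)[unfolded ins_T2_def] rl2] by blast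
  hence D: "D = D'" using RS_tableaux(4)[OF p] RS_tableaux(4)[OF p'] by simp
  have "RS D w = RS D w'" using 1 2 unfolding D RS1_def RS2_def by (rule prod_eqI)
  hence "\<forall>j\<in>D. w j = w' j"
    using RS_word_inj[of "sorted_list_of_set D" w w'] p p' finite_pp_data[OF p] unfolding RS_RS_word D pp_data_def by auto
  thus ?thesis using D by blast
qed

lemma triple_surj:
  assumes "(U1, U2, \<nu>) \<in> Upsilon n r"
  shows "\<exists>D w. pp_data n D w \<and> ins_T1 n D w = U1 \<and> ins_T2 n D w = U2 \<and> shape (RS1 D w) = \<nu>"
proof -
  have U: "tableau U1" "entries U1 = {1..n}" "tableau U2" "entries U2 = {1..n}" and \<nu>: "\<nu> \<in> partitions r"
    and s: "\<And>i. part \<nu> i \<le> row_len U1 i" "\<And>i. row_len U1 i \<le> Suc (part \<nu> i)" "\<And>i. part \<nu> i \<le> row_len U2 i" "\<And>i. row_len U2 i \<le> Suc (part \<nu> i)"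
    using assms unfolding Upsilon_def standard_tableau_iff diagram_subset column_strip_iff row_len_part by auto
  obtain P l where P: "tableau P" "row_len P = part \<nu>" "sorted_wrt (\<lambda>a b. b < a) l" "set l \<inter> entries P = {}" "foldl row_insert P l = U1"
    using row.foldl_ins_surj[OF U(1) partitions_part_antimono[OF \<nu>] s(1,2)] by blast
  obtain Q m where Q: "tableau Q" "row_len Q = part \<nu>" "sorted_wrt (<) m" "set m \<inter> entries Q = {}" "foldl (\<lambda>T m. column_insert m T) Q m = U2"
    using col.foldl_ins_surj[OF U(3) partitions_part_antimono[OF \<nu>] s(3,4)] by blast
  have eP: "entries P \<union> set l = {1..n}" using row.foldl_ins[OF P(1,3,4)] P(5) U(2) by simp
  have eQ: "entries Q \<union> set m = {1..n}" using col.foldl_ins[OF Q(1,3,4)] Q(5) U(4) by simp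
  \<comment> \<open>The recording tableau carries the domain as its entries, the insertion tableau
    the image.\<close>
  define D where "D = entries Q"
  have D: "D \<subseteq> {1..n}" "finite D" using eQ finite_subset[of "entries Q" "{1..n}"] unfolding D_def by auto
  obtain w where w: "inj_on w D" "RS D w = (P, Q)"
    using RS_word_surj[of "sorted_list_of_set D" P Q] P(1,2) Q(1,2) D(2) unfolding RS_RS_word D_def by auto
  have im: "w ` D = entries P"
  proof -
    have d: "distinct (map w (sorted_list_of_set D))" using w(1) D by (simp add: distinct_map)
    have "P = ptab (map w (sorted_list_of_set D))" using RS_word_invariant[of "sorted_list_of_set D" w] w D unfolding RS_RS_word by simp
    thus ?thesis using ptab_tableau(2)[OF d] D by simp
  qed
  have p: "pp_data n D w" unfolding pp_data_def using D w(1) im eP by auto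
  have RS: "RS1 D w = P" "RS2 D w = Q" unfolding RS1_def RS2_def using w(2) by auto
  have sl: "sorted_wrt (<) (rev l)" using P(3) by (simp add: sorted_wrt_rev)
  \<comment> \<open>A strictly monotone list is determined by its set, so the letters found are
    those prescribed, in the prescribed order.\<close>
  have "set (rev l) = {1..n} - w ` D" unfolding im using eP P(4) by auto
  hence "rev l = sorted_list_of_set ({1..n} - w ` D)"
    using sorted_list_of_set.idem_if_sorted_distinct[of "rev l"] sl by (simp add: strict_sorted_iff)
  hence l: "l = rev (sorted_list_of_set ({1..n} - w ` D))" by (metis rev_rev_ident)
  have "set m = {1..n} - D" unfolding D_def using eQ Q(4) by auto
  hence m: "m = sorted_list_of_set ({1..n} - D)"
    using sorted_list_of_set.idem_if_sorted_distinct[of m] Q(3) by (simp add: strict_sorted_iff)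
  have "shape P = \<nu>"
  proof (rule part_inj)
    show "0 \<notin> set (shape P)" using P(1) unfolding shape_def tableau_def rows_tableau_iff by auto
    show "0 \<notin> set \<nu>" using partitionsD[OF \<nu>] by simp
    show "part (shape P) = part \<nu>" using P(2) by (simp add: row_len_part)
  qed
  thus ?thesis using p P(5) Q(5) RS l m unfolding ins_T1_def ins_T2_def by blast
qed

lemma bij_triples: "bij_betw (\<lambda>\<tau>. (T1 n \<tau>, T2 n \<tau>, nu n \<tau>)) (partial_perms n) (\<Union>r\<in>{0..n}. Upsilon n r)"
  unfolding bij_betw_def
proof (intro conjI inj_onI equalityI subsetI)
  fix \<tau> \<tau>' assume t: "\<tau> \<in> partial_perms n" "\<tau>' \<in> partial_perms n"
    and e: "(T1 n \<tau>, T2 n \<tau>, nu n \<tau>) = (T1 n \<tau>', T2 n \<tau>', nu n \<tau>')"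
  have "pp_dom n \<tau> = pp_dom n \<tau>' \<and> (\<forall>j\<in>pp_dom n \<tau>. pp_map n \<tau> j = pp_map n \<tau>' j)"
    using triple_inj[OF pp_pp_data[OF t(1)] pp_pp_data[OF t(2)]] e unfolding T1_ins_T1 T2_ins_T2 nu_def by simp
  hence "pp_mat n (pp_dom n \<tau>) (pp_map n \<tau>) = pp_mat n (pp_dom n \<tau>') (pp_map n \<tau>')"
    unfolding pp_mat_def by (intro eq_matI) auto
  thus "\<tau> = \<tau>'" using pp_mat_pp[OF t(1)] pp_mat_pp[OF t(2)] by simp
next
  fix x assume "x \<in> (\<lambda>\<tau>. (T1 n \<tau>, T2 n \<tau>, nu n \<tau>)) ` partial_perms n"
  then obtain \<tau> where t: "\<tau> \<in> partial_perms n" "x = (T1 n \<tau>, T2 n \<tau>, nu n \<tau>)" by blast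
  note p = pp_pp_data[OF t(1)]
  have "card (pp_dom n \<tau>) \<le> card {1..n}" using p unfolding pp_data_def by (intro card_mono) auto
  thus "x \<in> (\<Union>r\<in>{0..n}. Upsilon n r)" using triple_in_Upsilon[OF p] unfolding t(2) T1_ins_T1 T2_ins_T2 nu_def by auto
next
  fix x assume "x \<in> (\<Union>r\<in>{0..n}. Upsilon n r)"
  then obtain r U1 U2 \<nu> where x: "x = (U1, U2, \<nu>)" "(U1, U2, \<nu>) \<in> Upsilon n r" by (cases x) auto
  obtain D w where p: "pp_data n D w" "ins_T1 n D w = U1" "ins_T2 n D w = U2" "shape (RS1 D w) = \<nu>" using triple_surj[OF x(2)] by blast
  show "x \<in> (\<lambda>\<tau>. (T1 n \<tau>, T2 n \<tau>, nu n \<tau>)) ` partial_perms n"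
    by (rule image_eqI[OF _ pp_mat_in_partial_perms[OF p(1)]]) (use p x tableaux_pp_mat[OF p(1)] in simp)
qed

lemma permutation_case:
  assumes "w permutes {1..n}"
  shows "perm_mat n w \<in> partial_perms n \<and>
        T1 n (perm_mat n w) = RS1 {1..n} w \<and>
        T2 n (perm_mat n w) = RS2 {1..n} w \<and>
        nu n (perm_mat n w) = shape (RS1 {1..n} w) \<and>
        shape (RS1 {1..n} w) = shape (RS2 {1..n} w) \<and>
        (T1 n (perm_mat n w), T2 n (perm_mat n w), nu n (perm_mat n w)) \<in> Upsilon n n"
proof -
  have im: "w ` {1..n} = {1..n}" by (rule permutes_image[OF assms])
  have p: "pp_data n {1..n} w" unfolding pp_data_def using im permutes_inj_on[OF assms] by auto
  have m: "perm_mat n w = pp_mat n {1..n} w" unfolding perm_mat_def pp_mat_def by (intro eq_matI) auto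
  \<comment> \<open>Domain and image are full, so nothing is inserted after the Robinson-Schensted
    pair.\<close>
  have T: "ins_T1 n {1..n} w = RS1 {1..n} w" "ins_T2 n {1..n} w = RS2 {1..n} w" unfolding ins_T1_def ins_T2_def im by auto
  have "shape (RS1 {1..n} w) = shape (RS2 {1..n} w)"
    using shape_eqI[of "RS1 {1..n} w" "RS2 {1..n} w"] RS_tableaux[OF p] unfolding tableau_def by simp
  thus ?thesis unfolding m using tableaux_pp_mat[OF p] pp_mat_in_partial_perms[OF p] triple_in_Upsilon[OF p] T by simp
qed

section \<open>The generalized Steinberg map\<close>

lemma before_sorted:
  assumes "sorted_wrt R l" "x \<in> set l" "y \<in> set l" "\<And>x y. x \<in> set l \<Longrightarrow> y \<in> set l \<Longrightarrow> R x y \<Longrightarrow> \<not> R y x"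
  shows "before l x y \<longleftrightarrow> R x y"
proof
  assume "before l x y" thus "R x y" using assms(1) unfolding before_def by (auto simp: sorted_wrt_nth_less)
next
  assume r: "R x y"
  obtain p q where pq: "p < length l" "l ! p = x" "q < length l" "l ! q = y" using assms(2,3) by (metis in_set_conv_nth)
  have "\<not> q < p" using sorted_wrt_nth_less[OF assms(1), of q p] pq assms(2,3,4) r by auto
  moreover have "p \<noteq> q" using pq r assms(2,4) by auto
  ultimately show "before l x y" unfolding before_def using pq by (intro exI[of _ p] exI[of _ q]) auto
qed

lemma before_set: "before l x y \<Longrightarrow> x \<in> set l \<and> y \<in> set l"
  unfolding before_def by auto

lemma before_append:
  assumes "set u \<inter> set v = {}"
  shows "before (u @ v) x y \<longleftrightarrow> before u x y \<or> before v x y \<or> x \<in> set u \<and> y \<in> set v"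
proof
  assume "before (u @ v) x y"
  then obtain p q where pq: "p < q" "q < length u + length v" "(u @ v) ! p = x" "(u @ v) ! q = y" unfolding before_def by auto
  show "before u x y \<or> before v x y \<or> x \<in> set u \<and> y \<in> set v"
  proof (cases "q < length u")
    case True thus ?thesis using pq unfolding before_def by (auto simp: nth_append)
  next
    case False
    show ?thesis
    proof (cases "p < length u")
      case True thus ?thesis using pq False by (auto simp: nth_append)
    next
      case False
      hence "p - length u < q - length u \<and> q - length u < length v \<and> v ! (p - length u) = x \<and> v ! (q - length u) = y"
        using pq by (auto simp: nth_append)
      thus ?thesis unfolding before_def by blast
    qed
  qed
qed (auto intro: before_append1 before_append2 before_append12)

text \<open>\<open>word_rel\<close> with positions replaced by letters, lowered by one to become
  matrix indices.\<close>

definition value_rel :: "nat list \<Rightarrow> (nat \<times> nat) set" where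
  "value_rel w = {(i, k). i < k \<and> before w (Suc i) (Suc k)}"

lemma generic_type_value_rel:
  assumes w: "distinct w" "set w = {1..n}" and g: "word_type w p"
  shows "generic_type n (value_rel w) p"
proof -
  have len: "length w = n" using w by (metis card_atLeastAtMost diff_Suc_1 distinct_card)
  have wn: "w ! p \<in> {1..n}" if "p < n" for p using w(2) len that nth_mem by metis
  have bij: "bij_betw (\<lambda>p. w ! p - 1) {..<n} {..<n}"
  proof -
    have "inj_on (\<lambda>p. w ! p - 1) {..<n}"
    proof (rule inj_onI)
      fix p q assume pq: "p \<in> {..<n}" "q \<in> {..<n}" "w ! p - 1 = w ! q - 1"
      hence "w ! p = w ! q" using wn[of p] wn[of q] by auto
      thus "p = q" using w(1) len pq by (simp add: nth_eq_iff_index_eq)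
    qed
    moreover have "(\<lambda>p. w ! p - 1) ` {..<n} \<subseteq> {..<n}" using wn by fastforce
    ultimately show ?thesis by (simp add: bij_betw_def endo_inj_surj)
  qed
  have bef: "before w (w ! p) (w ! q) \<longleftrightarrow> p < q" if "p < n" "q < n" for p q
  proof
    assume "before w (w ! p) (w ! q)"
    then obtain p' q' where "p' < q'" "q' < n" "w ! p' = w ! p" "w ! q' = w ! q" unfolding before_def len by auto
    thus "p < q" using w(1) len that by (simp add: nth_eq_iff_index_eq)
  qed (use that len in \<open>auto simp: before_def\<close>)
  show ?thesis
  proof (rule generic_type_relabel[OF _ bij])
    show "generic_type n (word_rel w) p" using g len unfolding word_type_def by simp
    fix p q assume pq: "p < n" "q < n"
    have S: "Suc (w ! p - 1) = w ! p" "Suc (w ! q - 1) = w ! q" using wn[OF pq(1)] wn[OF pq(2)] by auto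
    hence "w ! p - 1 < w ! q - 1 \<longleftrightarrow> w ! p < w ! q" by linarith
    thus "(p, q) \<in> word_rel w \<longleftrightarrow> (w ! p - 1, w ! q - 1) \<in> value_rel w"
      unfolding word_rel_def value_rel_def using S bef[OF pq] pq len by auto
  qed
qed

text \<open>The letters outside the image come last and decreasing: none of them starts a
  non-inversion, and each ends one with every smaller letter of the image. For these
  \<open>k\<close> the condition on \<open>b\<close> is vacuous.\<close>

lemma value_rel_word1:
  assumes p: "pp_data n D w"
  shows "(i, k) \<in> value_rel (word1 n D w) \<longleftrightarrow>
    i < k \<and> k < n \<and> (\<exists>a\<in>D. w a = Suc i \<and> (\<forall>b\<in>D. w b = Suc k \<longrightarrow> a < b))"
proof -
  let ?u = "map w (sorted_list_of_set D)" and ?v = "rev (sorted_list_of_set ({1..n} - w ` D))"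
  have D: "finite D" by (rule finite_pp_data[OF p])
  have inj: "inj_on w D" and im: "w ` D \<subseteq> {1..n}" using p unfolding pp_data_def by auto
  have su: "set ?u = w ` D" and sv: "set ?v = {1..n} - w ` D" using D by auto
  define R where "R = (\<lambda>x y. \<exists>a\<in>D. \<exists>b\<in>D. x = w a \<and> y = w b \<and> a < b)"
  have R: "R (w a) (w b) \<longleftrightarrow> a < b" if "a \<in> D" "b \<in> D" for a b
    using that inj unfolding R_def inj_on_def by metis
  have "sorted_wrt R ?u"
    unfolding sorted_wrt_map by (rule sorted_wrt_mono_rel[of _ "(<)"]) (use D R in auto)
  hence bu: "before ?u (w a) (w b) \<longleftrightarrow> a < b" if "a \<in> D" "b \<in> D" for a b
    using before_sorted[of R ?u "w a" "w b"] R that su by fastforce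
  have bv: "before ?v x y \<longleftrightarrow> y < x" if "x \<in> set ?v" "y \<in> set ?v" for x y
    by (rule before_sorted[where R = "\<lambda>x y. y < x"]) (use that in \<open>auto simp: sorted_wrt_rev\<close>)
  have ba: "before (word1 n D w) x y \<longleftrightarrow> before ?u x y \<or> before ?v x y \<or> x \<in> set ?u \<and> y \<in> set ?v" for x y
    unfolding word1_def by (rule before_append) (use su sv in auto)
  show ?thesis
  proof
    assume r: "(i, k) \<in> value_rel (word1 n D w)"
    hence ik: "i < k" and b: "before (word1 n D w) (Suc i) (Suc k)" unfolding value_rel_def by auto
    have kn: "k < n" using before_set[OF b] distinct_words(2)[OF p] by auto
    have "\<not> before ?v (Suc i) (Suc k)" using bv before_set ik by (metis Suc_less_eq less_asym)
    hence c: "before ?u (Suc i) (Suc k) \<or> Suc i \<in> set ?u \<and> Suc k \<in> set ?v" using b ba by blast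
    hence "Suc i \<in> w ` D" using before_set[of ?u "Suc i" "Suc k"] su by auto
    then obtain a where a: "a \<in> D" "w a = Suc i" by (metis imageE)
    have "a < b" if bb: "b \<in> D" "w b = Suc k" for b
    proof -
      have "Suc k \<notin> set ?v" using bb sv by (metis DiffD2 image_eqI)
      hence "before ?u (Suc i) (Suc k)" using c by blast
      hence "before ?u (w a) (w b)" unfolding a(2) bb(2) .
      thus ?thesis using bu a bb by blast
    qed
    thus "i < k \<and> k < n \<and> (\<exists>a\<in>D. w a = Suc i \<and> (\<forall>b\<in>D. w b = Suc k \<longrightarrow> a < b))" using ik kn a by blast
  next
    assume r: "i < k \<and> k < n \<and> (\<exists>a\<in>D. w a = Suc i \<and> (\<forall>b\<in>D. w b = Suc k \<longrightarrow> a < b))"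
    then obtain a where a: "a \<in> D" "w a = Suc i" "\<forall>b\<in>D. w b = Suc k \<longrightarrow> a < b" by blast
    have "before (word1 n D w) (Suc i) (Suc k)"
    proof (cases "Suc k \<in> w ` D")
      case True
      then obtain b where b: "b \<in> D" "w b = Suc k" by (metis imageE)
      hence "before ?u (w a) (w b)" using bu a by blast
      thus ?thesis using ba a b by simp
    next
      case False
      hence "Suc k \<in> set ?v" using sv r by auto
      moreover have "Suc i \<in> set ?u" using su a by (metis image_eqI)
      ultimately show ?thesis using ba by blast
    qed
    thus "(i, k) \<in> value_rel (word1 n D w)" using r unfolding value_rel_def by simp
  qed
qed

text \<open>In the reversed word the indices outside the domain come first and decreasing: none of
  them ends a non-inversion, and each starts one with every larger index of the domain. For these
  \<open>i\<close> the implication is vacuous.\<close>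

lemma value_rel_word2:
  assumes p: "pp_data n D w"
  shows "(i, k) \<in> value_rel (rev (word2 n D w)) \<longleftrightarrow>
    i < k \<and> k < n \<and> Suc k \<in> D \<and> (Suc i \<in> D \<longrightarrow> w (Suc i) < w (Suc k))"
proof -
  let ?u = "rev (sorted_list_of_set ({1..n} - D))" and ?v = "sort_key w (sorted_list_of_set D)"
  have D: "finite D" by (rule finite_pp_data[OF p])
  have inj: "inj_on w D" and Dn: "D \<subseteq> {1..n}" using p unfolding pp_data_def by auto
  have su: "set ?u = {1..n} - D" and sv: "set ?v = D" using D by auto
  have "sorted (map w ?v)" by simp
  moreover have "distinct (map w ?v)" using D inj by (simp add: distinct_map)
  ultimately have "sorted_wrt (\<lambda>x y. w x < w y) ?v" using strict_sorted_iff[of "map w ?v"] by (simp add: sorted_wrt_map)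
  hence bv: "before ?v a b \<longleftrightarrow> w a < w b" if "a \<in> D" "b \<in> D" for a b
    using before_sorted[of "\<lambda>x y. w x < w y" ?v a b] that sv by fastforce
  have bu: "before ?u x y \<longleftrightarrow> y < x" if "x \<in> set ?u" "y \<in> set ?u" for x y
    by (rule before_sorted[where R = "\<lambda>x y. y < x"]) (use that in \<open>auto simp: sorted_wrt_rev\<close>)
  have "rev (word2 n D w) = ?u @ ?v" unfolding word2_def by simp
  hence ba: "before (rev (word2 n D w)) x y \<longleftrightarrow> before ?u x y \<or> before ?v x y \<or> x \<in> set ?u \<and> y \<in> set ?v" for x y
    using before_append[of ?u ?v x y] su sv by auto
  show ?thesis
  proof
    assume r: "(i, k) \<in> value_rel (rev (word2 n D w))"
    hence ik: "i < k" and b: "before (rev (word2 n D w)) (Suc i) (Suc k)" unfolding value_rel_def by auto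
    have kn: "k < n" using before_set[OF b] distinct_words(4)[OF p] by auto
    have "\<not> before ?u (Suc i) (Suc k)" using bu before_set ik by (metis Suc_less_eq less_asym)
    hence c: "before ?v (Suc i) (Suc k) \<or> Suc i \<in> set ?u \<and> Suc k \<in> set ?v" using b ba by blast
    have "Suc k \<in> D" using c before_set sv by metis
    moreover have "w (Suc i) < w (Suc k)" if "Suc i \<in> D"
      using c bv[OF that \<open>Suc k \<in> D\<close>] that su by auto
    ultimately show "i < k \<and> k < n \<and> Suc k \<in> D \<and> (Suc i \<in> D \<longrightarrow> w (Suc i) < w (Suc k))" using ik kn by blast
  next
    assume r: "i < k \<and> k < n \<and> Suc k \<in> D \<and> (Suc i \<in> D \<longrightarrow> w (Suc i) < w (Suc k))"
    have "before (rev (word2 n D w)) (Suc i) (Suc k)"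
    proof (cases "Suc i \<in> D")
      case True thus ?thesis using ba bv r by blast
    next
      case False
      hence "Suc i \<in> set ?u" using su r by auto
      thus ?thesis using ba r sv by blast
    qed
    thus "(i, k) \<in> value_rel (rev (word2 n D w))" using r unfolding value_rel_def by simp
  qed
qed

text \<open>By \<open>B \<times> B\<close>-equivariance it suffices to look at the fibre of the conormal variety over \<open>\<tau>\<close>.\<close>

definition conormal_fibre :: "nat \<Rightarrow> complex mat \<Rightarrow> complex mat set" where
  "conormal_fibre n \<tau> = {y \<in> carrier_mat n n. \<tau> * y \<in> strictly_upper n \<and> y * \<tau> \<in> strictly_upper n}"

lemma pp_mat_mult_left:
  assumes p: "pp_data n D w" and Y: "Y \<in> carrier_mat n n" and ik: "i < n" "k < n"
  shows "a \<in> D \<Longrightarrow> w a = Suc i \<Longrightarrow> (pp_mat n D w * Y) $$ (i, k) = Y $$ (a - 1, k)"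
    "Suc i \<notin> w ` D \<Longrightarrow> (pp_mat n D w * Y) $$ (i, k) = 0"
proof -
  have e: "(pp_mat n D w * Y) $$ (i, k) = (\<Sum>l<n. pp_mat n D w $$ (i, l) * Y $$ (l, k))"
    by (rule mat_mult_index[OF pp_mat_carrier Y ik])
  { assume a: "a \<in> D" "w a = Suc i"
    have an: "a \<in> {1..n}" using a p unfolding pp_data_def by auto
    have "(\<Sum>l<n. pp_mat n D w $$ (i, l) * Y $$ (l, k)) = (\<Sum>l<n. if l = a - 1 then Y $$ (l, k) else 0)"
    proof (rule sum.cong)
      fix l assume "l \<in> {..<n}"
      moreover have "Suc l \<in> D \<and> w (Suc l) = Suc i \<longleftrightarrow> l = a - 1"
      proof
        assume "Suc l \<in> D \<and> w (Suc l) = Suc i"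
        hence "Suc l = a" using p a unfolding pp_data_def inj_on_def by metis
        thus "l = a - 1" by auto
      qed (use a an in auto)
      ultimately show "pp_mat n D w $$ (i, l) * Y $$ (l, k) = (if l = a - 1 then Y $$ (l, k) else 0)"
        using ik by (auto simp: pp_mat_index)
    qed simp
    also have "\<dots> = Y $$ (a - 1, k)" using an by auto
    finally show "(pp_mat n D w * Y) $$ (i, k) = Y $$ (a - 1, k)" using e by simp }
  { assume "Suc i \<notin> w ` D"
    hence "pp_mat n D w $$ (i, l) = 0" if "l < n" for l using ik that by (auto simp: pp_mat_index) (metis image_eqI)
    thus "(pp_mat n D w * Y) $$ (i, k) = 0" using e by simp }
qed

lemma pp_mat_mult_right:
  assumes p: "pp_data n D w" and Y: "Y \<in> carrier_mat n n" and ik: "i < n" "k < n"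
  shows "(Y * pp_mat n D w) $$ (i, k) = (if Suc k \<in> D then Y $$ (i, w (Suc k) - 1) else 0)"
proof -
  have "(Y * pp_mat n D w) $$ (i, k) = (\<Sum>l<n. Y $$ (i, l) * pp_mat n D w $$ (l, k))"
    by (rule mat_mult_index[OF Y pp_mat_carrier ik])
  also have "\<dots> = (\<Sum>l<n. if l = w (Suc k) - 1 then (if Suc k \<in> D then Y $$ (i, l) else 0) else 0)"
  proof (rule sum.cong)
    fix l assume "l \<in> {..<n}"
    moreover have "w (Suc k) = Suc l \<longleftrightarrow> l = w (Suc k) - 1" if "Suc k \<in> D"
    proof -
      have "w (Suc k) \<in> {1..n}" using p that unfolding pp_data_def by auto
      thus ?thesis by auto
    qed
    ultimately show "Y $$ (i, l) * pp_mat n D w $$ (l, k) = (if l = w (Suc k) - 1 then (if Suc k \<in> D then Y $$ (i, l) else 0) else 0)"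
      using ik by (auto simp: pp_mat_index)
  qed simp
  also have "\<dots> = (if Suc k \<in> D then Y $$ (i, w (Suc k) - 1) else 0)"
  proof (cases "Suc k \<in> D")
    case True
    hence "w (Suc k) \<in> {1..n}" using p unfolding pp_data_def by auto
    thus ?thesis using True by auto
  qed simp
  finally show ?thesis .
qed

lemma strictly_upperD: "X \<in> strictly_upper n \<Longrightarrow> i < n \<Longrightarrow> k < n \<Longrightarrow> X $$ (i, k) \<noteq> 0 \<Longrightarrow> i < k"
  unfolding strictly_upper_def by (metis (mono_tags, lifting) mem_Collect_eq not_le)

lemma strictly_upperI: "X \<in> carrier_mat n n \<Longrightarrow> (\<And>i k. i < n \<Longrightarrow> k < n \<Longrightarrow> X $$ (i, k) \<noteq> 0 \<Longrightarrow> i < k) \<Longrightarrow> X \<in> strictly_upper n"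
  unfolding strictly_upper_def by (auto) (metis le_less_trans not_le)

lemma pp_data_pred:
  assumes "pp_data n D w" "a \<in> D"
  shows "a - 1 < n" "Suc (a - 1) = a" "w a - 1 < n" "Suc (w a - 1) = w a"
proof -
  have "a \<in> {1..n}" "w a \<in> {1..n}" using assms unfolding pp_data_def by auto
  thus "a - 1 < n" "Suc (a - 1) = a" "w a - 1 < n" "Suc (w a - 1) = w a" by auto
qed

text \<open>Both products show the same entry of \<open>Y\<close>: position
  \<open>(w a, w b)\<close> of \<open>\<tau> Y\<close> and position \<open>(a, b)\<close> of
  \<open>Y \<tau>\<close> hold \<open>Y\<close> at \<open>(a, w b)\<close>. If it is nonzero, strict
  triangularity of both products gives \<open>w a < w b\<close> and \<open>a < b\<close>.\<close>

lemma fibre_incidence: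
  assumes p: "pp_data n D w" and Y: "Y \<in> conormal_fibre n (pp_mat n D w)"
  shows "pp_mat n D w * Y \<in> incidence n (value_rel (word1 n D w))" "Y * pp_mat n D w \<in> incidence n (value_rel (rev (word2 n D w)))"
proof -
  let ?t = "pp_mat n D w"
  have Yc: "Y \<in> carrier_mat n n" and u1: "?t * Y \<in> strictly_upper n" and u2: "Y * ?t \<in> strictly_upper n"
    using Y unfolding conormal_fibre_def by auto
  note Dn = pp_data_pred[OF p]
  show "?t * Y \<in> incidence n (value_rel (word1 n D w))"
    unfolding incidence_def
  proof (intro CollectI conjI allI impI)
    show "?t * Y \<in> carrier_mat n n" using pp_mat_carrier Yc by (rule mult_carrier_mat)
    fix i k assume ik: "i < n" "k < n" "(?t * Y) $$ (i, k) \<noteq> 0"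
    have lt: "i < k" by (rule strictly_upperD[OF u1 ik])
    obtain a where a: "a \<in> D" "w a = Suc i" using pp_mat_mult_left(2)[OF p Yc ik(1,2)] ik(3) by (metis imageE)
    have Ya: "Y $$ (a - 1, k) \<noteq> 0" using pp_mat_mult_left(1)[OF p Yc ik(1,2) a] ik(3) by simp
    have "a < b" if b: "b \<in> D" "w b = Suc k" for b
    proof -
      have "(Y * ?t) $$ (a - 1, b - 1) = Y $$ (a - 1, k)"
        using pp_mat_mult_right[OF p Yc Dn(1)[OF a(1)] Dn(1)[OF b(1)]] Dn(2)[OF b(1)] b by simp
      hence "a - 1 < b - 1" using strictly_upperD[OF u2 Dn(1)[OF a(1)] Dn(1)[OF b(1)]] Ya by simp
      thus ?thesis by simp
    qed
    thus "(i, k) \<in> value_rel (word1 n D w)" unfolding value_rel_word1[OF p] using lt ik a by blast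
  qed
  show "Y * ?t \<in> incidence n (value_rel (rev (word2 n D w)))"
    unfolding incidence_def
  proof (intro CollectI conjI allI impI)
    show "Y * ?t \<in> carrier_mat n n" using Yc pp_mat_carrier by (rule mult_carrier_mat)
    fix i k assume ik: "i < n" "k < n" "(Y * ?t) $$ (i, k) \<noteq> 0"
    have lt: "i < k" by (rule strictly_upperD[OF u2 ik])
    have k: "Suc k \<in> D" and Yk: "Y $$ (i, w (Suc k) - 1) \<noteq> 0"
      using pp_mat_mult_right[OF p Yc ik(1,2)] ik(3) by (auto split: if_splits)
    have "w (Suc i) < w (Suc k)" if i: "Suc i \<in> D"
    proof -
      have "(?t * Y) $$ (w (Suc i) - 1, w (Suc k) - 1) = Y $$ (i, w (Suc k) - 1)"
        using pp_mat_mult_left(1)[OF p Yc Dn(3)[OF i] Dn(3)[OF k] i] Dn(4)[OF i] by simp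
      hence "w (Suc i) - 1 < w (Suc k) - 1" using strictly_upperD[OF u1 Dn(3)[OF i] Dn(3)[OF k]] Yk by simp
      thus ?thesis by simp
    qed
    thus "(i, k) \<in> value_rel (rev (word2 n D w))" unfolding value_rel_word2[OF p] using lt ik k by blast
  qed
qed

lemma incidence_fibre1:
  assumes p: "pp_data n D w" and M: "M \<in> incidence n (value_rel (word1 n D w))"
  shows "\<exists>Y\<in>conormal_fibre n (pp_mat n D w). pp_mat n D w * Y = M"
proof -
  let ?t = "pp_mat n D w"
  \<comment> \<open>Row \<open>j\<close> of \<open>Y\<close> is row \<open>w j\<close> of
    \<open>M\<close>. Rows off the domain are invisible to \<open>\<tau> Y\<close>, and setting them
    to 0 keeps \<open>Y \<tau>\<close> strictly upper triangular.\<close>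
  define Y where "Y = mat n n (\<lambda>(j, k). if Suc j \<in> D then M $$ (w (Suc j) - 1, k) else 0)"
  have Yc: "Y \<in> carrier_mat n n" unfolding Y_def by simp
  have Mc: "M \<in> carrier_mat n n" by (rule incidence_carrier[OF M])
  have Mnz: "i < k \<and> (\<exists>a\<in>D. w a = Suc i \<and> (\<forall>b\<in>D. w b = Suc k \<longrightarrow> a < b))" if "i < n" "k < n" "M $$ (i, k) \<noteq> 0" for i k
    using M that value_rel_word1[OF p] unfolding incidence_def by blast
  note Dn = pp_data_pred[OF p]
  have tY: "?t * Y = M"
  proof (rule eq_matI)
    fix i k assume "i < dim_row M" "k < dim_col M"
    hence ik: "i < n" "k < n" using Mc by auto
    show "(?t * Y) $$ (i, k) = M $$ (i, k)"
    proof (cases "Suc i \<in> w ` D")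
      case True
      then obtain a where a: "a \<in> D" "w a = Suc i" by (metis imageE)
      have "(?t * Y) $$ (i, k) = Y $$ (a - 1, k)" by (rule pp_mat_mult_left(1)[OF p Yc ik a])
      thus ?thesis using a Dn[OF a(1)] ik unfolding Y_def by simp
    next
      case False
      hence "M $$ (i, k) = 0" using Mnz[OF ik] by (metis image_eqI)
      thus ?thesis using pp_mat_mult_left(2)[OF p Yc ik False] by simp
    qed
  qed (use Mc Yc pp_mat_carrier[of n D w] in auto)
  have "?t * Y \<in> strictly_upper n" unfolding tY by (rule strictly_upperI[OF Mc]) (use Mnz in blast)
  moreover have "Y * ?t \<in> strictly_upper n"
  proof (rule strictly_upperI)
    show "Y * ?t \<in> carrier_mat n n" using Yc pp_mat_carrier by (rule mult_carrier_mat)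
    fix i k assume ik: "i < n" "k < n" "(Y * ?t) $$ (i, k) \<noteq> 0"
    hence k: "Suc k \<in> D" and Yk: "Y $$ (i, w (Suc k) - 1) \<noteq> 0"
      using pp_mat_mult_right[OF p Yc ik(1,2)] by (auto split: if_splits)
    have i: "Suc i \<in> D" and Mk: "M $$ (w (Suc i) - 1, w (Suc k) - 1) \<noteq> 0"
      using Yk ik(1) Dn(3)[OF k] unfolding Y_def by (auto split: if_splits)
    obtain a where a: "a \<in> D" "w a = w (Suc i)" "\<forall>b\<in>D. w b = w (Suc k) \<longrightarrow> a < b"
      using Mnz[OF Dn(3)[OF i] Dn(3)[OF k] Mk] unfolding Dn(4)[OF i] Dn(4)[OF k] by blast
    have "a = Suc i" using a(1,2) i p unfolding pp_data_def inj_on_def by blast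
    thus "i < k" using a(3) k by auto
  qed
  ultimately show ?thesis using tY Yc unfolding conormal_fibre_def by blast
qed

lemma incidence_fibre2:
  assumes p: "pp_data n D w" and M: "M \<in> incidence n (value_rel (rev (word2 n D w)))"
  shows "\<exists>Y\<in>conormal_fibre n (pp_mat n D w). Y * pp_mat n D w = M"
proof -
  let ?t = "pp_mat n D w"
  define v where "v = the_inv_into D w"
  \<comment> \<open>Column \<open>w j\<close> of \<open>Y\<close> is column \<open>j\<close> of
    \<open>M\<close>; columns off the image, which \<open>Y \<tau>\<close> does not see, are set to
    0.\<close>
  define Y where "Y = mat n n (\<lambda>(i, l). if Suc l \<in> w ` D then M $$ (i, v (Suc l) - 1) else 0)"
  have v: "v (w a) = a" if "a \<in> D" for a
    unfolding v_def by (rule the_inv_into_f_f) (use p that in \<open>auto simp: pp_data_def\<close>)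
  have Yc: "Y \<in> carrier_mat n n" unfolding Y_def by simp
  have Mc: "M \<in> carrier_mat n n" by (rule incidence_carrier[OF M])
  have Mnz: "i < k \<and> Suc k \<in> D \<and> (Suc i \<in> D \<longrightarrow> w (Suc i) < w (Suc k))" if "i < n" "k < n" "M $$ (i, k) \<noteq> 0" for i k
    using M that value_rel_word2[OF p] unfolding incidence_def by blast
  note Dn = pp_data_pred[OF p]
  have Yt: "Y * ?t = M"
  proof (rule eq_matI)
    fix i k assume "i < dim_row M" "k < dim_col M"
    hence ik: "i < n" "k < n" using Mc by auto
    have e: "(Y * ?t) $$ (i, k) = (if Suc k \<in> D then Y $$ (i, w (Suc k) - 1) else 0)"
      by (rule pp_mat_mult_right[OF p Yc ik])
    show "(Y * ?t) $$ (i, k) = M $$ (i, k)"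
    proof (cases "Suc k \<in> D")
      case True
      hence "Suc (w (Suc k) - 1) \<in> w ` D" using Dn(4)[OF True] by simp
      hence "Y $$ (i, w (Suc k) - 1) = M $$ (i, k)"
        using ik Dn(3)[OF True] Dn(4)[OF True] v[OF True] unfolding Y_def by simp
      thus ?thesis using e True by simp
    next
      case False thus ?thesis using e Mnz[OF ik] by auto
    qed
  qed (use Mc Yc pp_mat_carrier[of n D w] in auto)
  have "Y * ?t \<in> strictly_upper n" unfolding Yt by (rule strictly_upperI[OF Mc]) (use Mnz in blast)
  moreover have "?t * Y \<in> strictly_upper n"
  proof (rule strictly_upperI)
    show "?t * Y \<in> carrier_mat n n" using pp_mat_carrier Yc by (rule mult_carrier_mat)
    fix i k assume ik: "i < n" "k < n" "(?t * Y) $$ (i, k) \<noteq> 0"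
    obtain a where a: "a \<in> D" "w a = Suc i" using pp_mat_mult_left(2)[OF p Yc ik(1,2)] ik(3) by (metis imageE)
    have Ya: "Y $$ (a - 1, k) \<noteq> 0" using pp_mat_mult_left(1)[OF p Yc ik(1,2) a] ik(3) by simp
    hence "Suc k \<in> w ` D" using Dn(1)[OF a(1)] ik unfolding Y_def by (auto split: if_splits)
    then obtain b where b: "b \<in> D" "w b = Suc k" by (metis imageE)
    have "M $$ (a - 1, b - 1) \<noteq> 0" using Ya Dn(1)[OF a(1)] ik b v[OF b(1)] unfolding Y_def by (auto split: if_splits)
    from Mnz[OF Dn(1)[OF a(1)] Dn(1)[OF b(1)] this] have "w a < w b" using a b Dn(2)[OF a(1)] Dn(2)[OF b(1)] by auto
    thus "i < k" using a b by simp
  qed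
  ultimately show ?thesis using Yt Yc unfolding conormal_fibre_def by blast
qed

lemma strictly_upper_line:
  assumes "A \<in> strictly_upper n" "B \<in> strictly_upper n"
  shows "A + t \<cdot>\<^sub>m (B - A) \<in> strictly_upper n"
  using assms unfolding strictly_upper_def by auto

lemma fibre_line:
  assumes t: "\<tau> \<in> carrier_mat n n" and Y: "Y \<in> conormal_fibre n \<tau>" "Z \<in> conormal_fibre n \<tau>"
  shows "line Y (Z - Y) s \<in> conormal_fibre n \<tau>"
    "\<tau> * line Y (Z - Y) s = line (\<tau> * Y) (\<tau> * Z - \<tau> * Y) s" "line Y (Z - Y) s * \<tau> = line (Y * \<tau>) (Z * \<tau> - Y * \<tau>) s"
proof -
  have c: "Y \<in> carrier_mat n n" "Z \<in> carrier_mat n n" using Y unfolding conormal_fibre_def by auto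
  have E: "Z - Y \<in> carrier_mat n n" by (rule minus_carrier_mat[OF c(1)])
  show 1: "\<tau> * line Y (Z - Y) s = line (\<tau> * Y) (\<tau> * Z - \<tau> * Y) s"
    unfolding line_def mult_add_distrib_mat[OF t c(1) smult_carrier_mat[OF E]] mult_smult_distrib[OF t E]
      mult_minus_distrib_mat[OF t c(2,1)] ..
  show 2: "line Y (Z - Y) s * \<tau> = line (Y * \<tau>) (Z * \<tau> - Y * \<tau>) s"
    unfolding line_def add_mult_distrib_mat[OF c(1) smult_carrier_mat[OF E] t] mult_smult_assoc_mat[OF E t]
      minus_mult_distrib_mat[OF c(2,1) t] ..
  show "line Y (Z - Y) s \<in> conormal_fibre n \<tau>"
    using strictly_upper_line Y c t 1 2 unfolding conormal_fibre_def line_def by auto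
qed

lemma fibre_generic:
  assumes p: "pp_data n D w"
    and g: "generic_type n (value_rel (word1 n D w)) \<alpha>" "generic_type n (value_rel (rev (word2 n D w))) \<beta>"
  shows "\<exists>Y\<in>conormal_fibre n (pp_mat n D w). pp_mat n D w * Y \<in> nilpotent_orbit n \<alpha> \<and> Y * pp_mat n D w \<in> nilpotent_orbit n \<beta>"
proof -
  let ?t = "pp_mat n D w"
  obtain M where M: "M \<in> incidence n (value_rel (word1 n D w))" "M \<in> nilpotent_orbit n \<alpha>" using g(1) unfolding generic_type_def by blast
  obtain N where N: "N \<in> incidence n (value_rel (rev (word2 n D w)))" "N \<in> nilpotent_orbit n \<beta>" using g(2) unfolding generic_type_def by blast
  obtain Y where Y: "Y \<in> conormal_fibre n ?t" "?t * Y = M" using incidence_fibre1[OF p M(1)] by blast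
  obtain Z where Z: "Z \<in> conormal_fibre n ?t" "Z * ?t = N" using incidence_fibre2[OF p N(1)] by blast
  have c: "Y \<in> carrier_mat n n" "Z \<in> carrier_mat n n" using Y Z unfolding conormal_fibre_def by auto
  \<comment> \<open>The line starts at a point that is generic for the first product and reaches at
    1 a point that is generic for the second; it stays in the fibre, which is linear.\<close>
  let ?L = "line Y (Z - Y)"
  note L = fibre_line[OF pp_mat_carrier Y(1) Z(1)]
  have L0: "?L 0 = Y" and L1: "?L 1 = Z" unfolding line_def using c by (auto intro!: eq_matI)
  have lp: "mat_poly_on UNIV {\<lambda>t. t} n ?L" by (rule line_poly) (use c in auto)
  have f1: "finite {s. ?t * ?L s \<notin> nilpotent_orbit n \<alpha>}"
    by (rule generic_type_generic[OF g(1) mat_poly_on_mult[OF mat_poly_on_const[OF pp_mat_carrier] lp] fibre_incidence(1)[OF p L(1)], of 0])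
       (use L0 Y M in simp)
  have f2: "finite {s. ?L s * ?t \<notin> nilpotent_orbit n \<beta>}"
    by (rule generic_type_generic[OF g(2) mat_poly_on_mult[OF lp mat_poly_on_const[OF pp_mat_carrier]] fibre_incidence(2)[OF p L(1)], of 1])
       (use L1 Z N in simp)
  obtain s where "s \<notin> {s. ?t * ?L s \<notin> nilpotent_orbit n \<alpha>} \<union> {s. ?L s * ?t \<notin> nilpotent_orbit n \<beta>}"
    using ex_new_if_finite[OF infinite_UNIV_char_0] f1 f2 by (metis finite_UnI)
  thus ?thesis using L(1)[of s] by blast
qed

section \<open>Reduction to the fibre by triangular matrices\<close>

lemma invertible_inverse:
  assumes "b \<in> carrier_mat n n" "invertible_mat b"
  obtains c where "b * c = 1\<^sub>m n" "c * b = 1\<^sub>m n" "c \<in> carrier_mat n n"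
  using assms unfolding invertible_mat_def inverts_mat_def
  by (metis carrier_matD carrier_matI index_mult_mat(2,3) index_one_mat(2,3))

lemma borel_diag:
  assumes "b \<in> borel_group n" "i < n" shows "b $$ (i, i) \<noteq> 0"
proof -
  have b: "b \<in> carrier_mat n n" "upper_triangular b" "invertible_mat b" using assms unfolding borel_group_def by auto
  obtain c where c: "b * c = 1\<^sub>m n" "c \<in> carrier_mat n n" using invertible_inverse[OF b(1,3)] by blast
  have "det b * det c = 1" using det_mult[OF b(1) c(2)] c(1) by simp
  hence "det b \<noteq> 0" by auto
  hence "prod_list (diag_mat b) \<noteq> 0" using det_upper_triangular[OF b(2,1)] by simp
  thus ?thesis using assms(2) b(1) unfolding diag_mat_def by (auto simp: prod_list_zero_iff)
qed

lemma upper_mult_strict: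
  assumes b: "b \<in> carrier_mat n n" "upper_triangular b" and Z: "Z \<in> strictly_upper n"
  shows "b * Z \<in> strictly_upper n" "Z * b \<in> strictly_upper n"
proof -
  have Zc: "Z \<in> carrier_mat n n" using Z unfolding strictly_upper_def by simp
  have bz: "b $$ (i, j) \<noteq> 0 \<Longrightarrow> i \<le> j" if "i < n" "j < n" for i j
    using b that unfolding upper_triangular_def by (metis carrier_matD(1) not_le)
  show "b * Z \<in> strictly_upper n"
  proof (rule strictly_upperI)
    fix i k assume ik: "i < n" "k < n" "(b * Z) $$ (i, k) \<noteq> 0"
    have "(b * Z) $$ (i, k) = (\<Sum>l<n. b $$ (i, l) * Z $$ (l, k))" by (rule mat_mult_index[OF b(1) Zc ik(1,2)])
    then obtain l where "l < n" "b $$ (i, l) \<noteq> 0" "Z $$ (l, k) \<noteq> 0"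
      using ik(3) by (metis (no_types, lifting) lessThan_iff mult_not_zero sum.not_neutral_contains_not_neutral)
    thus "i < k" using bz[OF ik(1)] strictly_upperD[OF Z _ ik(2)] by (meson le_less_trans)
  qed (use b Zc in simp)
  show "Z * b \<in> strictly_upper n"
  proof (rule strictly_upperI)
    fix i k assume ik: "i < n" "k < n" "(Z * b) $$ (i, k) \<noteq> 0"
    have "(Z * b) $$ (i, k) = (\<Sum>l<n. Z $$ (i, l) * b $$ (l, k))" by (rule mat_mult_index[OF Zc b(1) ik(1,2)])
    then obtain l where "l < n" "Z $$ (i, l) \<noteq> 0" "b $$ (l, k) \<noteq> 0"
      using ik(3) by (metis (no_types, lifting) lessThan_iff mult_not_zero sum.not_neutral_contains_not_neutral)
    thus "i < k" using bz[OF _ ik(2)] strictly_upperD[OF Z ik(1)] by (meson less_le_trans)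
  qed (use b Zc in simp)
qed

text \<open>Back substitution from the last row upwards, with \<open>d\<close> counting the rows
  from the bottom. It does the work of the triangularity of the inverse of \<open>b\<close>.\<close>

lemma borel_cancel_left:
  assumes b: "b \<in> borel_group n" and Z: "Z \<in> carrier_mat n n" and bZ: "b * Z \<in> strictly_upper n"
  shows "Z \<in> strictly_upper n"
proof -
  have bc: "b \<in> carrier_mat n n" "upper_triangular b" using b unfolding borel_group_def by auto
  have "\<forall>k\<le>n - d. k < n \<longrightarrow> Z $$ (n - d, k) = 0" if "d \<le> n" "0 < d" for d
    using that
  proof (induct d rule: less_induct)
    case (less d)
    let ?i = "n - d"
    have i: "?i < n" using less.prems by simp
    show ?case
    proof (intro allI impI)
      fix k assume k: "k \<le> ?i" "k < n"
      have z: "Z $$ (l, k) = 0" if "?i < l" "l < n" for l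
        using less.hyps[of "n - l"] that k less.prems by auto
      have "(b * Z) $$ (?i, k) = (\<Sum>l<n. b $$ (?i, l) * Z $$ (l, k))" by (rule mat_mult_index[OF bc(1) Z i k(2)])
      also have "\<dots> = (\<Sum>l<n. if l = ?i then b $$ (?i, ?i) * Z $$ (?i, k) else 0)"
      proof (rule sum.cong)
        fix l assume l: "l \<in> {..<n}"
        show "b $$ (?i, l) * Z $$ (l, k) = (if l = ?i then b $$ (?i, ?i) * Z $$ (?i, k) else 0)"
        proof (rule linorder_cases[of l ?i])
          assume "l < ?i"
          hence "b $$ (?i, l) = 0" using bc i unfolding upper_triangular_def by auto
          thus ?thesis using \<open>l < ?i\<close> by simp
        next
          assume "?i < l" thus ?thesis using z[of l] l by simp
        qed simp
      qed simp
      also have "\<dots> = b $$ (?i, ?i) * Z $$ (?i, k)" using i by simp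
      finally have "b $$ (?i, ?i) * Z $$ (?i, k) = 0" using strictly_upperD[OF bZ i k(2)] k(1) by fastforce
      thus "Z $$ (?i, k) = 0" using borel_diag[OF b i] by simp
    qed
  qed
  hence "Z $$ (i, k) = 0" if "i < n" "k \<le> i" for i k
    using that by (metis diff_diff_cancel diff_le_self le_less_trans less_imp_le zero_less_diff)
  thus ?thesis using Z unfolding strictly_upper_def by auto
qed

text \<open>The same elimination, by columns from the left.\<close>

lemma borel_cancel_right:
  assumes b: "b \<in> borel_group n" and Z: "Z \<in> carrier_mat n n" and bZ: "Z * b \<in> strictly_upper n"
  shows "Z \<in> strictly_upper n"
proof -
  have bc: "b \<in> carrier_mat n n" "upper_triangular b" using b unfolding borel_group_def by auto
  have "\<forall>i<n. k \<le> i \<longrightarrow> Z $$ (i, k) = 0" if "k < n" for k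
    using that
  proof (induct k rule: less_induct)
    case (less k)
    show ?case
    proof (intro allI impI)
      fix i assume i: "i < n" "k \<le> i"
      have z: "Z $$ (i, l) = 0" if "l < k" for l using less that i by auto
      have "(Z * b) $$ (i, k) = (\<Sum>l<n. Z $$ (i, l) * b $$ (l, k))" by (rule mat_mult_index[OF Z bc(1) i(1) less.prems])
      also have "\<dots> = (\<Sum>l<n. if l = k then Z $$ (i, k) * b $$ (k, k) else 0)"
      proof (rule sum.cong)
        fix l assume l: "l \<in> {..<n}"
        show "Z $$ (i, l) * b $$ (l, k) = (if l = k then Z $$ (i, k) * b $$ (k, k) else 0)"
        proof (rule linorder_cases[of l k])
          assume "l < k" thus ?thesis using z[of l] by simp
        next
          assume "k < l"
          hence "b $$ (l, k) = 0" using bc l unfolding upper_triangular_def by auto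
          thus ?thesis using \<open>k < l\<close> by simp
        qed simp
      qed simp
      also have "\<dots> = Z $$ (i, k) * b $$ (k, k)" using less.prems by simp
      finally have "Z $$ (i, k) * b $$ (k, k) = 0" using strictly_upperD[OF bZ i(1) less.prems] i(2) by fastforce
      thus "Z $$ (i, k) = 0" using borel_diag[OF b less.prems] by simp
    qed
  qed
  thus ?thesis using Z unfolding strictly_upper_def by auto
qed

lemma invertible_commute_similar:
  assumes b: "b \<in> carrier_mat n n" "invertible_mat b" and Z: "Z \<in> carrier_mat n n"
  shows "similar_mat (b * Z) (Z * b)"
proof -
  obtain c where c: "b * c = 1\<^sub>m n" "c * b = 1\<^sub>m n" "c \<in> carrier_mat n n"
    using invertible_inverse[OF b] by blast
  have "b * (Z * b) * c = (b * Z) * (b * c)" using b(1) Z c(3) by (simp add: assoc_mult_mat[of _ n n _ n _ n])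
  hence "b * Z = b * (Z * b) * c" using c(1) b(1) Z by simp
  thus ?thesis by (intro similar_matI[of _ _ b c n]) (use b Z c in auto)
qed

text \<open>For \<open>x = b \<tau> c\<close> the choice \<open>Y = c y b\<close> makes
  \<open>x y\<close> and \<open>\<tau> Y\<close> equal to \<open>b Z\<close> and \<open>Z b\<close>
  with the same \<open>Z = \<tau> c y\<close>. Hence they are conjugate, and cancelling
  \<open>b\<close> on one side and restoring it on the other preserves strict triangularity. The
  products in the other order are treated alike with \<open>c\<close>.\<close>

lemma phi_double_coset:
  assumes t: "\<tau> \<in> carrier_mat n n" and xy: "(x, y) \<in> conormal n" "x \<in> double_coset n \<tau>"
  shows "\<exists>Y\<in>conormal_fibre n \<tau>. similar_mat (x * y) (\<tau> * Y) \<and> similar_mat (y * x) (Y * \<tau>)"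
proof -
  obtain b c where bc: "b \<in> borel_group n" "c \<in> borel_group n" "x = b * \<tau> * c" using xy(2) unfolding double_coset_def by blast
  have b: "b \<in> carrier_mat n n" "invertible_mat b" "upper_triangular b" and c: "c \<in> carrier_mat n n" "invertible_mat c" "upper_triangular c"
    using bc unfolding borel_group_def by auto
  have y: "y \<in> carrier_mat n n" and u: "x * y \<in> strictly_upper n" "y * x \<in> strictly_upper n" using xy(1) unfolding conormal_def by auto
  let ?Y = "c * y * b" and ?Z = "\<tau> * c * y" and ?W = "y * b * \<tau>"
  have Zc: "?Z \<in> carrier_mat n n" and Wc: "?W \<in> carrier_mat n n" using t b c y by auto
  have xy': "x * y = b * ?Z" "y * x = ?W * c" and tY: "\<tau> * ?Y = ?Z * b" "?Y * \<tau> = c * ?W"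
    unfolding bc(3) using t b(1) c(1) y by (simp_all add: assoc_mult_mat[of _ n n _ n _ n])
  have "?Z \<in> strictly_upper n" by (rule borel_cancel_left[OF bc(1) Zc]) (use u xy' in simp)
  hence 1: "\<tau> * ?Y \<in> strictly_upper n" unfolding tY by (rule upper_mult_strict(2)[OF b(1,3)])
  have "?W \<in> strictly_upper n" by (rule borel_cancel_right[OF bc(2) Wc]) (use u xy' in simp)
  hence 2: "?Y * \<tau> \<in> strictly_upper n" unfolding tY by (rule upper_mult_strict(1)[OF c(1,3)])
  have "?Y \<in> conormal_fibre n \<tau>" unfolding conormal_fibre_def using 1 2 b c y by auto
  moreover have "similar_mat (x * y) (\<tau> * ?Y)" unfolding xy' tY by (rule invertible_commute_similar[OF b(1,2) Zc])
  moreover have "similar_mat (y * x) (?Y * \<tau>)" unfolding xy' tY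
    by (rule similar_mat_sym[OF invertible_commute_similar[OF c(1,2) Wc]])
  ultimately show ?thesis by blast
qed

section \<open>Evaluation of the Steinberg map\<close>

lemma nilpotent_orbit_conjugate:
  assumes "M \<in> nilpotent_orbit n p" "N \<in> nilpotent_orbit n p" shows "similar_mat M N"
  using assms unfolding nilpotent_orbit_def jordan_nf_def by (auto intro: similar_mat_trans similar_mat_sym)

lemma zariski_closure_least: "S \<subseteq> zariski_closure X cs T \<Longrightarrow> zariski_closure X cs S \<subseteq> zariski_closure X cs T"
  unfolding zariski_closure_def by blast

text \<open>A generic point of the fibre already produces the full product of orbits by saturation.
  Conversely, every point over the double coset is conjugate to the image of a fibre point, and the
  product of orbit closures is closed and stable under both conjugations.\<close>

lemma Steinberg_value:
  assumes p: "pp_data n D w"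
    and g: "generic_type n (value_rel (word1 n D w)) \<alpha>" "generic_type n (value_rel (rev (word2 n D w))) \<beta>"
  shows "is_Steinberg_value n (pp_mat n D w) (\<alpha>, \<beta>)"
proof -
  let ?t = "pp_mat n D w" and ?O = "nilpotent_orbit n \<alpha> \<times> nilpotent_orbit n \<beta>"
  let ?S = "{(x, y) \<in> conormal n. x \<in> double_coset n ?t}" and ?C = "GL_GL_saturation (phi ` Y_component n ?t)"
  have tc: "?t \<in> carrier_mat n n" by (rule pp_mat_carrier)
  have Oc: "nilpotent_orbit n q \<subseteq> carrier_mat n n" for q using nilpotent_orbit_carrier by blast
  have OO: "closure_MM n ?O = closure_M n (nilpotent_orbit n \<alpha>) \<times> closure_M n (nilpotent_orbit n \<beta>)"
    by (rule closure_MM_Times[OF Oc Oc])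
  have Sc: "?S \<subseteq> carrier_mat n n \<times> carrier_mat n n" unfolding conormal_def by auto
  have SY: "?S \<subseteq> Y_component n ?t" unfolding Y_component_def closure_MM_def by (rule zariski_closure_subset[OF Sc])
  have "?O \<subseteq> ?C"
  proof
    fix z assume "z \<in> ?O"
    then obtain a b where z: "z = (a, b)" "a \<in> nilpotent_orbit n \<alpha>" "b \<in> nilpotent_orbit n \<beta>" by auto
    obtain Y where Y: "Y \<in> conormal_fibre n ?t" "?t * Y \<in> nilpotent_orbit n \<alpha>" "Y * ?t \<in> nilpotent_orbit n \<beta>"
      using fibre_generic[OF p g] by blast
    have one: "1\<^sub>m n \<in> borel_group n"
      unfolding borel_group_def invertible_mat_def inverts_mat_def
      by (auto simp: upper_triangular_def intro!: exI[of _ "1\<^sub>m n"])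
    have "?t = 1\<^sub>m n * ?t * 1\<^sub>m n" using tc by simp
    hence "?t \<in> double_coset n ?t" using one unfolding double_coset_def by blast
    hence "(?t, Y) \<in> ?S" using Y(1) tc unfolding conormal_def conormal_fibre_def by auto
    hence "(?t * Y, Y * ?t) \<in> phi ` Y_component n ?t" using SY unfolding phi_def by force
    thus "z \<in> ?C" using nilpotent_orbit_conjugate[OF z(2) Y(2)] nilpotent_orbit_conjugate[OF z(3) Y(3)]
      unfolding GL_GL_saturation_def z(1) by blast
  qed
  hence 1: "closure_MM n ?O \<subseteq> closure_MM n ?C" unfolding closure_MM_def by (rule zariski_closure_mono)
  have fib: "(x * y, y * x) \<in> closure_MM n ?O" if xy: "(x, y) \<in> ?S" for x y
  proof -
    obtain Y where Y: "Y \<in> conormal_fibre n ?t" "similar_mat (x * y) (?t * Y)" "similar_mat (y * x) (Y * ?t)"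
      using phi_double_coset[OF tc, of x y] xy by blast
    have "?t * Y \<in> closure_M n (nilpotent_orbit n \<alpha>)" "Y * ?t \<in> closure_M n (nilpotent_orbit n \<beta>)"
      using fibre_incidence[OF p Y(1)] g unfolding generic_type_def by blast+
    thus ?thesis unfolding OO using closure_orbit_similar Y(2,3) by blast
  qed
  have "?C \<subseteq> closure_MM n ?O"
  proof
    fix z assume "z \<in> ?C"
    then obtain a b x y where z: "z = (a, b)" "(x, y) \<in> Y_component n ?t" "similar_mat a (x * y)" "similar_mat b (y * x)"
      unfolding GL_GL_saturation_def phi_def by auto
    have "(fst (x, y) * snd (x, y), snd (x, y) * fst (x, y)) \<in> closure_MM n ?O"
      by (rule closure_MM_map[OF z(2)[unfolded Y_component_def closure_MM_alt] Sc
            mat_poly_on_mult[OF mat_poly_on_fst mat_poly_on_snd] mat_poly_on_mult[OF mat_poly_on_snd mat_poly_on_fst]])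
         (use fib in auto)
    thus "z \<in> closure_MM n ?O" unfolding OO z(1) using closure_orbit_similar z(3,4) by auto
  qed
  hence 2: "closure_MM n ?C \<subseteq> closure_MM n ?O" unfolding closure_MM_def by (rule zariski_closure_least)
  have "\<alpha> \<in> partitions n" "\<beta> \<in> partitions n" using g unfolding generic_type_def by auto
  thus ?thesis unfolding is_Steinberg_value_def using 1 2 OO by auto
qed

lemma closure_orbit_inj:
  assumes p: "p \<in> partitions n" and q: "q \<in> partitions n"
    and e: "closure_M n (nilpotent_orbit n p) = closure_M n (nilpotent_orbit n q)"
  shows "p = q"
proof -
  have sub: "nilpotent_orbit n r \<subseteq> closure_M n (nilpotent_orbit n r)" for r
    unfolding closure_M_def by (rule zariski_closure_subset) (use nilpotent_orbit_carrier in blast)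
  obtain M where M: "M \<in> nilpotent_orbit n p" using nilpotent_orbit_nonempty[OF p] by blast
  obtain N where N: "N \<in> nilpotent_orbit n q" using nilpotent_orbit_nonempty[OF q] by blast
  show ?thesis
    by (rule closure_orbit_antisym[OF p q M _ N]) (use M N sub e in blast)+
qed

lemma Steinberg_value_unique:
  assumes "is_Steinberg_value n \<tau> p" "is_Steinberg_value n \<tau> q" shows "p = q"
proof -
  obtain \<alpha> \<beta> where p: "p = (\<alpha>, \<beta>)" by force
  obtain \<gamma> \<delta> where q: "q = (\<gamma>, \<delta>)" by force
  have P: "\<alpha> \<in> partitions n" "\<beta> \<in> partitions n" "\<gamma> \<in> partitions n" "\<delta> \<in> partitions n"
    and e: "closure_M n (nilpotent_orbit n \<alpha>) \<times> closure_M n (nilpotent_orbit n \<beta>) =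
      closure_M n (nilpotent_orbit n \<gamma>) \<times> closure_M n (nilpotent_orbit n \<delta>)"
    using assms unfolding p q is_Steinberg_value_def by auto
  \<comment> \<open>Nonemptiness is what lets a product of sets determine its factors.\<close>
  have ne: "closure_M n (nilpotent_orbit n r) \<noteq> {}" if "r \<in> partitions n" for r
    using nilpotent_orbit_nonempty[OF that] zariski_closure_subset[of "nilpotent_orbit n r" "carrier_mat n n"] nilpotent_orbit_carrier
    unfolding closure_M_def by blast
  have "closure_M n (nilpotent_orbit n \<alpha>) = closure_M n (nilpotent_orbit n \<gamma>)"
    "closure_M n (nilpotent_orbit n \<beta>) = closure_M n (nilpotent_orbit n \<delta>)"
    using e ne P unfolding times_eq_iff by auto
  thus ?thesis unfolding p q using closure_orbit_inj P by simp
qed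

text \<open>The first word has the shape of its insertion tableau as type. For the second word the
  type belongs to the reversed word, and it is the shape of the transposed insertion tableau, which
  is the second tableau itself.\<close>

lemma Steinberg_map:
  assumes t: "\<tau> \<in> partial_perms n"
  shows "(\<exists>!p. is_Steinberg_value n \<tau> p) \<and> Phi n \<tau> = (shape (T1 n \<tau>), shape (T2 n \<tau>))"
proof -
  let ?D = "pp_dom n \<tau>" and ?w = "pp_map n \<tau>"
  note p = pp_pp_data[OF t]
  note d = distinct_words[OF p]
  have "generic_type n (value_rel (word1 n ?D ?w)) (shape (T1 n \<tau>))"
    unfolding T1_ins_T1 ins_T1_eq[OF p] by (rule generic_type_value_rel[OF d(1,2) word_type_ptab[OF d(1)]])
  moreover have "generic_type n (value_rel (rev (word2 n ?D ?w))) (shape (T2 n \<tau>))"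
    unfolding T2_ins_T2 ins_T2_eq[OF p] by (rule generic_type_value_rel[OF _ _ word_type_ptab_transpose[OF d(3)]]) (use d(3,4) in auto)
  ultimately have s: "is_Steinberg_value n \<tau> (shape (T1 n \<tau>), shape (T2 n \<tau>))"
    using Steinberg_value[OF p] pp_mat_pp[OF t] by simp
  hence "Phi n \<tau> = (shape (T1 n \<tau>), shape (T2 n \<tau>))"
    unfolding Phi_def by (rule the_equality) (rule Steinberg_value_unique[OF _ s])
  thus ?thesis using s Steinberg_value_unique by blast
qed

theorem theorem1p7:
  fixes n :: nat
  assumes "n \<ge> 1"
  shows
    "(\<forall>\<tau>\<in>partial_perms n.
        (\<exists>!p. is_Steinberg_value n \<tau> p) \<and>
        Phi n \<tau> = (shape (T1 n \<tau>), shape (T2 n \<tau>))) \<and>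
     bij_betw (\<lambda>\<tau>. (T1 n \<tau>, T2 n \<tau>, nu n \<tau>)) (partial_perms n) (\<Union>r\<in>{0..n}. Upsilon n r) \<and>
     (\<forall>w. w permutes {1..n} \<longrightarrow>
        perm_mat n w \<in> partial_perms n \<and>
        T1 n (perm_mat n w) = RS1 {1..n} w \<and>
        T2 n (perm_mat n w) = RS2 {1..n} w \<and>
        nu n (perm_mat n w) = shape (RS1 {1..n} w) \<and>
        shape (RS1 {1..n} w) = shape (RS2 {1..n} w) \<and>
        (T1 n (perm_mat n w), T2 n (perm_mat n w), nu n (perm_mat n w)) \<in> Upsilon n n)"
  using Steinberg_map bij_triples permutation_case by blast

end
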